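(* Let $d\ge 1$, $T>0$, let $a:[0,T]\times\mathbb{R}^d\to\mathbb{R}_+$ be a Borel function, and let $z^0\in\mathcal{M}(\mathbb{R}^d)$. Let $z_1,z_2:[0,T]\to\mathcal{M}(\mathbb{R}^d)$ be continuous with respect to the weak topology on finite measures, and suppose that both $z_1$ and $z_2$ solve $\partial_t z=\Delta(az)$ in the sense of distributions with initial condition $z(0,\cdot)=z^0$, i.e. for $i=1,2$, every $t\in[0,T]$ and every $\phi\in\mathcal{S}(\mathbb{R}^d)$, \[\int_{\mathbb{R}^d}\phi(x)\,z_i(t,dx)=\int_{\mathbb{R}^d}\phi(x)\,z^0(dx)+\int_0^t ds\int_{\mathbb{R}^d}\Delta\phi(x)\,a(s,x)\,z_i(s,dx).\] Set $z:=z_1-z_2$ and assume the following Hypothesis (B): there is $\tilde z\in L^1_{loc}([0,T]\times\mathbb{R}^d)$ such that $z(t,\cdot)$ admits $\tilde z(t,\cdot)$ as density for almost all $t\in[0,T]$ (we write $z$ for $\tilde z$), and either (B1) or (B2) holds: (B1) (i) $\int_{[0,T]\times\mathbb{R}^d}|z(t,x)|^2\,dt\,dx<+\infty$ and (ii) $\int_{[0,T]\times\mathbb{R}^d}|az|^2(t,x)\,dt\,dx<+\infty$; (B2) $d=1$, and for every $t_0>0$: (i) $\int_{[t_0,T]\times\mathbb{R}}|z(t,x)|^2\,dt\,dx<+\infty$, (ii) $\int_{[0,T]\times\mathbb{R}}|az|(t,x)\,dt\,dx<+\infty$, (iii) $\int_{[t_0,T]\times\mathbb{R}}|az|^2(t,x)\,dt\,dx<+\infty$.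 Then $z(t,\cdot)=(z_1-z_2)(t,\cdot)$ is identically zero for every $t\in[0,T]$.
   Context: $\mathcal{M}(\mathbb{R}^d)$ denotes the set of finite (signed) Borel measures on $\mathbb{R}^d$; $\mathcal{S}(\mathbb{R}^d)$ is the Schwartz space of rapidly decreasing smooth functions; $\Delta$ is the Laplacian in $x$. *)

theory Defs
  imports "HOL-Analysis.Analysis"
begin

text \<open>Finite signed Borel measures on a Euclidean space, represented by their
  Jordan decomposition: a pair (positive part, negative part) of mutually
  singular finite Borel measures.  Every finite signed measure arises this way
  (and uniquely).\<close>

type_synonym 'a smeasure = "'a measure \<times> 'a measure"

definition fin_smeasure :: "'a::euclidean_space smeasure \<Rightarrow> bool" where
  "fin_smeasure z \<longleftrightarrow>
     sets (fst z) = sets borel \<and> sets (snd z) = sets borel \<and>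
     finite_measure (fst z) \<and> finite_measure (snd z) \<and>
     (\<exists>A\<in>sets borel. emeasure (fst z) (UNIV - A) = 0 \<and> emeasure (snd z) A = 0)"

definition sval :: "'a smeasure \<Rightarrow> 'a set \<Rightarrow> real" where
  "sval z A = measure (fst z) A - measure (snd z) A"

definition sintegrable :: "'a smeasure \<Rightarrow> ('a \<Rightarrow> real) \<Rightarrow> bool" where
  "sintegrable z f \<longleftrightarrow> integrable (fst z) f \<and> integrable (snd z) f"

definition sint :: "'a smeasure \<Rightarrow> ('a \<Rightarrow> real) \<Rightarrow> real" where
  "sint z f = integral\<^sup>L (fst z) f - integral\<^sup>L (snd z) f"

definition weakly_continuous_on :: "real set \<Rightarrow> (real \<Rightarrow> 'a::euclidean_space smeasure) \<Rightarrow> bool" where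
  "weakly_continuous_on S z \<longleftrightarrow>
     (\<forall>f::'a \<Rightarrow> real. continuous_on UNIV f \<and> bounded (range f) \<longrightarrow>
        continuous_on S (\<lambda>t. sint (z t) f))"

definition dir_deriv :: "'a::euclidean_space \<Rightarrow> ('a \<Rightarrow> real) \<Rightarrow> 'a \<Rightarrow> real" where
  "dir_deriv b f x = frechet_derivative f (at x) b"

fun iter_pderiv :: "'a::euclidean_space list \<Rightarrow> ('a \<Rightarrow> real) \<Rightarrow> 'a \<Rightarrow> real" where
  "iter_pderiv [] f = f"
| "iter_pderiv (b # bs) f = dir_deriv b (iter_pderiv bs f)"

definition schwartz :: "('a::euclidean_space \<Rightarrow> real) \<Rightarrow> bool" where
  "schwartz f \<longleftrightarrow>
     (\<forall>bs. set bs \<subseteq> Basis \<longrightarrow>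
        (\<forall>x. iter_pderiv bs f differentiable (at x)) \<and>
        (\<forall>m::nat. bounded (range (\<lambda>x. (1 + norm x) ^ m * iter_pderiv bs f x))))"

definition laplacian :: "('a::euclidean_space \<Rightarrow> real) \<Rightarrow> 'a \<Rightarrow> real" where
  "laplacian f x = (\<Sum>b\<in>Basis. (deriv ^^ 2) (\<lambda>r. f (x + r *\<^sub>R b)) 0)"

definition dist_solution ::
  "real \<Rightarrow> (real \<Rightarrow> 'a::euclidean_space \<Rightarrow> real) \<Rightarrow> 'a smeasure \<Rightarrow> (real \<Rightarrow> 'a smeasure) \<Rightarrow> bool" where
  "dist_solution T a z0 z \<longleftrightarrow>
     (\<forall>\<phi>. schwartz \<phi> \<longrightarrow>
        (AE s in lborel. s \<in> {0..T} \<longrightarrow> sintegrable (z s) (\<lambda>x. laplacian \<phi> x * a s x)) \<and>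
        set_integrable lborel {0..T} (\<lambda>s. sint (z s) (\<lambda>x. laplacian \<phi> x * a s x)) \<and>
        (\<forall>t\<in>{0..T}. sint (z t) \<phi> =
            sint z0 \<phi> + (LINT s:{0..t}|lborel. sint (z s) (\<lambda>x. laplacian \<phi> x * a s x))))"

definition L1_loc_strip :: "real \<Rightarrow> (real \<Rightarrow> 'a::euclidean_space \<Rightarrow> real) \<Rightarrow> bool" where
  "L1_loc_strip T g \<longleftrightarrow>
     (\<lambda>p. g (fst p) (snd p)) \<in> borel_measurable (lborel :: (real \<times> 'a) measure) \<and>
     (\<forall>K. compact K \<and> K \<subseteq> {0..T} \<times> UNIV \<longrightarrow>
        set_integrable (lborel :: (real \<times> 'a) measure) K (\<lambda>p. g (fst p) (snd p)))"

definition finite_strip_integral :: "real \<Rightarrow> real \<Rightarrow> (real \<Rightarrow> 'a::euclidean_space \<Rightarrow> real) \<Rightarrow> bool" where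
  "finite_strip_integral t0 t1 h \<longleftrightarrow>
     (\<integral>\<^sup>+ p. indicator ({t0..t1} \<times> UNIV) p * ennreal (h (fst p) (snd p))
        \<partial>(lborel :: (real \<times> 'a) measure)) < \<infinity>"

end

theory Submission
  imports Defs "HOL-Probability.Distributions"
begin

text \<open>
  Let \<open>z\<close> be the difference of the two solutions and \<open>p\<^sub>r\<close> the heat kernel at time \<open>r\<close>. Put
  \<open>G(t,r) = \<langle>z(t), p\<^sub>r * z(t)\<rangle>\<close> and \<open>H\<^sub>t(r) = \<integral>\<^sub>0\<^sup>t \<langle>p\<^sub>r * z(s), (az)(s)\<rangle> ds\<close>. By the semigroup property
  \<open>G \<ge> 0\<close>. Testing the equation against \<open>p\<^sub>r\<close> and using \<open>\<Delta>p\<^sub>r = \<partial>\<^sub>r p\<^sub>r\<close> gives \<open>G(t,r) = 2 \<partial>\<^sub>r H\<^sub>t(r)\<close>, so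
  \<open>H\<^sub>t\<close> is nondecreasing in \<open>r\<close>. It tends to \<open>0\<close> as \<open>r \<rightarrow> \<infinity>\<close> because \<open>p\<^sub>r\<close> decays, and, up to the mass of
  \<open>p\<^sub>r\<close>, to \<open>\<integral>\<integral> a z\<^sup>2 \<ge> 0\<close> as \<open>r \<rightarrow> 0\<close>. Hence \<open>H\<^sub>t = 0\<close> and \<open>G = 0\<close>, which forces \<open>z(t) = 0\<close>.
  Under (B2) the limit \<open>r \<rightarrow> 0\<close> is only available on \<open>[t\<^sub>0, t]\<close>; the remaining term
  \<open>\<integral>\<^sub>0\<^sup>1 G(t\<^sub>0,r) dr\<close> vanishes as \<open>t\<^sub>0 \<rightarrow> 0\<close> since \<open>G(t\<^sub>0,r) \<le> C r\<^bsup>-1/2\<^esup>\<close> in dimension one. The bound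
  on the total mass of \<open>z(t)\<close>, uniform in \<open>t\<close>, comes from weak continuity and the uniform boundedness
  principle.
\<close>

section \<open>Uniform boundedness, translations in \<open>L\<^sup>1\<close>, and signed measures\<close>

text \<open>The coefficient \<open>a\<close> is only Borel and nonnegative; it may vanish or be
  unbounded, so neither regularity nor parabolicity is at hand and the sign of \<open>a z^2\<close>
  carries the argument. The natural energy is the squared negative Sobolev norm
  \<open>\<langle>z, (-\<Delta>)^{-1} z\<rangle>\<close>, whose time derivative is formally
  \<open>-2 \<integral> a z^2\<close>. Since \<open>(-\<Delta>)^{-1}\<close> is the integral of the
  heat semigroup over all \<open>r > 0\<close>, this energy is \<open>\<integral> G(t,r) dr\<close>
  up to a constant. For a general finite measure that integral can diverge: at large
  \<open>r\<close> in low dimension, at small \<open>r\<close> because of concentration. Truncating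
  it to \<open>[\<delta>, R]\<close> makes everything finite and moves both difficulties into the
  boundary values of \<open>H\<close> at \<open>\<delta>\<close> and \<open>R\<close>. The parameter
  \<open>r\<close> is a regularisation scale, unrelated to the time of the equation. A second
  obstacle is that a density exists only at almost every time. All estimates are made at times in a
  set \<open>D\<close> of full measure, and weak continuity reaches the remaining times at the
  end.\<close>

lemma uniform_boundedness:
  fixes \<Phi> :: "'i \<Rightarrow> 'b::{real_normed_vector, complete_space} \<Rightarrow> real"
  assumes lin: "\<And>i. i \<in> I \<Longrightarrow> bounded_linear (\<Phi> i)"
    and ptw: "\<And>x. bounded ((\<lambda>i. \<Phi> i x) ` I)"
  obtains M where "M \<ge> 0" "\<And>i x. i \<in> I \<Longrightarrow> \<bar>\<Phi> i x\<bar> \<le> M * norm x"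
proof -
  define F where "F n = (\<Inter>i\<in>I. {x. \<bar>\<Phi> i x\<bar> \<le> real n})" for n :: nat
  have cont: "continuous_on UNIV (\<Phi> i)" if "i \<in> I" for i
    using lin[OF that] by (simp add: linear_continuous_on)
  have clF: "closed (F n)" for n
    unfolding F_def by (intro closed_INT ballI closed_Collect_le continuous_intros cont)
  have cover: "\<Union>(range F) = UNIV"
  proof -
    have "x \<in> \<Union>(range F)" for x
    proof -
      obtain B where B: "\<And>i. i \<in> I \<Longrightarrow> \<bar>\<Phi> i x\<bar> \<le> B"
        using ptw[of x] by (auto simp: bounded_iff)
      obtain n where "B \<le> real n" using real_arch_simple by blast
      then have "x \<in> F n" using B by (force simp: F_def)
      then show ?thesis by auto
    qed
    then show ?thesis by auto
  qed
  \<comment> \<open>Baire: the closed sets \<open>F n\<close> cover a complete space, so they cannot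
    all have empty interior.\<close>
  have "\<exists>n. interior (F n) \<noteq> {}"
  proof (rule ccontr)
    assume "\<not> ?thesis"
    then have "euclidean interior_of \<Union>(range F) = {}"
      using clF completely_metrizable_space_euclidean
      by (intro Baire_category_alt) auto
    then show False using cover by simp
  qed
  then obtain n x0 where "x0 \<in> interior (F n)" by auto
  then obtain e where e: "e > 0" "cball x0 e \<subseteq> F n"
    by (meson mem_interior_cball)
  have "\<bar>\<Phi> i x\<bar> \<le> (2 * real n / e) * norm x" if i: "i \<in> I" for i x
  proof (cases "x = 0")
    case True
    then show ?thesis using linear_0[OF bounded_linear.linear[OF lin[OF i]]] by simp
  next
    case False
    interpret bounded_linear "\<Phi> i" by (rule lin[OF i])
    \<comment> \<open>The point of the ball at distance \<open>e\<close> from its centre in the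
      direction of \<open>x\<close>. The values of \<open>\<Phi> i\<close> at \<open>x0\<close> and
      \<open>y\<close> differ by at most \<open>2 * n\<close>, and linearity rescales this to
      \<open>x\<close>.\<close>
    define y where "y = x0 + (e / norm x) *\<^sub>R x"
    have "x0 \<in> F n" "y \<in> F n" using e False by (auto simp: y_def dist_norm intro!: subsetD[OF e(2)])
    then have "\<bar>\<Phi> i x0\<bar> \<le> n" "\<bar>\<Phi> i y\<bar> \<le> n" using i by (auto simp: F_def)
    then have "\<bar>\<Phi> i y - \<Phi> i x0\<bar> \<le> 2 * n" by linarith
    moreover have "\<Phi> i y - \<Phi> i x0 = (e / norm x) * \<Phi> i x"
      by (simp add: y_def add scaleR)
    ultimately have "(e / norm x) * \<bar>\<Phi> i x\<bar> \<le> 2 * n" using e by (simp add: abs_mult)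
    then show ?thesis using e False by (simp add: field_simps)
  qed
  then show ?thesis using e by (intro that[of "2 * real n / e"]) auto
qed

section \<open>Affine changes of variables for Lebesgue measure\<close>

lemma nn_integral_lborel_affine:
  fixes f :: "'a::euclidean_space \<Rightarrow> ennreal"
  assumes [measurable]: "f \<in> borel_measurable borel" and c: "c \<noteq> 0"
  shows "(\<integral>\<^sup>+x. f x \<partial>lborel) = ennreal (\<bar>c\<bar> ^ DIM('a)) * (\<integral>\<^sup>+x. f (t + c *\<^sub>R x) \<partial>lborel)"
  by (subst lborel_affine[OF c, of t])
     (simp add: nn_integral_density nn_integral_distr nn_integral_cmult)

lemma integral_lborel_affine:
  fixes f :: "'a::euclidean_space \<Rightarrow> real"
  assumes [measurable]: "f \<in> borel_measurable borel" and c: "c \<noteq> 0"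
  shows "(LBINT x. f x) = \<bar>c\<bar> ^ DIM('a) * (LBINT x. f (t + c *\<^sub>R x))"
proof -
  have "(LBINT x. f x) = (\<integral>x. f x \<partial>density (distr lborel borel (\<lambda>x. t + c *\<^sub>R x)) (\<lambda>_. \<bar>c\<bar>^DIM('a)))"
    using lborel_affine[OF c, of t] by simp
  also have "\<dots> = \<bar>c\<bar> ^ DIM('a) * (LBINT x. f (t + c *\<^sub>R x))"
    by (subst integral_density) (auto simp: integral_distr)
  finally show ?thesis .
qed

lemma integrable_lborel_affine:
  fixes f :: "'a::euclidean_space \<Rightarrow> real"
  assumes f: "integrable lborel f" and c: "c \<noteq> 0"
  shows "integrable lborel (\<lambda>x. f (t + c *\<^sub>R x))"
proof -
  have [measurable]: "f \<in> borel_measurable borel" using f by simp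
  have "ennreal (\<bar>c\<bar> ^ DIM('a)) * (\<integral>\<^sup>+x. ennreal (norm (f (t + c *\<^sub>R x))) \<partial>lborel) < \<infinity>"
    using f nn_integral_lborel_affine[OF _ c, of "\<lambda>x. ennreal (norm (f x))" t]
    by (simp add: integrable_iff_bounded)
  then show ?thesis using c
    by (auto simp: integrable_iff_bounded ennreal_mult_less_top)
qed

lemma nn_integral_lborel_reflect:
  fixes f :: "'a::euclidean_space \<Rightarrow> ennreal"
  assumes "f \<in> borel_measurable borel"
  shows "(\<integral>\<^sup>+x. f (t - x) \<partial>lborel) = (\<integral>\<^sup>+x. f x \<partial>lborel)"
  using nn_integral_lborel_affine[OF assms, of "-1" t] by simp

lemma nn_integral_lborel_shift:
  fixes f :: "'a::euclidean_space \<Rightarrow> ennreal"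
  assumes "f \<in> borel_measurable borel"
  shows "(\<integral>\<^sup>+x. f (x - t) \<partial>lborel) = (\<integral>\<^sup>+x. f x \<partial>lborel)"
  using nn_integral_lborel_affine[OF assms, of "1" "-t"] by simp

lemma integral_lborel_shift:
  fixes f :: "'a::euclidean_space \<Rightarrow> real"
  assumes "f \<in> borel_measurable borel"
  shows "(LBINT x. f (x - t)) = (LBINT x. f x)"
  using integral_lborel_affine[OF assms, of "1" "-t"] by simp

lemma integrable_lborel_shift:
  fixes f :: "'a::euclidean_space \<Rightarrow> real"
  assumes "integrable lborel f"
  shows "integrable lborel (\<lambda>x. f (x - t))"
  using integrable_lborel_affine[OF assms, of "1" "-t"] by simp

lemma integral_lborel_reflect:
  fixes f :: "'a::euclidean_space \<Rightarrow> real"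
  assumes "f \<in> borel_measurable borel"
  shows "(LBINT x. f (t - x)) = (LBINT x. f x)"
  using integral_lborel_affine[OF assms, of "-1" "t"] by simp

section \<open>Continuity of translation in L1\<close>

lemma translation_L1_approx:
  fixes f g :: "'a::euclidean_space \<Rightarrow> real"
  assumes f: "integrable lborel f" and g: "integrable lborel g"
  shows "(LBINT x. \<bar>f (x - v) - f x\<bar>)
      \<le> 2 * (LBINT x. \<bar>f x - g x\<bar>) + (LBINT x. \<bar>g (x - v) - g x\<bar>)"
proof -
  have [simp]: "integrable lborel (\<lambda>x. f (x - v))" "integrable lborel (\<lambda>x. g (x - v))"
    using f g by (auto intro: integrable_lborel_shift)
  have [measurable]: "f \<in> borel_measurable borel" "g \<in> borel_measurable borel" using f g by auto
  have i: "integrable lborel (\<lambda>x. \<bar>f (x - v) - g (x - v)\<bar>)"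
    "integrable lborel (\<lambda>x. \<bar>f x - g x\<bar>)" "integrable lborel (\<lambda>x. \<bar>g (x - v) - g x\<bar>)"
    using f g by auto
  have "(LBINT x. \<bar>f (x - v) - f x\<bar>)
     \<le> (LBINT x. \<bar>f (x - v) - g (x - v)\<bar> + \<bar>f x - g x\<bar> + \<bar>g (x - v) - g x\<bar>)"
    using f g i by (intro integral_mono) auto
  also have "\<dots> = (LBINT x. \<bar>f (x - v) - g (x - v)\<bar>) + (LBINT x. \<bar>f x - g x\<bar>)
      + (LBINT x. \<bar>g (x - v) - g x\<bar>)"
    using f g i by simp
  also have "(LBINT x. \<bar>f (x - v) - g (x - v)\<bar>) = (LBINT x. \<bar>f x - g x\<bar>)"
    by (rule integral_lborel_shift[of "\<lambda>x. \<bar>f x - g x\<bar>"]) simp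
  finally show ?thesis by simp
qed

text \<open>The functions on which translation along \<open>v\<close> is continuous form a closed
  set in L1. The approximation error enters twice, once for \<open>f\<close> and once for its
  translate, which is why the proof asks for an \<open>e/4\<close> approximation.\<close>

lemma translation_L1_closure:
  fixes f :: "'a::euclidean_space \<Rightarrow> real"
  assumes f: "integrable lborel f"
    and apx: "\<And>e. e > 0 \<Longrightarrow> \<exists>g. integrable lborel g \<and> (LBINT x. \<bar>f x - g x\<bar>) < e \<and>
       (\<lambda>n. \<integral>x. \<bar>g (x - v n) - g x\<bar> \<partial>lborel) \<longlonglongrightarrow> 0"
  shows "(\<lambda>n. \<integral>x. \<bar>f (x - v n) - f x\<bar> \<partial>lborel) \<longlonglongrightarrow> 0"
proof (rule LIMSEQ_I)
  fix e :: real assume e: "e > 0"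
  obtain g where g: "integrable lborel g" "(LBINT x. \<bar>f x - g x\<bar>) < e / 4"
    and lim: "(\<lambda>n. \<integral>x. \<bar>g (x - v n) - g x\<bar> \<partial>lborel) \<longlonglongrightarrow> 0"
    using apx[of "e/4"] e by auto
  obtain N where N: "\<And>n. n \<ge> N \<Longrightarrow> norm ((LBINT x. \<bar>g (x - v n) - g x\<bar>) - 0) < e / 2"
    using LIMSEQ_D[OF lim, of "e/2"] e by auto
  have "norm ((LBINT x. \<bar>f (x - v n) - f x\<bar>) - 0) < e" if "n \<ge> N" for n
  proof -
    have "(LBINT x. \<bar>f (x - v n) - f x\<bar>) \<ge> 0" by simp
    then show ?thesis
      using N[OF that] g(2) translation_L1_approx[OF f g(1), of "v n"] by (simp add: abs_less_iff)
  qed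
  then show "\<exists>N. \<forall>n\<ge>N. norm ((LBINT x. \<bar>f (x - v n) - f x\<bar>) - 0) < e" by blast
qed

text \<open>
  Lower semicontinuity of the indicator controls only the positive part of \<open>f - f(\<cdot> - v)\<close>; since
  \<open>\<bar>a - b\<bar> = 2 max (b - a) 0 + (a - b)\<close> and translation preserves the integral, this suffices.
\<close>

lemma translation_L1_open:
  fixes U :: "'a::euclidean_space set"
  assumes U: "open U" and fin: "emeasure lborel U < \<infinity>" and v: "v \<longlonglongrightarrow> 0"
  shows "(\<lambda>n. \<integral>x. \<bar>indicator U (x - v n) - indicator U x\<bar> \<partial>lborel) \<longlonglongrightarrow> (0::real)"
proof -
  let ?f = "indicator U :: 'a \<Rightarrow> real"
  have [measurable]: "U \<in> sets borel" using U by simp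
  have f: "integrable lborel ?f" using fin by (simp add: integrable_indicator_iff)
  have fv: "integrable lborel (\<lambda>x. ?f (x - v n))" for n by (rule integrable_lborel_shift[OF f])
  have "(\<lambda>n. \<integral>x. max (?f x - ?f (x - v n)) 0 \<partial>lborel) \<longlonglongrightarrow> (\<integral>x. 0 \<partial>(lborel :: 'a measure))"
  proof (rule integral_dominated_convergence[where w = ?f])
    show "AE x in lborel. (\<lambda>n. max (?f x - ?f (x - v n)) 0) \<longlonglongrightarrow> 0"
    proof (intro always_eventually allI)
      fix x
      show "(\<lambda>n. max (?f x - ?f (x - v n)) 0) \<longlonglongrightarrow> 0"
      proof (cases "x \<in> U")
        case True
        have "(\<lambda>n. x - v n) \<longlonglongrightarrow> x" using tendsto_diff[OF tendsto_const v, of x] by simp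
        then have "\<forall>\<^sub>F n in sequentially. x - v n \<in> U"
          using U True by (rule topological_tendstoD)
        then have "\<forall>\<^sub>F n in sequentially. max (?f x - ?f (x - v n)) 0 = 0"
          by eventually_elim (auto simp: True)
        then show ?thesis by (rule tendsto_eventually)
      qed (auto simp: max_def)
    qed
    show "AE x in lborel. norm (max (?f x - ?f (x - v n)) 0) \<le> ?f x" for n
      by (auto simp: indicator_def)
  qed (use f in auto)
  then have "(\<lambda>n. 2 * (LBINT x. max (?f x - ?f (x - v n)) 0)) \<longlonglongrightarrow> 0"
    using tendsto_mult_right_zero by fastforce
  moreover have "(LBINT x. \<bar>?f (x - v n) - ?f x\<bar>) = 2 * (LBINT x. max (?f x - ?f (x - v n)) 0)" for n
  proof -
    have "(LBINT x. \<bar>?f (x - v n) - ?f x\<bar>)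
        = (LBINT x. 2 * max (?f x - ?f (x - v n)) 0 + (?f (x - v n) - ?f x))"
      by (rule Bochner_Integration.integral_cong) (auto simp: indicator_def)
    also have "\<dots> = 2 * (LBINT x. max (?f x - ?f (x - v n)) 0) + ((LBINT x. ?f (x - v n)) - (LBINT x. ?f x))"
      using f fv[of n] by (subst Bochner_Integration.integral_add) auto
    also have "(LBINT x. ?f (x - v n)) = (LBINT x. ?f x)" by (rule integral_lborel_shift) simp
    finally show ?thesis by simp
  qed
  ultimately show ?thesis by simp
qed

text \<open>By outer regularity the indicator of a Borel set of finite measure is an L1 limit of
  indicators of open sets, where \<open>translation_L1_open\<close> applies. The property then
  passes to linear combinations and, by \<open>translation_L1_closure\<close>, to limits.\<close>

lemma translation_L1:
  fixes f :: "'a::euclidean_space \<Rightarrow> real"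
  assumes "integrable lborel f" and v: "v \<longlonglongrightarrow> 0"
  shows "(\<lambda>n. \<integral>x. \<bar>f (x - v n) - f x\<bar> \<partial>lborel) \<longlonglongrightarrow> 0"
  using assms(1)
proof (induction rule: integrable_induct)
  case (base A c)
  have [measurable]: "A \<in> sets borel" using base by simp
  have iA: "integrable lborel (indicator A :: 'a \<Rightarrow> real)" using base by (simp add: integrable_indicator_iff)
  have "(\<lambda>n. \<integral>x. \<bar>indicator A (x - v n) - indicator A x\<bar> \<partial>lborel) \<longlonglongrightarrow> (0::real)"
  proof (rule translation_L1_closure[OF iA])
    fix e :: real assume e: "e > 0"
    obtain U where U: "open U" "A \<subseteq> U" "U - A \<in> lmeasurable" "emeasure lebesgue (U - A) < ennreal e"
      by (rule sets_lebesgue_outer_open[of A e]) (use base e in auto)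
    have [measurable]: "U \<in> sets borel" using U(1) by simp
    have UA: "emeasure lborel (U - A) < ennreal e" using U(4) by simp
    have finU: "emeasure lborel U < \<infinity>"
    proof -
      have "emeasure lborel (A \<union> (U - A)) \<le> emeasure lborel A + emeasure lborel (U - A)"
        by (rule emeasure_subadditive) auto
      also have "\<dots> < \<infinity>" using base UA by (auto simp: less_top[symmetric])
      finally show ?thesis using U(2) by (simp add: Un_absorb1)
    qed
    have "(LBINT x. \<bar>indicator A x - indicator U x\<bar>) = (\<integral>x. indicator (U - A) x \<partial>lborel :: real)"
      using U(2) by (intro Bochner_Integration.integral_cong) (auto simp: indicator_def)
    also have "\<dots> = measure lborel (U - A)" by simp
    also have "\<dots> < e" using UA e by (simp add: measure_def enn2real_less_iff less_top)
       (metis UA e enn2real_ennreal enn2real_less_iff ennreal_less_top less_le less_trans)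
    finally show "\<exists>g. integrable lborel g \<and> (LBINT x. \<bar>indicator A x - g x\<bar>) < e \<and>
       (\<lambda>n. \<integral>x. \<bar>g (x - v n) - g x\<bar> \<partial>lborel) \<longlonglongrightarrow> 0"
      using translation_L1_open[OF U(1) finU v] finU
      by (intro exI[of _ "indicator U"]) (auto simp: integrable_indicator_iff)
  qed
  then have "(\<lambda>n. (LBINT x. \<bar>indicator A (x - v n) - indicator A x\<bar>) * \<bar>c\<bar>) \<longlonglongrightarrow> 0"
    by (rule tendsto_mult_left_zero)
  moreover have "(LBINT x. \<bar>indicator A (x - v n) *\<^sub>R c - indicator A x *\<^sub>R c\<bar>)
     = (LBINT x. \<bar>indicator A (x - v n) - indicator A x\<bar>) * \<bar>c\<bar>" for n
  proof -
    have "\<bar>indicator A (x - v n) *\<^sub>R c - indicator A x *\<^sub>R c\<bar> = \<bar>indicator A (x - v n) - indicator A x\<bar> * \<bar>c\<bar>" for x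
      by (simp add: abs_mult[symmetric] left_diff_distrib)
    then show ?thesis by simp
  qed
  ultimately show ?case by simp
next
  case (add f g)
  have [simp]: "integrable lborel (\<lambda>x. f (x - v n))" "integrable lborel (\<lambda>x. g (x - v n))" for n
    using add by (auto intro: integrable_lborel_shift)
  have "(\<lambda>n. (LBINT x. \<bar>f (x - v n) - f x\<bar>) + (LBINT x. \<bar>g (x - v n) - g x\<bar>)) \<longlonglongrightarrow> 0"
    using tendsto_add[OF add(3,4)] by simp
  then show ?case
  proof (rule tendsto_sandwich[OF _ _ tendsto_const, rotated -1])
    have "(LBINT x. \<bar>f (x - v n) + g (x - v n) - (f x + g x)\<bar>)
      \<le> (LBINT x. \<bar>f (x - v n) - f x\<bar> + \<bar>g (x - v n) - g x\<bar>)" for n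
      using add(1,2) by (intro integral_mono) auto
    also have "\<dots>n = (LBINT x. \<bar>f (x - v n) - f x\<bar>) + (LBINT x. \<bar>g (x - v n) - g x\<bar>)" for n
      using add(1,2) by simp
    finally show "\<forall>\<^sub>F n in sequentially. (LBINT x. \<bar>f (x - v n) + g (x - v n) - (f x + g x)\<bar>)
      \<le> (LBINT x. \<bar>f (x - v n) - f x\<bar>) + (LBINT x. \<bar>g (x - v n) - g x\<bar>)" by simp
  qed auto
next
  case (lim f s)
  show ?case
  proof (rule translation_L1_closure[OF lim(4)])
    fix e :: real assume e: "e > 0"
    \<comment> \<open>The induction rule supplies simple functions with
      \<open>\<bar>s i x\<bar> \<le> 2 * \<bar>f x\<bar>\<close>, hence the majorant with factor
      3.\<close>
    have "(\<lambda>i. \<integral>x. \<bar>f x - s i x\<bar> \<partial>lborel) \<longlonglongrightarrow> (\<integral>x. 0 \<partial>(lborel::'a measure))"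
    proof (rule integral_dominated_convergence[where w = "\<lambda>x. 3 * \<bar>f x\<bar>"])
      show "AE x in lborel. (\<lambda>i. \<bar>f x - s i x\<bar>) \<longlonglongrightarrow> 0"
        using lim(2) by (intro always_eventually allI tendsto_rabs_zero) (auto intro!: tendsto_eq_intros)
      show "AE x in lborel. norm \<bar>f x - s i x\<bar> \<le> 3 * \<bar>f x\<bar>" for i
      proof (intro always_eventually allI)
        fix x show "norm \<bar>f x - s i x\<bar> \<le> 3 * \<bar>f x\<bar>" using lim(3)[of x i] by simp
      qed
    qed (use lim in auto)
    then obtain i where "\<bar>\<integral>x. \<bar>f x - s i x\<bar> \<partial>lborel\<bar> < e"
      using e LIMSEQ_D[of _ 0 e] by fastforce
    then show "\<exists>g. integrable lborel g \<and> (LBINT x. \<bar>f x - g x\<bar>) < e \<and>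
       (\<lambda>n. \<integral>x. \<bar>g (x - v n) - g x\<bar> \<partial>lborel) \<longlonglongrightarrow> 0"
      using lim(1,5) by (intro exI[of _ "s i"]) auto
  qed
qed

lemma integrable_mult_bounded:
  fixes f h :: "'a::euclidean_space \<Rightarrow> real"
  assumes "integrable lborel f" "h \<in> borel_measurable borel" "\<And>x. \<bar>h x\<bar> \<le> B"
  shows "integrable lborel (\<lambda>x. f x * h x)"
proof (rule Bochner_Integration.integrable_bound[where f = "\<lambda>x. B * f x"])
  show "AE x in lborel. norm (f x * h x) \<le> norm (B * f x)"
  proof (intro always_eventually allI)
    fix x show "norm (f x * h x) \<le> norm (B * f x)"
      using mult_right_mono[OF assms(3)[of x], of "\<bar>f x\<bar>"] assms(3)[of x]
      by (simp add: abs_mult mult.commute)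
  qed
qed (use assms in auto)

text \<open>The translation acts on the integrable factor, so the modulus of continuity is
  \<open>B\<close> times the L1 modulus of \<open>f\<close> and \<open>h\<close> may be as rough as
  a sign function. It gives continuity both of correlations at \<open>0\<close> and of smoothed
  signs.\<close>

lemma continuous_on_correlation:
  fixes f h :: "'a::euclidean_space \<Rightarrow> real"
  assumes f: "integrable lborel f" and h[measurable]: "h \<in> borel_measurable borel" and B: "\<And>x. \<bar>h x\<bar> \<le> B"
  shows "continuous_on UNIV (\<lambda>v. \<integral>x. f (x - v) * h x \<partial>lborel)"
proof (rule continuous_on_sequentiallyI)
  fix u :: "nat \<Rightarrow> 'a" and a assume u: "u \<longlonglongrightarrow> a"
  let ?g = "\<lambda>x. f (x - a)"
  have g: "integrable lborel ?g" by (rule integrable_lborel_shift[OF f])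
  have fu: "integrable lborel (\<lambda>x. f (x - u n))" for n by (rule integrable_lborel_shift[OF f])
  have [measurable]: "f \<in> borel_measurable borel" using f by auto
  have "(\<lambda>n. u n - a) \<longlonglongrightarrow> 0" using u by (simp add: LIM_zero)
  from translation_L1[OF g this]
  have l: "(\<lambda>n. (LBINT x. \<bar>f (x - u n) - f (x - a)\<bar>) * B) \<longlonglongrightarrow> 0"
    by (intro tendsto_mult_left_zero) (simp add: algebra_simps)
  have "(\<lambda>n. (LBINT x. f (x - u n) * h x) - (LBINT x. f (x - a) * h x)) \<longlonglongrightarrow> 0"
  proof (rule Lim_null_comparison[OF always_eventually[rule_format] l])
    fix n
    have i: "integrable lborel (\<lambda>x. f (x - u n) * h x)" "integrable lborel (\<lambda>x. f (x - a) * h x)"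
      by (rule integrable_mult_bounded[OF fu h B], rule integrable_mult_bounded[OF g h B])
    have "norm ((LBINT x. f (x - u n) * h x) - (LBINT x. f (x - a) * h x))
       = norm (LBINT x. f (x - u n) * h x - f (x - a) * h x)"
      using i by simp
    also have "\<dots> \<le> (LBINT x. norm (f (x - u n) * h x - f (x - a) * h x))"
      by (rule integral_norm_bound)
    also have "\<dots> \<le> (LBINT x. \<bar>f (x - u n) - f (x - a)\<bar> * B)"
    proof (rule integral_mono)
      show "norm (f (x - u n) * h x - f (x - a) * h x) \<le> \<bar>f (x - u n) - f (x - a)\<bar> * B" for x
        using B by (auto simp: left_diff_distrib[symmetric] abs_mult intro!: mult_left_mono)
    qed (use i fu[of n] g in auto)
    also have "\<dots> = (LBINT x. \<bar>f (x - u n) - f (x - a)\<bar>) * B" by simp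
    finally show "norm ((LBINT x. f (x - u n) * h x) - (LBINT x. f (x - a) * h x))
       \<le> (LBINT x. \<bar>f (x - u n) - f (x - a)\<bar>) * B" .
  qed
  then show "(\<lambda>n. \<integral>x. f (x - u n) * h x \<partial>lborel) \<longlonglongrightarrow> (LBINT x. f (x - a) * h x)"
    by (simp add: LIM_zero_iff)
qed

text \<open>Monotone induction on nonnegative functions, then a split into positive and negative
  parts. The function \<open>h\<close> may be unbounded, as it must be for
  \<open>laplacian \<phi> x * a s x\<close>; integrability against the four positive measures and
  against \<open>g\<close> therefore travels inside the induction statement.\<close>

lemma sint_diff_density:
  fixes z z' :: "'a::euclidean_space smeasure" and g h :: "'a \<Rightarrow> real"
  assumes z: "fin_smeasure z" "fin_smeasure z'"
    and g: "integrable lborel g"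
    and dens: "\<And>A. A \<in> sets borel \<Longrightarrow> sval z A - sval z' A = (LINT x:A|lborel. g x)"
    and h: "sintegrable z h" "sintegrable z' h" "integrable lborel (\<lambda>x. h x * g x)"
  shows "sint z h - sint z' h = (LBINT x. h x * g x)"
proof -
  note [measurable_cong] = z[unfolded fin_smeasure_def, THEN conjunct1]
    z[unfolded fin_smeasure_def, THEN conjunct2, THEN conjunct1]
  interpret a: finite_measure "fst z" using z by (simp add: fin_smeasure_def)
  interpret b: finite_measure "snd z" using z by (simp add: fin_smeasure_def)
  interpret c: finite_measure "fst z'" using z by (simp add: fin_smeasure_def)
  interpret d: finite_measure "snd z'" using z by (simp add: fin_smeasure_def)
  have sets[simp]: "sets (fst z) = sets borel" "sets (snd z) = sets borel"
     "sets (fst z') = sets borel" "sets (snd z') = sets borel"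
    using z by (auto simp: fin_smeasure_def)
  have sp[simp]: "space (fst z) = UNIV" "space (snd z) = UNIV" "space (fst z') = UNIV" "space (snd z') = UNIV"
    using sets[THEN sets_eq_imp_space_eq] by auto
  have [measurable]: "g \<in> borel_measurable borel" using g by auto
  have nonneg: "sint z u - sint z' u = (LBINT x. u x * g x)"
    if "u \<in> borel_measurable borel" "\<And>x. 0 \<le> u x" "sintegrable z u" "sintegrable z' u"
      "integrable lborel (\<lambda>x. u x * g x)" for u
    using that
  proof (induction rule: borel_measurable_induct_real)
    case (set A)
    then show ?case using dens[of A] by (simp add: sint_def sval_def set_lebesgue_integral_def)
  next
    case (mult u c)
    show ?case
    proof (cases "c = 0")
      case False
      then have "sintegrable z u" "sintegrable z' u" "integrable lborel (\<lambda>x. u x * g x)"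
        using mult.prems by (auto simp: sintegrable_def mult.assoc)
      from mult.IH[OF this] show ?thesis
        by (simp add: sint_def mult.assoc right_diff_distrib[symmetric])
    qed (simp add: sint_def)
  next
    case (add u v)
    \<comment> \<open>Integrability of a sum passes to its terms here because both are nonnegative
      and so dominated by the sum.\<close>
    have bd: "integrable M u \<and> integrable M v"
      if "integrable M (\<lambda>x. v x + u x)" "sets M = sets borel" for M
    proof -
      have [measurable]: "u \<in> borel_measurable M" "v \<in> borel_measurable M"
        using add.hyps that(2) by (auto cong: measurable_cong_sets)
      show ?thesis
        using add.hyps by (auto intro!: Bochner_Integration.integrable_bound[OF that(1)])
    qed
    have bd2: "integrable lborel (\<lambda>x. u x * g x)" "integrable lborel (\<lambda>x. v x * g x)"
      using add.hyps by (auto intro!: Bochner_Integration.integrable_bound[OF add.prems(3)] AE_I2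
          simp: abs_mult intro!: mult_right_mono)
    have "sintegrable z u" "sintegrable z' u" "sintegrable z v" "sintegrable z' v"
      using add.prems by (auto simp: sintegrable_def bd)
    then show ?case using add.IH bd2 by (simp add: sint_def sintegrable_def distrib_right)
  next
    case (seq U)
    have U_le: "U i x \<le> u x" for x i
      using seq by (intro incseq_le) (auto simp: incseq_def le_fun_def)
    have lim: "(\<lambda>i. integral\<^sup>L M (U i)) \<longlonglongrightarrow> integral\<^sup>L M u \<and> (\<forall>i. integrable M (U i))"
      if "integrable M u" "sets M = sets borel" for M
    proof -
      have m[measurable]: "U i \<in> borel_measurable M" for i
        using seq.hyps(1)[of i] that(2) by (auto cong: measurable_cong_sets)
      have "(\<lambda>i. integral\<^sup>L M (U i)) \<longlonglongrightarrow> integral\<^sup>L M u"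
        using that seq.hyps U_le by (intro integral_dominated_convergence[where w=u]) auto
      moreover have "integrable M (U i)" for i
        using seq.hyps(2) U_le
        by (intro Bochner_Integration.integrable_bound[OF that(1)] m AE_I2) (auto intro: order_trans[OF _ abs_ge_self])
      ultimately show ?thesis by blast
    qed
    have l2: "(\<lambda>i. \<integral>x. U i x * g x \<partial>lborel) \<longlonglongrightarrow> (LBINT x. u x * g x)"
      and i2: "integrable lborel (\<lambda>x. U i x * g x)" for i
    proof -
      have b: "norm (U i x * g x) \<le> norm (u x * g x)" for i x
        using U_le[of i x] seq.hyps(2)[of i x] by (auto simp: abs_mult intro!: mult_right_mono)
      have [measurable]: "u \<in> borel_measurable borel"
        using seq.prems(1) borel_measurable_integrable by (fastforce simp: sintegrable_def)
      show "integrable lborel (\<lambda>x. U i x * g x)"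
        using b seq.hyps(1) by (intro Bochner_Integration.integrable_bound[OF seq.prems(3)]) auto
      show "(\<lambda>i. \<integral>x. U i x * g x \<partial>lborel) \<longlonglongrightarrow> (LBINT x. u x * g x)"
        using b seq.hyps(1,4) seq.prems(3)
        by (intro integral_dominated_convergence[where w="\<lambda>x. norm (u x * g x)"]) (auto intro!: tendsto_intros)
    qed
    have "sint z (U i) - sint z' (U i) = (LBINT x. U i x * g x)" for i
      using seq.IH[of i] lim i2 seq.prems by (auto simp: sintegrable_def)
    moreover have "(\<lambda>i. sint z (U i) - sint z' (U i)) \<longlonglongrightarrow> sint z u - sint z' u"
      using lim seq.prems unfolding sint_def sintegrable_def by (intro tendsto_intros) auto
    ultimately show ?case using l2 by (metis (no_types, lifting) LIMSEQ_unique ext)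
  qed
  have [measurable]: "h \<in> borel_measurable borel"
    using h(1) borel_measurable_integrable by (fastforce simp: sintegrable_def)
  have i2: "integrable lborel (\<lambda>x. max 0 (h x) * g x)" "integrable lborel (\<lambda>x. max 0 (- h x) * g x)"
    by (auto intro!: Bochner_Integration.integrable_bound[OF h(3)] AE_I2 simp: abs_mult intro!: mult_right_mono)
  have p: "sint z (\<lambda>x. max 0 (h x)) - sint z' (\<lambda>x. max 0 (h x)) = (LBINT x. max 0 (h x) * g x)"
    using h i2 by (intro nonneg) (auto simp: sintegrable_def)
  have n: "sint z (\<lambda>x. max 0 (- h x)) - sint z' (\<lambda>x. max 0 (- h x)) = (LBINT x. max 0 (- h x) * g x)"
    using h i2 by (intro nonneg) (auto simp: sintegrable_def)
  have dec: "h = (\<lambda>x. max 0 (h x) - max 0 (- h x))" by (auto simp: max_def)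
  have 1: "integral\<^sup>L M h = integral\<^sup>L M (\<lambda>x. max 0 (h x)) - integral\<^sup>L M (\<lambda>x. max 0 (- h x))"
    if "integrable M h" for M :: "'a measure"
    using that by (subst (1) dec, subst Bochner_Integration.integral_diff) auto
  have 2: "(LBINT x. h x * g x) = (LBINT x. max 0 (h x) * g x) - (LBINT x. max 0 (- h x) * g x)"
    using i2 by (subst (1) dec) (simp add: left_diff_distrib)
  show ?thesis using p n h unfolding 2 sint_def sintegrable_def by (simp add: 1)
qed

lemma integrable_bounded_fin_smeasure:
  fixes z :: "'a::euclidean_space smeasure"
  assumes z: "fin_smeasure z" and f: "f \<in> borel_measurable borel" "\<And>x. \<bar>f x\<bar> \<le> B"
  shows "sintegrable z f"
proof -
  interpret a: finite_measure "fst z" using z by (simp add: fin_smeasure_def)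
  interpret b: finite_measure "snd z" using z by (simp add: fin_smeasure_def)
  have "f \<in> borel_measurable (fst z)" "f \<in> borel_measurable (snd z)"
    using z f(1) by (auto simp: fin_smeasure_def cong: measurable_cong_sets)
  then show ?thesis unfolding sintegrable_def
    using f(2) by (auto intro!: a.integrable_const_bound[where B=B] b.integrable_const_bound[where B=B])
qed

text \<open>Closed sets are an intersection-stable generator of the Borel sets, and their indicators
  are pointwise limits of bounded continuous functions. Equality then spreads to all Borel sets by
  the Dynkin argument; complements work because \<open>UNIV\<close> is closed and all measures are
  finite.\<close>

lemma sval_eq_of_sint_eq:
  fixes z z' :: "'a::euclidean_space smeasure"
  assumes z: "fin_smeasure z" "fin_smeasure z'"
    and eq: "\<And>f. continuous_on UNIV f \<Longrightarrow> bounded (range f) \<Longrightarrow> sint z f = sint z' f"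
    and A: "A \<in> sets borel"
  shows "sval z A - sval z' A = 0"
proof -
  interpret a: finite_measure "fst z" using z by (simp add: fin_smeasure_def)
  interpret b: finite_measure "snd z" using z by (simp add: fin_smeasure_def)
  interpret c: finite_measure "fst z'" using z by (simp add: fin_smeasure_def)
  interpret d: finite_measure "snd z'" using z by (simp add: fin_smeasure_def)
  have sets[simp]: "sets (fst z) = sets borel" "sets (snd z) = sets borel"
     "sets (fst z') = sets borel" "sets (snd z') = sets borel"
    using z by (auto simp: fin_smeasure_def)
  have sp[simp]: "space (fst z) = UNIV" "space (snd z) = UNIV" "space (fst z') = UNIV" "space (snd z') = UNIV"
    using sets[THEN sets_eq_imp_space_eq] by auto
  have closed: "sval z F - sval z' F = 0" if F: "closed F" for F
  proof (cases "F = {}")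
    case False
    \<comment> \<open>Tents that shrink to the indicator of \<open>F\<close>. Since
      \<open>infdist x {}\<close> is \<open>0\<close> by convention, they would be constantly
      \<open>1\<close> for empty \<open>F\<close>, which is why that case is separate.\<close>
    define f where "f n x = max 0 (1 - real n * infdist x F)" for n x
    have fc: "continuous_on UNIV (f n)" for n
      unfolding f_def by (intro continuous_intros)
    have fb: "\<bar>f n x\<bar> \<le> 1" for n x
      by (auto simp: f_def infdist_nonneg)
    have lim: "(\<lambda>n. f n x) \<longlonglongrightarrow> indicator F x" for x
    proof (cases "x \<in> F")
      case True
      then show ?thesis by (simp add: f_def)
    next
      case x: False
      then have pos: "infdist x F > 0"
        using F False in_closed_iff_infdist_zero[OF F False, of x] infdist_nonneg[of x F] by linarith
      obtain N where N: "real N * infdist x F > 1" using reals_Archimedean3[OF pos] by blast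
      have "f n x = 0" if "n \<ge> N" for n
      proof -
        have "real N * infdist x F \<le> real n * infdist x F" using that pos by simp
        then show ?thesis using N by (simp add: f_def)
      qed
      then have "\<forall>\<^sub>F n in sequentially. f n x = 0" by (auto simp: eventually_sequentially)
      then show ?thesis using x by (simp add: tendsto_eventually)
    qed
    have L: "(\<lambda>n. integral\<^sup>L M (f n)) \<longlonglongrightarrow> measure M F"
      if "finite_measure M" "sets M = sets borel" for M
    proof -
      interpret finite_measure M by fact
      have sM: "space M = UNIV" using that(2) sets_eq_imp_space_eq by fastforce
      have "f n \<in> borel_measurable M" for n
        using borel_measurable_continuous_onI[OF fc] that(2) by (auto cong: measurable_cong_sets)
      moreover have "F \<in> sets M" using F that(2) by simp
      ultimately have "(\<lambda>n. integral\<^sup>L M (f n)) \<longlonglongrightarrow> integral\<^sup>L M (indicator F :: 'a \<Rightarrow> real)"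
        using lim fb by (intro integral_dominated_convergence[where w="\<lambda>_. 1"]) auto
      then show ?thesis using sM by simp
    qed
    have "(\<lambda>n. sint z (f n) - sint z' (f n)) \<longlonglongrightarrow> sval z F - sval z' F"
      unfolding sint_def sval_def
      by (intro tendsto_intros L) (use z in \<open>auto simp: fin_smeasure_def\<close>)
    moreover have "sint z (f n) - sint z' (f n) = 0" for n
      using eq[OF fc, of n] fb by (auto simp: bounded_iff)
    ultimately show ?thesis by (simp add: LIMSEQ_const_iff)
  qed (simp add: sval_def)
  have "Int_stable (Collect closed :: 'a set set)" "Collect closed \<subseteq> Pow (UNIV :: 'a set)"
    by (auto simp: Int_stable_def)
  moreover have "A \<in> sigma_sets UNIV (Collect closed)"
    using A borel_eq_closed by (metis sets_measure_of top_greatest Pow_UNIV)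
  ultimately show ?thesis
  proof (induction rule: sigma_sets_induct_disjoint)
    case (compl B)
    then have B: "B \<in> sets borel" by (metis borel_eq_closed sets_measure_of top_greatest Pow_UNIV)
    have U: "sval z UNIV - sval z' UNIV = 0" by (rule closed) simp
    show ?case using compl U B
      a.finite_measure_compl[of B] b.finite_measure_compl[of B] c.finite_measure_compl[of B] d.finite_measure_compl[of B]
      by (simp add: sval_def)
  next
    case (union B)
    then have B: "range B \<subseteq> sets borel" by (metis borel_eq_closed sets_measure_of top_greatest Pow_UNIV)
    have "(\<lambda>i. sval z (B i) - sval z' (B i)) sums (sval z (\<Union>i. B i) - sval z' (\<Union>i. B i))"
      unfolding sval_def using B union.hyps(1)
      by (intro sums_diff a.finite_measure_UNION b.finite_measure_UNION c.finite_measure_UNION d.finite_measure_UNION) auto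
    then have "(\<lambda>i. 0) sums (sval z (\<Union>i. B i) - sval z' (\<Union>i. B i))" using union.IH by simp
    then show ?case using sums_unique2 sums_zero by blast
  next
    case (basic B)
    then show ?case using closed by simp
  qed (simp add: sval_def)
qed

section \<open>Gaussians and the heat kernel\<close>

definition gauss :: "real \<Rightarrow> 'a::euclidean_space \<Rightarrow> real" where
  "gauss c x = exp (- c * (norm x)\<^sup>2)"

lemma gauss_pos[simp]: "gauss c x > 0" by (simp add: gauss_def)
lemma gauss_nonneg[simp]: "gauss c x \<ge> 0" by (simp add: gauss_def)
lemma gauss_le_1: "c \<ge> 0 \<Longrightarrow> gauss c x \<le> 1" by (simp add: gauss_def)

lemma borel_measurable_gauss[measurable]: "gauss c \<in> borel_measurable borel"
  unfolding gauss_def by measurable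

section \<open>Polynomials times Gaussians as Schwartz functions\<close>

lemma power_le_exp:
  fixes u :: real assumes "u \<ge> 0"
  shows "u ^ n \<le> fact n * exp u"
proof -
  have "(\<Sum>i\<in>{n}. u ^ i /\<^sub>R fact i) \<le> (\<Sum>i. u ^ i /\<^sub>R fact i)"
    using assms summable_exp_generic[of u] by (intro sum_le_suminf) auto
  then show ?thesis by (simp add: exp_def field_simps)
qed

lemma one_plus_norm_power_gauss_bounded:
  fixes x0 :: "'a::euclidean_space"
  assumes c: "c > 0"
  obtains C where "C \<ge> 0" "\<And>x. (1 + norm x) ^ m * gauss c (x - x0) \<le> C"
proof -
  \<comment> \<open>The exponent \<open>1 + 1 / (4 * c)\<close> is the maximum of
    \<open>1 + s - c * s^2\<close>, reached at \<open>s = 1 / (2 * c)\<close>; here \<open>s\<close>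
    is the distance to \<open>x0\<close>.\<close>
  define K where "K = (1 + norm x0) ^ m * fact m * exp (1 + 1 / (4 * c))"
  have "(1 + norm x) ^ m * gauss c (x - x0) \<le> K" for x
  proof -
    let ?s = "norm (x - x0)"
    have "norm x \<le> norm x0 + ?s" using norm_triangle_sub by blast
    then have "1 + norm x \<le> (1 + norm x0) * (1 + ?s)"
      using mult_nonneg_nonneg[OF norm_ge_zero[of x0] norm_ge_zero[of "x - x0"]]
      by (simp only: distrib_left distrib_right mult_1_left mult_1_right)
    then have "(1 + norm x) ^ m \<le> (1 + norm x0) ^ m * (1 + ?s) ^ m"
      by (simp add: power_mono power_mult_distrib[symmetric])
    also have "\<dots> \<le> (1 + norm x0) ^ m * (fact m * exp (1 + ?s))"
      by (intro mult_left_mono power_le_exp) auto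
    finally have "(1 + norm x) ^ m * gauss c (x - x0) \<le> (1 + norm x0) ^ m * (fact m * exp (1 + ?s)) * gauss c (x - x0)"
      by (simp add: mult_right_mono)
    also have "\<dots> = (1 + norm x0) ^ m * fact m * exp (1 + ?s - c * ?s\<^sup>2)"
      by (simp add: gauss_def exp_add exp_diff exp_minus field_simps)
    also have "\<dots> \<le> K"
    proof -
      have "?s - c * ?s\<^sup>2 = 1 / (4 * c) - c * (?s - 1 / (2 * c))\<^sup>2"
        using c by (simp add: power2_eq_square field_simps)
      also have "\<dots> \<le> 1 / (4 * c)" using c by simp
      finally show ?thesis unfolding K_def by (intro mult_left_mono) auto
    qed
    finally show ?thesis .
  qed
  moreover have "K \<ge> 0" by (simp add: K_def)
  ultimately show ?thesis using that by blast
qed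

lemma real_polynomial_function_growth:
  fixes p :: "'a::real_normed_vector \<Rightarrow> real"
  assumes "real_polynomial_function p"
  shows "\<exists>C k. C \<ge> 0 \<and> (\<forall>x. \<bar>p x\<bar> \<le> C * (1 + norm x) ^ k)"
  using assms
proof induction
  case (linear f)
  then obtain K where K: "K > 0" "\<And>x. norm (f x) \<le> norm x * K"
    using bounded_linear.pos_bounded by blast
  have "\<bar>f x\<bar> \<le> K * (1 + norm x) ^ 1" for x
    using K(2)[of x] K(1) by (simp add: algebra_simps)
  then show ?case using K(1) by (metis less_eq_real_def)
next
  case (const c)
  show ?case by (intro exI[of _ "\<bar>c\<bar>"] exI[of _ 0]) auto
next
  case (add f g)
  then obtain C k C' k' where 1: "C \<ge> 0" "\<And>x. \<bar>f x\<bar> \<le> C * (1 + norm x) ^ k"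
    and 2: "C' \<ge> 0" "\<And>x. \<bar>g x\<bar> \<le> C' * (1 + norm x) ^ k'" by metis
  have "\<bar>f x + g x\<bar> \<le> (C + C') * (1 + norm x) ^ (k + k')" for x
  proof -
    have "C * (1 + norm x) ^ k \<le> C * (1 + norm x) ^ (k + k')" "C' * (1 + norm x) ^ k' \<le> C' * (1 + norm x) ^ (k + k')"
      using 1 2 by (auto intro!: mult_left_mono power_increasing)
    then show ?thesis using 1(2)[of x] 2(2)[of x] by (simp add: algebra_simps)
  qed
  then show ?case using 1 2 by (intro exI[of _ "C + C'"] exI[of _ "k + k'"]) auto
next
  case (mult f g)
  then obtain C k C' k' where 1: "C \<ge> 0" "\<And>x. \<bar>f x\<bar> \<le> C * (1 + norm x) ^ k"
    and 2: "C' \<ge> 0" "\<And>x. \<bar>g x\<bar> \<le> C' * (1 + norm x) ^ k'" by metis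
  have "\<bar>f x * g x\<bar> \<le> (C * C') * (1 + norm x) ^ (k + k')" for x
    using mult_mono[OF 1(2)[of x] 2(2)[of x]] 1 by (simp add: abs_mult power_add algebra_simps)
  then show ?case using 1 2 by (intro exI[of _ "C * C'"] exI[of _ "k + k'"]) auto
qed

lemma real_polynomial_function_has_derivative:
  fixes p :: "'a::real_normed_vector \<Rightarrow> real"
  assumes "real_polynomial_function p"
  shows "\<exists>D. (\<forall>x. (p has_derivative D x) (at x)) \<and> (\<forall>b. real_polynomial_function (\<lambda>x. D x b))"
  using assms
proof induction
  case (linear f)
  then show ?case by (intro exI[of _ "\<lambda>_. f"]) (auto intro: bounded_linear_imp_has_derivative)
next
  case (const c)
  show ?case by (intro exI[of _ "\<lambda>_ _. 0"]) auto
next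
  case (add f g)
  then obtain D E where "\<And>x. (f has_derivative D x) (at x)" "\<And>b. real_polynomial_function (\<lambda>x. D x b)"
    "\<And>x. (g has_derivative E x) (at x)" "\<And>b. real_polynomial_function (\<lambda>x. E x b)" by blast
  then show ?case by (intro exI[of _ "\<lambda>x b. D x b + E x b"]) (auto intro: has_derivative_add)
next
  case (mult f g)
  then obtain D E where "\<And>x. (f has_derivative D x) (at x)" "\<And>b. real_polynomial_function (\<lambda>x. D x b)"
    "\<And>x. (g has_derivative E x) (at x)" "\<And>b. real_polynomial_function (\<lambda>x. E x b)" by blast
  then show ?case using mult.hyps
    by (intro exI[of _ "\<lambda>x b. f x * E x b + D x b * g x"] conjI allI has_derivative_mult
        real_polynomial_function.intros(3) real_polynomial_function.intros(4))
qed

text \<open>With \<open>c\<close> and \<open>x0\<close> fixed, the class is closed under sums and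
  directional derivatives. The infinitely many conditions in \<open>schwartz\<close> thus reduce to
  a single growth bound, and no iterated derivative has to be computed.\<close>

definition poly_gauss :: "real \<Rightarrow> 'a::euclidean_space \<Rightarrow> ('a \<Rightarrow> real) \<Rightarrow> bool" where
  "poly_gauss c x0 f \<longleftrightarrow> (\<exists>p. real_polynomial_function p \<and> f = (\<lambda>x. p x * gauss c (x - x0)))"

lemma poly_gaussI: "real_polynomial_function p \<Longrightarrow> (\<And>x. f x = p x * gauss c (x - x0)) \<Longrightarrow> poly_gauss c x0 f"
  by (auto simp: poly_gauss_def)

lemma poly_gauss_add:
  assumes "poly_gauss c x0 f" "poly_gauss c x0 g"
  shows "poly_gauss c x0 (\<lambda>x. f x + g x)"
proof -
  obtain p q where "real_polynomial_function p" "real_polynomial_function q"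
    "f = (\<lambda>x. p x * gauss c (x - x0))" "g = (\<lambda>x. q x * gauss c (x - x0))"
    using assms by (auto simp: poly_gauss_def)
  then show ?thesis by (intro poly_gaussI[of "\<lambda>x. p x + q x"]) (auto simp: distrib_right)
qed

lemma poly_gauss_sum:
  assumes "finite I" "\<And>i. i \<in> I \<Longrightarrow> poly_gauss c x0 (f i)"
  shows "poly_gauss c x0 (\<lambda>x. \<Sum>i\<in>I. f i x)"
  using assms
proof (induction rule: finite_induct)
  case empty
  then show ?case by (auto intro: poly_gaussI[of "\<lambda>_. 0"])
qed (auto intro!: poly_gauss_add)

lemma has_derivative_gauss:
  "((\<lambda>x. gauss c (x - x0)) has_derivative (\<lambda>b. - 2 * c * ((x - x0) \<bullet> b) * gauss c (x - x0))) (at x)"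
  unfolding gauss_def power2_norm_eq_inner
  by (auto intro!: derivative_eq_intros simp: inner_commute algebra_simps)

lemma poly_gauss_has_derivative:
  assumes "poly_gauss c x0 f"
  obtains D where "\<And>x. (f has_derivative D x) (at x)" "\<And>b. poly_gauss c x0 (\<lambda>x. D x b)"
proof -
  obtain p where p: "real_polynomial_function p" "f = (\<lambda>x. p x * gauss c (x - x0))"
    using assms by (auto simp: poly_gauss_def)
  obtain D where D: "\<And>x. (p has_derivative D x) (at x)" "\<And>b. real_polynomial_function (\<lambda>x. D x b)"
    using real_polynomial_function_has_derivative[OF p(1)] by blast
  show ?thesis
  proof
    show "(f has_derivative (\<lambda>b. p x * (- 2 * c * ((x - x0) \<bullet> b) * gauss c (x - x0)) + D x b * gauss c (x - x0))) (at x)" for x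
      unfolding p(2) by (rule has_derivative_mult[OF D(1) has_derivative_gauss])
    have "real_polynomial_function (\<lambda>x. (x - x0) \<bullet> b)" for b
      unfolding inner_diff_left
      by (intro real_polynomial_function_diff real_polynomial_function.intros(1) real_polynomial_function.intros(2) bounded_linear_inner_left)
    then show "poly_gauss c x0 (\<lambda>x. p x * (- 2 * c * ((x - x0) \<bullet> b) * gauss c (x - x0)) + D x b * gauss c (x - x0))" for b
      using p(1) D(2)
      by (intro poly_gaussI[of "\<lambda>x. p x * (- 2 * c * ((x - x0) \<bullet> b)) + D x b"]
         real_polynomial_function.intros(3) real_polynomial_function.intros(4) real_polynomial_function.intros(2))
         (auto simp: algebra_simps)
  qed
qed

lemma poly_gauss_dir_deriv:
  assumes "poly_gauss c x0 f"
  shows "(f has_derivative (\<lambda>b. dir_deriv b f x)) (at x)" "poly_gauss c x0 (dir_deriv b f)"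
proof -
  obtain D where D: "\<And>x. (f has_derivative D x) (at x)" "\<And>b. poly_gauss c x0 (\<lambda>x. D x b)"
    using poly_gauss_has_derivative[OF assms] by blast
  have eq: "dir_deriv b f x = D x b" for b x
    unfolding dir_deriv_def using frechet_derivative_at[OF D(1)] by metis
  show "(f has_derivative (\<lambda>b. dir_deriv b f x)) (at x)" using D(1)[of x] by (simp add: eq)
  have "dir_deriv b f = (\<lambda>x. D x b)" by (simp add: eq fun_eq_iff)
  then show "poly_gauss c x0 (dir_deriv b f)" using D(2) by simp
qed

lemma poly_gauss_bounded:
  assumes "poly_gauss c x0 f" and c: "c > 0"
  shows "bounded (range (\<lambda>x. (1 + norm x) ^ m * f x))"
proof -
  obtain p where p: "real_polynomial_function p" "f = (\<lambda>x. p x * gauss c (x - x0))"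
    using assms by (auto simp: poly_gauss_def)
  obtain C k where C: "C \<ge> 0" "\<And>x. \<bar>p x\<bar> \<le> C * (1 + norm x) ^ k"
    using real_polynomial_function_growth[OF p(1)] by blast
  obtain K where K: "\<And>x. (1 + norm x) ^ (m + k) * gauss c (x - x0) \<le> K"
    using one_plus_norm_power_gauss_bounded[OF c] by metis
  have "\<bar>(1 + norm x) ^ m * f x\<bar> \<le> C * K" for x
  proof -
    have "\<bar>(1 + norm x) ^ m * f x\<bar> = (1 + norm x) ^ m * gauss c (x - x0) * \<bar>p x\<bar>"
      by (simp add: p(2) abs_mult abs_of_nonneg)
    also have "\<dots> \<le> (1 + norm x) ^ m * gauss c (x - x0) * (C * (1 + norm x) ^ k)"
      by (intro mult_left_mono C) auto
    also have "\<dots> = C * ((1 + norm x) ^ (m + k) * gauss c (x - x0))" by (simp add: power_add)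
    also have "\<dots> \<le> C * K" by (intro mult_left_mono K C)
    finally show ?thesis .
  qed
  then show ?thesis by (auto simp: bounded_iff)
qed

text \<open>Half of the exponent absorbs the polynomial, the other half survives as the
  majorant.\<close>

lemma poly_gauss_le_gauss:
  fixes f :: "'a::euclidean_space \<Rightarrow> real"
  assumes "poly_gauss c x0 f" and c: "c > 0"
  obtains C where "C \<ge> 0" "\<And>x. \<bar>f x\<bar> \<le> C * gauss (c / 2) (x - x0)"
proof -
  obtain p where p: "real_polynomial_function p" "f = (\<lambda>x. p x * gauss c (x - x0))"
    using assms by (auto simp: poly_gauss_def)
  have "poly_gauss (c / 2) x0 (\<lambda>x. p x * gauss (c / 2) (x - x0))"
    using p(1) by (auto simp: poly_gauss_def)
  from poly_gauss_bounded[OF this, of 0] c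
  obtain C where C: "\<And>x. \<bar>p x * gauss (c / 2) (x - x0)\<bar> \<le> C" by (auto simp: bounded_iff)
  have "\<bar>f x\<bar> \<le> C * gauss (c / 2) (x - x0)" for x
  proof -
    have "gauss c (x - x0) = gauss (c / 2) (x - x0) * gauss (c / 2) (x - x0)"
      by (simp add: gauss_def exp_add[symmetric])
    then have "\<bar>f x\<bar> = \<bar>p x * gauss (c / 2) (x - x0)\<bar> * gauss (c / 2) (x - x0)"
      by (simp add: p(2) abs_mult)
    also have "\<dots> \<le> C * gauss (c / 2) (x - x0)" by (intro mult_right_mono C) simp
    finally show ?thesis .
  qed
  moreover have "C \<ge> 0" using C[of x0] by linarith
  ultimately show ?thesis using that by blast
qed

lemma poly_gauss_iter_pderiv:
  assumes "poly_gauss c x0 f"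
  shows "poly_gauss c x0 (iter_pderiv bs f)"
  by (induction bs) (auto intro: assms poly_gauss_dir_deriv)

lemma schwartz_poly_gauss:
  fixes f :: "'a::euclidean_space \<Rightarrow> real"
  assumes "poly_gauss c x0 f" "c > 0"
  shows "schwartz f"
  unfolding schwartz_def
proof (intro allI impI conjI)
  fix bs :: "'a list" and x and m :: nat
  show "iter_pderiv bs f differentiable (at x)"
    using poly_gauss_dir_deriv(1)[OF poly_gauss_iter_pderiv[OF assms(1)]] unfolding differentiable_def by blast
  show "bounded (range (\<lambda>x. (1 + norm x) ^ m * iter_pderiv bs f x))"
    by (rule poly_gauss_bounded[OF poly_gauss_iter_pderiv[OF assms(1)] assms(2)])
qed

text \<open>Bridge between two notions of derivative: \<open>laplacian\<close> differentiates twice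
  along coordinate lines, whereas \<open>schwartz\<close> iterates directional derivatives taken
  from the Frechet derivative.\<close>

lemma deriv_line:
  assumes "\<And>x. (f has_derivative (\<lambda>b. dir_deriv b f x)) (at x)"
  shows "((\<lambda>r. f (x + r *\<^sub>R b)) has_field_derivative dir_deriv b f (x + r *\<^sub>R b)) (at r)"
proof -
  have lin: "linear (\<lambda>b. dir_deriv b f (x + r *\<^sub>R b'))" for b'
    using assms has_derivative_linear by blast
  have "((\<lambda>r. f (x + r *\<^sub>R b)) has_derivative (\<lambda>h. dir_deriv (h *\<^sub>R b) f (x + r *\<^sub>R b))) (at r)"
    by (rule has_derivative_compose[OF _ assms]) (auto intro!: derivative_eq_intros)
  moreover have "dir_deriv (h *\<^sub>R b) f (x + r *\<^sub>R b) = dir_deriv b f (x + r *\<^sub>R b) * h" for h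
    using linear_scale[OF lin, of h b b] by simp
  ultimately show ?thesis by (simp add: has_field_derivative_def)
qed

lemma laplacian_poly_gauss:
  assumes "poly_gauss c x0 f"
  shows "laplacian f = (\<lambda>x. \<Sum>b\<in>Basis. dir_deriv b (dir_deriv b f) x)"
proof
  fix x
  have "(deriv ^^ 2) (\<lambda>r. f (x + r *\<^sub>R b)) 0 = dir_deriv b (dir_deriv b f) x" for b
  proof -
    have 1: "deriv (\<lambda>r. f (x + r *\<^sub>R b)) = (\<lambda>r. dir_deriv b f (x + r *\<^sub>R b))"
      using deriv_line[OF poly_gauss_dir_deriv(1)[OF assms]] by (auto intro!: DERIV_imp_deriv)
    have "deriv (\<lambda>r. dir_deriv b f (x + r *\<^sub>R b)) 0 = dir_deriv b (dir_deriv b f) (x + 0 *\<^sub>R b)"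
      by (rule DERIV_imp_deriv[OF deriv_line[OF poly_gauss_dir_deriv(1)[OF poly_gauss_dir_deriv(2)[OF assms]]]])
    then show ?thesis by (simp add: numeral_2_eq_2 1)
  qed
  then show "laplacian f x = (\<Sum>b\<in>Basis. dir_deriv b (dir_deriv b f) x)" by (simp add: laplacian_def)
qed

lemma poly_gauss_laplacian:
  assumes "poly_gauss c x0 f"
  shows "poly_gauss c x0 (laplacian f)"
  unfolding laplacian_poly_gauss[OF assms]
  by (intro poly_gauss_sum poly_gauss_dir_deriv(2) assms) auto

lemma laplacian_shift: "laplacian (\<lambda>x. f (x - x0)) y = laplacian f (y - x0)"
  by (simp add: laplacian_def algebra_simps)

text \<open>Evenness turns the line through \<open>-x\<close> in direction \<open>b\<close> into the
  reversed line through \<open>x\<close>; each of the two derivatives changes sign once. This serves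
  \<open>heat_drr\<close>, for which there is no explicit formula from which to read off the
  symmetry.\<close>

lemma laplacian_even:
  assumes "poly_gauss c 0 f" and even: "\<And>x. f (- x) = f x"
  shows "laplacian f (- x) = laplacian f x"
proof -
  have "(deriv ^^ 2) (\<lambda>r. f (- x + r *\<^sub>R b)) 0 = (deriv ^^ 2) (\<lambda>r. f (x + r *\<^sub>R b)) 0" for b
  proof -
    note d = deriv_line[OF poly_gauss_dir_deriv(1)[OF assms(1)]]
    note d2 = deriv_line[OF poly_gauss_dir_deriv(1)[OF poly_gauss_dir_deriv(2)[OF assms(1)]]]
    have eq: "f (- x + r *\<^sub>R b) = f (x + (- r) *\<^sub>R b)" for r
      using even[of "x + (- r) *\<^sub>R b"] by (simp add: algebra_simps)
    have "((\<lambda>r. f (- x + r *\<^sub>R b)) has_field_derivative - dir_deriv b f (x + (- r) *\<^sub>R b)) (at r)" for r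
      unfolding eq by (rule DERIV_mirror[of "\<lambda>r. f (x + r *\<^sub>R b)", THEN iffD1, OF d])
    then have 1: "deriv (\<lambda>r. f (- x + r *\<^sub>R b)) = (\<lambda>r. - dir_deriv b f (x + (- r) *\<^sub>R b))"
      by (auto intro!: DERIV_imp_deriv)
    have "((\<lambda>r. dir_deriv b f (x + (- r) *\<^sub>R b)) has_field_derivative - dir_deriv b (dir_deriv b f) x) (at 0)"
      using DERIV_mirror[of "\<lambda>r. dir_deriv b f (x + r *\<^sub>R b)" _ "0", THEN iffD1, OF d2] by simp
    then have "deriv (\<lambda>r. - dir_deriv b f (x + (- r) *\<^sub>R b)) 0 = dir_deriv b (dir_deriv b f) x"
      using DERIV_minus by (fastforce intro!: DERIV_imp_deriv)
    then have "(deriv ^^ 2) (\<lambda>r. f (- x + r *\<^sub>R b)) 0 = dir_deriv b (dir_deriv b f) x"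
      unfolding numeral_2_eq_2 funpow.simps o_apply id_apply 1 by simp
    moreover have "deriv (\<lambda>r. f (x + r *\<^sub>R b)) = (\<lambda>r. dir_deriv b f (x + r *\<^sub>R b))"
      using d by (auto intro!: DERIV_imp_deriv)
    then have "(deriv ^^ 2) (\<lambda>r. f (x + r *\<^sub>R b)) 0 = dir_deriv b (dir_deriv b f) x"
      using DERIV_imp_deriv[OF d2[of b x b "0"]] by (simp add: numeral_2_eq_2)
    ultimately show ?thesis by simp
  qed
  then show ?thesis by (simp add: laplacian_def)
qed

section \<open>Gaussian integrals and the semigroup identity\<close>

lemma integrable_gauss:
  assumes c: "c > 0"
  shows "integrable lborel (gauss c :: 'a::euclidean_space \<Rightarrow> real)"
proof -
  have one: "integrable lborel (\<lambda>x::real. exp (- c * x\<^sup>2))"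
  proof -
    have "integrable lborel (\<lambda>x::real. std_normal_density x * x ^ 0)" by (rule integrable_std_normal_moment)
    then have "integrable lborel (\<lambda>x::real. sqrt (2 * pi) * (std_normal_density x * x ^ 0))"
      by (rule integrable_mult_right)
    then have "integrable lborel (\<lambda>x::real. exp (- x\<^sup>2 / 2))" by (simp add: std_normal_density_def)
    from lborel_integrable_real_affine[OF this, of "sqrt (2 * c)" 0] c show ?thesis
      by (simp add: power_mult_distrib)
  qed
  have eq: "gauss c x = (\<Prod>b\<in>Basis. exp (- c * (x \<bullet> b)\<^sup>2))" for x :: 'a
    by (simp add: gauss_def exp_sum[symmetric] sum_distrib_left[symmetric] sum_negf)
      (simp add: power2_norm_eq_inner euclidean_inner[of x x] power2_eq_square[of "_ \<bullet> _"])
  have "(\<integral>\<^sup>+ x. ennreal (norm (gauss c (x::'a))) \<partial>lborel) = (\<integral>\<^sup>+ x. (\<Prod>b\<in>Basis. ennreal (exp (- c * (x \<bullet> b)\<^sup>2))) \<partial>(lborel::'a measure))"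
    by (simp add: eq prod_ennreal abs_prod)
  also have "\<dots> = (\<Prod>b\<in>(Basis::'a set). (\<integral>\<^sup>+ x. ennreal (exp (- c * x\<^sup>2)) \<partial>lborel))"
    by (rule nn_integral_lborel_prod) auto
  also have "\<dots> < \<infinity>"
    using one by (auto simp: integrable_iff_bounded ennreal_prod_eq_top less_top[symmetric] power_eq_top_ennreal)
  finally show ?thesis by (auto simp: integrable_iff_bounded)
qed

lemma integral_gauss_pos:
  assumes c: "c > 0"
  shows "(LBINT x. gauss c (x::'a::euclidean_space)) > 0"
proof -
  have "(LBINT x. gauss c (x::'a)) \<noteq> 0"
  proof
    assume "(LBINT x. gauss c (x::'a)) = 0"
    then have "AE x::'a in lborel. gauss c x = 0"
      using integral_nonneg_eq_0_iff_AE[OF integrable_gauss[OF c]] by auto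
    then have "AE x::'a in lborel. False" by (auto simp: gauss_def)
    then show False using emeasure_lborel_UNIV by (auto simp: AE_iff_measurable[OF _ refl])
  qed
  moreover have "(LBINT x. gauss c (x::'a)) \<ge> 0" by simp
  ultimately show ?thesis by linarith
qed

text \<open>Completing the square at the midpoint \<open>?m\<close> of \<open>y\<close> and
  \<open>y'\<close>: twice the sum of the squared distances from \<open>x\<close> is
  \<open>4 * (norm (x - ?m))^2 + (norm (y - y'))^2\<close>. This is the semigroup property with an
  unevaluated constant, and the source of the positive definiteness of the kernel.\<close>

lemma gauss_conv:
  fixes y y' :: "'a::euclidean_space"
  shows "(LBINT x. gauss (2 * c) (x - y) * gauss (2 * c) (x - y'))
      = (LBINT x. gauss (4 * c) (x::'a)) * gauss c (y - y')"
proof -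
  let ?m = "(1 / 2) *\<^sub>R (y + y')"
  have "gauss (2 * c) (x - y) * gauss (2 * c) (x - y') = gauss c (y - y') * gauss (4 * c) (x - ?m)" for x
  proof -
    have "2 * ((norm (x - y))\<^sup>2 + (norm (x - y'))\<^sup>2) = 4 * (norm (x - ?m))\<^sup>2 + (norm (y - y'))\<^sup>2"
      unfolding power2_norm_eq_inner by (simp add: inner_diff inner_add inner_commute algebra_simps)
    then have "- (2 * c) * (norm (x - y))\<^sup>2 + - (2 * c) * (norm (x - y'))\<^sup>2 = - c * (norm (y - y'))\<^sup>2 + - (4 * c) * (norm (x - ?m))\<^sup>2"
      by (simp add: algebra_simps) (metis (no_types, lifting) distrib_left mult.left_commute)
    then show ?thesis unfolding gauss_def exp_add[symmetric] by simp
  qed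
  then show ?thesis by (simp add: integral_lborel_shift)
qed

text \<open>
  The heat kernel without its normalising factor \<open>(4\<pi>)\<^bsup>-d/2\<^esup>\<close>, so that its total mass is some positive
  constant whose value is never needed.
\<close>

definition heat :: "real \<Rightarrow> 'a::euclidean_space \<Rightarrow> real" where
  "heat r x = r powr (- real DIM('a) / 2) * gauss (1 / (4 * r)) x"

text \<open>The common value of \<open>\<partial>\<^sub>r p\<^sub>r\<close> and \<open>\<Delta> p\<^sub>r\<close>.\<close>

definition heat_dr :: "real \<Rightarrow> 'a::euclidean_space \<Rightarrow> real" where
  "heat_dr r x = ((norm x)\<^sup>2 / (4 * r\<^sup>2) - real DIM('a) / (2 * r)) * heat r x"

text \<open>The kernel that appears when the weak formulation is tested with
  \<open>heat_dr r\<close>. It is left as a Laplacian because evenness, measurability and a Gaussian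
  bound suffice, and all three come from \<open>poly_gauss\<close>.\<close>

definition heat_drr :: "real \<Rightarrow> 'a::euclidean_space \<Rightarrow> real" where
  "heat_drr r = laplacian (heat_dr r)"

section \<open>The heat kernel: heat equation, Gaussian bounds, scaling\<close>

lemma heat_nonneg[simp]: "heat r x \<ge> 0" by (simp add: heat_def)

lemma poly_gauss_heat: "poly_gauss (1 / (4 * r)) x0 (\<lambda>x. heat r (x - x0))"
  by (rule poly_gaussI[of "\<lambda>_. r powr (- real DIM('a) / 2)"]) (auto simp: heat_def)

lemma poly_gauss_heat_dr: "poly_gauss (1 / (4 * r)) x0 (\<lambda>x::'a::euclidean_space. heat_dr r (x - x0))"
proof (rule poly_gaussI)
  have *: "real_polynomial_function (\<lambda>x::'a. \<Sum>b\<in>Basis. ((x - x0) \<bullet> b) * ((x - x0) \<bullet> b))"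
    unfolding inner_diff_left
    by (intro real_polynomial_function_sum real_polynomial_function_diff real_polynomial_function.intros(1)
        real_polynomial_function.intros(4) real_polynomial_function.intros(2) bounded_linear_inner_left) auto
  show "real_polynomial_function (\<lambda>x::'a. ((\<Sum>b\<in>Basis. ((x - x0) \<bullet> b) * ((x - x0) \<bullet> b)) / (4 * r\<^sup>2) - real DIM('a) / (2 * r)) * r powr (- real DIM('a) / 2))"
    by (intro real_polynomial_function.intros(4) real_polynomial_function.intros(2) real_polynomial_function_diff
        real_polynomial_function_divide *)
  show "heat_dr r (x - x0) = ((\<Sum>b\<in>Basis. ((x - x0) \<bullet> b) * ((x - x0) \<bullet> b)) / (4 * r\<^sup>2) - real DIM('a) / (2 * r)) * r powr (- real DIM('a) / 2)
     * gauss (1 / (4 * r)) (x - x0)" for x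
    by (simp add: heat_dr_def heat_def power2_norm_eq_inner euclidean_inner[of "x - x0" "x - x0"])
qed

lemma laplacian_gauss: "laplacian (\<lambda>x. k * gauss c x) (x::'a::euclidean_space) = k * (4 * c\<^sup>2 * (norm x)\<^sup>2 - 2 * c * DIM('a)) * gauss c x"
proof -
  have "(deriv ^^ 2) (\<lambda>r. k * gauss c (x + r *\<^sub>R b)) 0 = k * (4 * c\<^sup>2 * ((x \<bullet> b) * (x \<bullet> b)) - 2 * c) * gauss c x" if b: "b \<in> Basis" for b
  proof -
    let ?g = "\<lambda>r. exp (- c * ((norm x)\<^sup>2 + 2 * r * (x \<bullet> b) + r\<^sup>2))"
    have g: "gauss c (x + r *\<^sub>R b) = ?g r" for r
    proof -
      have "(norm (x + r *\<^sub>R b))\<^sup>2 = (norm x)\<^sup>2 + 2 * r * (x \<bullet> b) + r\<^sup>2"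
        unfolding power2_norm_eq_inner using b
        by (simp add: inner_add inner_commute power2_eq_square)
      then show ?thesis by (simp add: gauss_def)
    qed
    have 1: "deriv (\<lambda>r. k * ?g r) = (\<lambda>r. k * - c * (2 * (x \<bullet> b) + 2 * r) * ?g r)"
      by (intro ext DERIV_imp_deriv) (auto intro!: derivative_eq_intros simp: algebra_simps)
    have "deriv (\<lambda>r. k * - c * (2 * (x \<bullet> b) + 2 * r) * ?g r) 0 = k * (4 * c\<^sup>2 * ((x \<bullet> b) * (x \<bullet> b)) - 2 * c) * exp (- c * (norm x)\<^sup>2)"
      by (intro DERIV_imp_deriv) (auto intro!: derivative_eq_intros simp: algebra_simps power2_eq_square)
    moreover have "(deriv ^^ 2) h = deriv (deriv h)" for h :: "real \<Rightarrow> real" by (simp add: numeral_2_eq_2)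
    ultimately show ?thesis unfolding g by (simp only: 1) (simp add: gauss_def)
  qed
  then have "laplacian (\<lambda>x. k * gauss c x) x = (\<Sum>b\<in>Basis. k * (4 * c\<^sup>2 * ((x \<bullet> b) * (x \<bullet> b)) - 2 * c) * gauss c x)"
    by (simp add: laplacian_def)
  also have "\<dots> = k * (4 * c\<^sup>2 * (\<Sum>b\<in>Basis. (x \<bullet> b) * (x \<bullet> b)) - 2 * c * DIM('a)) * gauss c x"
    by (simp add: sum_distrib_right[symmetric] sum_subtractf sum_distrib_left[symmetric])
  finally show ?thesis by (simp add: power2_norm_eq_inner euclidean_inner[of x x])
qed

lemma laplacian_heat:
  fixes x0 :: "'a::euclidean_space"
  assumes r: "r > 0"
  shows "laplacian (\<lambda>x. heat r (x - x0)) = (\<lambda>x. heat_dr r (x - x0))"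
proof
  fix y :: 'a
  have e: "4 * (1 / (4 * r))\<^sup>2 * u = u / (4 * r\<^sup>2)" "2 * (1 / (4 * r)) * u = u / (2 * r)" for u
    using r by (auto simp: power2_eq_square)
  have "laplacian (\<lambda>x. heat r (x - x0)) y = laplacian (\<lambda>x. r powr (- real DIM('a) / 2) * gauss (1 / (4 * r)) x) (y - x0)"
    by (subst laplacian_shift) (simp add: heat_def[abs_def])
  then show "laplacian (\<lambda>x. heat r (x - x0)) y = heat_dr r (y - x0)"
    unfolding laplacian_gauss e heat_dr_def heat_def by simp
qed

lemma laplacian_heat_dr: "laplacian (\<lambda>x. heat_dr r (x - x0)) = (\<lambda>x. heat_drr r (x - x0))"
  unfolding heat_drr_def by (rule ext) (rule laplacian_shift)

lemma heat_minus: "heat r (- x) = heat r x" "heat_dr r (- x) = heat_dr r x"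
  by (simp_all add: heat_def heat_dr_def gauss_def)

lemma heat_drr_minus: "heat_drr r (- x) = heat_drr r (x :: 'a::euclidean_space)"
proof -
  have "poly_gauss (1 / (4 * r)) 0 (heat_dr r :: 'a \<Rightarrow> real)" using poly_gauss_heat_dr[of r 0] by simp
  then show ?thesis unfolding heat_drr_def by (rule laplacian_even) (rule heat_minus(2))
qed

lemma heat_commute: "heat r (x - y) = heat r (y - x)" "heat_dr r (x - y) = heat_dr r (y - x)" "heat_drr r (x - y) = heat_drr r (y - x)"
  by (metis heat_minus(1) minus_diff_eq, metis heat_minus(2) minus_diff_eq, metis heat_drr_minus minus_diff_eq)

lemma schwartz_heat: "r > 0 \<Longrightarrow> schwartz (\<lambda>x. heat r (x - x0))"
  by (rule schwartz_poly_gauss[OF poly_gauss_heat]) auto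

lemma schwartz_heat_dr: "r > 0 \<Longrightarrow> schwartz (\<lambda>x. heat_dr r (x - x0))"
  by (rule schwartz_poly_gauss[OF poly_gauss_heat_dr]) auto

lemma borel_measurable_heat[measurable]:
  assumes [measurable]: "g \<in> borel_measurable M" "f \<in> M \<rightarrow>\<^sub>M borel"
  shows "(\<lambda>x. heat (g x) (f x)) \<in> borel_measurable M"
  unfolding heat_def gauss_def by measurable

lemma borel_measurable_heat_dr[measurable]:
  assumes [measurable]: "g \<in> borel_measurable M" "f \<in> M \<rightarrow>\<^sub>M borel"
  shows "(\<lambda>x. heat_dr (g x) (f x)) \<in> borel_measurable M"
  unfolding heat_dr_def by measurable

lemma poly_gauss_heat_drr: "poly_gauss (1 / (4 * r)) 0 (heat_drr r :: 'a::euclidean_space \<Rightarrow> real)"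
proof -
  have "poly_gauss (1 / (4 * r)) 0 (heat_dr r :: 'a \<Rightarrow> real)" using poly_gauss_heat_dr[of r 0] by simp
  then show ?thesis unfolding heat_drr_def by (rule poly_gauss_laplacian)
qed

lemma borel_measurable_heat_drr[measurable]: "(heat_drr r :: 'a::euclidean_space \<Rightarrow> real) \<in> borel_measurable borel"
proof (rule borel_measurable_continuous_onI)
  show "continuous_on UNIV (heat_drr r :: 'a \<Rightarrow> real)"
    using has_derivative_continuous[OF poly_gauss_dir_deriv(1)[OF poly_gauss_heat_drr[of r, where 'a='a]]]
    by (simp add: continuous_on_eq_continuous_at)
qed

lemma heat_le: "r > 0 \<Longrightarrow> heat r (x::'a::euclidean_space) \<le> r powr (- real DIM('a) / 2)"
  using gauss_le_1[of "1 / (4 * r)" x] by (simp add: heat_def mult_left_le)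

lemma heat_drr_le_gauss:
  assumes "r > 0"
  obtains C c where "C \<ge> 0" "c > 0" "\<And>x::'a::euclidean_space. \<bar>heat_drr r x\<bar> \<le> C * gauss c x"
proof -
  from poly_gauss_le_gauss[OF poly_gauss_heat_drr[of r]] assms
  obtain C where "C \<ge> 0" "\<And>x::'a. \<bar>heat_drr r x\<bar> \<le> C * gauss (1 / (4 * r) / 2) x" by auto
  then show ?thesis using assms that[of C "1 / (4 * r) / 2"] by auto
qed

lemma gauss_antimono: "c \<le> c' \<Longrightarrow> gauss c' x \<le> gauss c x"
  by (simp add: gauss_def mult_right_mono)

text \<open>One majorant for all \<open>r\<close> in \<open>[\<delta>, R]\<close>, as needed for
  Fubini in \<open>r\<close>. The prefactors are largest at \<open>\<delta>\<close>, the Gaussian is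
  widest at \<open>R\<close>; half of the exponent \<open>1 / (4 * R)\<close> pays for the factor
  \<open>(norm x)^2\<close>, which leaves \<open>1 / (8 * R)\<close>.\<close>

lemma heat_dr_le_gauss:
  assumes "\<delta> > 0"
  obtains C c where "C \<ge> 0" "c > 0"
    "\<And>r x::'a::euclidean_space. \<delta> \<le> r \<Longrightarrow> r \<le> R \<Longrightarrow> \<bar>heat_dr r x\<bar> \<le> C * gauss c x"
proof (cases "\<delta> \<le> R")
  case False
  then show ?thesis using that[of 0 1] by auto
next
  case True
  then have R: "R > 0" using assms by simp
  obtain K where K: "K \<ge> 0" "\<And>x::'a. (1 + norm x) ^ 2 * gauss (1 / (8 * R)) (x - 0) \<le> K"
    using one_plus_norm_power_gauss_bounded[of "1 / (8 * R)" 2 "0::'a"] R by auto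
  define A where "A = (1 / (4 * \<delta>\<^sup>2) + real DIM('a) / (2 * \<delta>)) * \<delta> powr (- real DIM('a) / 2)"
  have A: "A \<ge> 0" using assms by (simp add: A_def)
  have "\<bar>heat_dr r x\<bar> \<le> (A * K) * gauss (1 / (8 * R)) x" if r: "\<delta> \<le> r" "r \<le> R" for r and x :: 'a
  proof -
    have r0: "r > 0" using r assms by linarith
    have n1: "1 \<le> (1 + norm x)\<^sup>2" "(norm x)\<^sup>2 \<le> (1 + norm x)\<^sup>2"
      by (auto intro!: power_mono)
    have "\<bar>(norm x)\<^sup>2 / (4 * r\<^sup>2) - real DIM('a) / (2 * r)\<bar> \<le> (norm x)\<^sup>2 / (4 * r\<^sup>2) + real DIM('a) / (2 * r)"
      using r0 by (auto simp: abs_le_iff)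
    also have "\<dots> \<le> (norm x)\<^sup>2 / (4 * \<delta>\<^sup>2) + real DIM('a) / (2 * \<delta>)"
      using r assms by (intro add_mono divide_left_mono mult_left_mono power_mono) auto
    also have "\<dots> \<le> (1 + norm x)\<^sup>2 / (4 * \<delta>\<^sup>2) + real DIM('a) * (1 + norm x)\<^sup>2 / (2 * \<delta>)"
      using n1 assms by (intro add_mono divide_right_mono) (auto simp: mult_le_cancel_left1)
    finally have 1: "\<bar>(norm x)\<^sup>2 / (4 * r\<^sup>2) - real DIM('a) / (2 * r)\<bar> \<le> (1 / (4 * \<delta>\<^sup>2) + real DIM('a) / (2 * \<delta>)) * (1 + norm x)\<^sup>2"
      by (simp add: algebra_simps)
    have 2: "r powr (- real DIM('a) / 2) \<le> \<delta> powr (- real DIM('a) / 2)"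
      using r assms by (intro powr_mono2') auto
    have 3: "gauss (1 / (4 * r)) x \<le> gauss (1 / (4 * R)) x"
      using r r0 by (intro gauss_antimono divide_left_mono) auto
    have 4: "gauss (1 / (4 * R)) x = gauss (1 / (8 * R)) x * gauss (1 / (8 * R)) x"
      using R by (simp add: gauss_def exp_add[symmetric])
    have "\<bar>heat_dr r x\<bar> = \<bar>(norm x)\<^sup>2 / (4 * r\<^sup>2) - real DIM('a) / (2 * r)\<bar> * (r powr (- real DIM('a) / 2) * gauss (1 / (4 * r)) x)"
      by (simp add: heat_dr_def heat_def abs_mult)
    also have "\<dots> \<le> ((1 / (4 * \<delta>\<^sup>2) + real DIM('a) / (2 * \<delta>)) * (1 + norm x)\<^sup>2) * (\<delta> powr (- real DIM('a) / 2) * gauss (1 / (4 * R)) x)"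
      using 1 2 3 assms by (intro mult_mono) auto
    also have "\<dots> = A * ((1 + norm x)\<^sup>2 * gauss (1 / (8 * R)) x) * gauss (1 / (8 * R)) x"
      by (simp add: A_def 4)
    also have "\<dots> \<le> A * K * gauss (1 / (8 * R)) x"
      using K(2)[of x] A by (intro mult_right_mono mult_left_mono) auto
    finally show ?thesis .
  qed
  then show ?thesis using that[of "A * K" "1 / (8 * R)"] A K(1) R by auto
qed

text \<open>Together with \<open>laplacian_heat\<close> this is the heat equation. The power of
  \<open>r\<close> contributes \<open>- DIM('a) / (2 * r)\<close>, the exponent contributes
  \<open>(norm x)^2 / (4 * r^2)\<close>.\<close>

lemma DERIV_heat:
  fixes x :: "'a::euclidean_space"
  assumes r: "r > 0"
  shows "((\<lambda>r. heat r x) has_field_derivative heat_dr r x) (at r)"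
proof -
  have "r powr (- (real DIM('a) / 2) - 1) = r powr (- (real DIM('a) / 2)) / r"
    using r by (simp add: powr_diff)
  then show ?thesis unfolding heat_def heat_dr_def gauss_def
    using r by (auto intro!: derivative_eq_intros simp: field_simps power2_eq_square)
qed

text \<open>Parabolic scaling, with length measured in units of \<open>sqrt r\<close>. It makes the
  mass of the kernel independent of \<open>r\<close> and reduces small-\<open>r\<close> limits to
  integrals against the fixed kernel \<open>heat 1\<close>.\<close>

lemma heat_scale:
  fixes x :: "'a::euclidean_space"
  assumes r: "r > 0"
  shows "\<bar>sqrt r\<bar> ^ DIM('a) * heat r (sqrt r *\<^sub>R x) = heat 1 x"
proof -
  have "\<bar>sqrt r\<bar> ^ DIM('a) * r powr (- real DIM('a) / 2) = r powr (real DIM('a) / 2) * r powr (- real DIM('a) / 2)"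
    using r by (simp add: powr_half_sqrt[symmetric] powr_powr powr_realpow[symmetric])
  also have "\<dots> = 1" using r by (simp add: powr_add[symmetric])
  finally have "\<bar>sqrt r\<bar> ^ DIM('a) * r powr (- real DIM('a) / 2) = 1" .
  then show ?thesis using r
    by (simp add: heat_def mult.assoc[symmetric]) (simp add: gauss_def power_mult_distrib)
qed

lemma integral_heat_scale:
  fixes g :: "'a::euclidean_space \<Rightarrow> real"
  assumes [measurable]: "g \<in> borel_measurable borel" and r: "r > 0"
  shows "(LBINT x. heat r x * g x) = (LBINT x. heat 1 x * g (sqrt r *\<^sub>R x))"
proof -
  have "(LBINT x. heat r x * g x) = (LBINT x. \<bar>sqrt r\<bar> ^ DIM('a) * (heat r (sqrt r *\<^sub>R x) * g (sqrt r *\<^sub>R x)))"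
    using integral_lborel_affine[of "\<lambda>x. heat r x * g x" "sqrt r" 0] r by simp
  also have "\<dots> = (LBINT x. heat 1 x * g (sqrt r *\<^sub>R x))"
    unfolding mult.assoc[symmetric] heat_scale[OF r] ..
  finally show ?thesis .
qed

lemma integrable_heat: "r > 0 \<Longrightarrow> integrable lborel (heat r :: 'a::euclidean_space \<Rightarrow> real)"
  unfolding heat_def by (intro integrable_mult_right integrable_gauss) auto

definition heat_mass :: "'a::euclidean_space itself \<Rightarrow> real" where
  "heat_mass _ = (LBINT x. heat 1 (x::'a))"

lemma heat_mass_pos: "heat_mass TYPE('a::euclidean_space) > 0"
  unfolding heat_mass_def heat_def using integral_gauss_pos[of "1/4", where 'a='a] by simp

lemma integral_heat: "r > 0 \<Longrightarrow> (LBINT x. heat r (x::'a::euclidean_space)) = heat_mass TYPE('a)"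
  using integral_heat_scale[of "\<lambda>_. 1" r] by (simp add: heat_mass_def)

section \<open>Convolution forms and approximate identities\<close>

lemma borel_measurable_fst_borel[measurable (raw)]:
  fixes f :: "'c \<Rightarrow> 'a::second_countable_topology \<times> 'b::second_countable_topology"
  assumes "f \<in> borel_measurable M"
  shows "(\<lambda>x. fst (f x)) \<in> borel_measurable M"
  using assms by (rule borel_measurable_continuous_on[rotated]) (intro continuous_intros)

lemma borel_measurable_snd_borel[measurable (raw)]:
  fixes f :: "'c \<Rightarrow> 'a::second_countable_topology \<times> 'b::second_countable_topology"
  assumes "f \<in> borel_measurable M"
  shows "(\<lambda>x. snd (f x)) \<in> borel_measurable M"
  using assms by (rule borel_measurable_continuous_on[rotated]) (intro continuous_intros)

lemma integrable_lborel_pairI: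
  fixes F :: "'a::euclidean_space \<times> 'b::euclidean_space \<Rightarrow> real"
  assumes [measurable]: "F \<in> borel_measurable borel"
    and fin: "(\<integral>\<^sup>+x. \<integral>\<^sup>+y. ennreal \<bar>F (x, y)\<bar> \<partial>lborel \<partial>lborel) < \<infinity>"
  shows "integrable (lborel \<Otimes>\<^sub>M lborel) F"
proof -
  have m: "(\<lambda>q. ennreal \<bar>F q\<bar>) \<in> borel_measurable (lborel \<Otimes>\<^sub>M lborel)"
    by (simp add: lborel_prod)
  have "(\<integral>\<^sup>+q. ennreal (norm (F q)) \<partial>(lborel \<Otimes>\<^sub>M lborel)) < \<infinity>"
    using fin lborel.nn_integral_fst[OF m] by simp
  then show ?thesis by (simp add: integrable_iff_bounded lborel_prod)
qed

text \<open>A single time slice is null in space-time; this lets strict and weak time ordering be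
  exchanged in the energy identity.\<close>

lemma AE_lborel_fst_neq: "AE q in (lborel :: (real \<times> 'a::euclidean_space) measure). fst q \<noteq> s"
proof -
  have "AE q in (lborel :: real measure) \<Otimes>\<^sub>M (lborel :: 'a measure). fst q \<noteq> s"
  proof (rule lborel_pair.AE_pair_measure)
    show "{q \<in> space (lborel \<Otimes>\<^sub>M lborel). fst q \<noteq> s} \<in> sets ((lborel :: real measure) \<Otimes>\<^sub>M (lborel :: 'a measure))"
      by measurable
    show "AE x in lborel. AE y in (lborel :: 'a measure). fst (x, y) \<noteq> s"
      using AE_lborel_singleton[of s] by auto
  qed
  then show ?thesis unfolding lborel_prod .
qed

lemma nn_integral_form_bounded:
  fixes k u g :: "'a::euclidean_space \<Rightarrow> real"
  assumes [measurable]: "k \<in> borel_measurable borel" "u \<in> borel_measurable borel" "g \<in> borel_measurable borel"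
    and k: "\<And>x. k x \<ge> 0" and u: "\<And>x. \<bar>u x\<bar> \<le> B"
  shows "(\<integral>\<^sup>+x. \<integral>\<^sup>+y. ennreal \<bar>k (x - y) * u x * g y\<bar> \<partial>lborel \<partial>lborel)
     \<le> ennreal B * (\<integral>\<^sup>+x. k x \<partial>lborel) * (\<integral>\<^sup>+y. \<bar>g y\<bar> \<partial>lborel)"
proof -
  have B: "B \<ge> 0" using u[of 0] by linarith
  have "(\<integral>\<^sup>+x. \<integral>\<^sup>+y. ennreal \<bar>k (x - y) * u x * g y\<bar> \<partial>lborel \<partial>lborel)
      \<le> (\<integral>\<^sup>+x. \<integral>\<^sup>+y. ennreal B * (ennreal \<bar>g y\<bar> * ennreal (k (x - y))) \<partial>lborel \<partial>lborel)"
  proof (intro nn_integral_mono)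
    fix x y
    have "\<bar>k (x - y) * u x * g y\<bar> \<le> B * (\<bar>g y\<bar> * k (x - y))"
      using mult_right_mono[OF u[of x], of "k (x - y) * \<bar>g y\<bar>"] k[of "x - y"] by (simp add: abs_mult mult_ac)
    then show "ennreal \<bar>k (x - y) * u x * g y\<bar> \<le> ennreal B * (ennreal \<bar>g y\<bar> * ennreal (k (x - y)))"
      using B k by (simp add: ennreal_mult'[symmetric] ennreal_leI)
  qed
  also have "\<dots> = (\<integral>\<^sup>+y. \<integral>\<^sup>+x. ennreal B * (ennreal \<bar>g y\<bar> * ennreal (k (x - y))) \<partial>lborel \<partial>lborel)"
    by (rule lborel_pair.Fubini'[symmetric]) (simp add: lborel_prod case_prod_beta)
  also have "\<dots> = ennreal B * (\<integral>\<^sup>+x. k x \<partial>lborel) * (\<integral>\<^sup>+y. \<bar>g y\<bar> \<partial>lborel)"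
    by (simp add: nn_integral_cmult nn_integral_multc nn_integral_lborel_shift[of "\<lambda>x. ennreal (k x)"] mult_ac)
  finally show ?thesis .
qed

text \<open>The weighted Young inequality \<open>\<bar>u\<bar> * \<bar>g\<bar> \<le> u^2 / \<eta> +
  \<eta> * g^2\<close> separates the factors, after which the kernel integrates out in whichever
  variable is left. The free \<open>\<eta>\<close> takes the place of Cauchy-Schwarz: it makes one
  term small before the other is handled.\<close>

lemma nn_integral_form_L2:
  fixes k u g :: "'a::euclidean_space \<Rightarrow> real"
  assumes [measurable]: "k \<in> borel_measurable borel" "u \<in> borel_measurable borel" "g \<in> borel_measurable borel"
    and k: "\<And>x. k x \<ge> 0" and \<eta>: "\<eta> > 0"
  shows "(\<integral>\<^sup>+x. \<integral>\<^sup>+y. ennreal \<bar>k (x - y) * u x * g y\<bar> \<partial>lborel \<partial>lborel)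
     \<le> (\<integral>\<^sup>+x. k x \<partial>lborel) * ((\<integral>\<^sup>+x. (u x)\<^sup>2 / \<eta> \<partial>lborel) + (\<integral>\<^sup>+y. \<eta> * (g y)\<^sup>2 \<partial>lborel))"
proof -
  have "(\<integral>\<^sup>+x. \<integral>\<^sup>+y. ennreal \<bar>k (x - y) * u x * g y\<bar> \<partial>lborel \<partial>lborel)
      \<le> (\<integral>\<^sup>+x. \<integral>\<^sup>+y. ennreal ((u x)\<^sup>2 / \<eta>) * ennreal (k (x - y)) + ennreal (\<eta> * (g y)\<^sup>2) * ennreal (k (x - y)) \<partial>lborel \<partial>lborel)"
  proof (intro nn_integral_mono)
    fix x y
    have "2 * (\<bar>u x\<bar> * \<bar>g y\<bar>) \<le> (u x)\<^sup>2 / \<eta> + \<eta> * (g y)\<^sup>2"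
    proof -
      have "0 \<le> (\<bar>u x\<bar> - \<eta> * \<bar>g y\<bar>)\<^sup>2 / \<eta>" using \<eta> by simp
      also have "\<dots> = (u x)\<^sup>2 / \<eta> + \<eta> * (g y)\<^sup>2 - 2 * (\<bar>u x\<bar> * \<bar>g y\<bar>)"
        using \<eta> by (simp add: power2_diff power_mult_distrib field_simps) (simp add: power2_eq_square)
      finally show ?thesis by simp
    qed
    moreover have "0 \<le> \<bar>u x\<bar> * \<bar>g y\<bar>" by simp
    ultimately have "\<bar>u x\<bar> * \<bar>g y\<bar> \<le> (u x)\<^sup>2 / \<eta> + \<eta> * (g y)\<^sup>2" by linarith
    from mult_right_mono[OF this k[of "x - y"]]
    have "\<bar>k (x - y) * u x * g y\<bar> \<le> (u x)\<^sup>2 / \<eta> * k (x - y) + \<eta> * (g y)\<^sup>2 * k (x - y)"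
      using k[of "x - y"] by (simp add: abs_mult distrib_left distrib_right mult_ac)
    then show "ennreal \<bar>k (x - y) * u x * g y\<bar> \<le> ennreal ((u x)\<^sup>2 / \<eta>) * ennreal (k (x - y)) + ennreal (\<eta> * (g y)\<^sup>2) * ennreal (k (x - y))"
      using \<eta> k by (simp add: ennreal_mult'[symmetric] ennreal_plus[symmetric] ennreal_leI del: ennreal_plus)
  qed
  also have "\<dots> = (\<integral>\<^sup>+x. \<integral>\<^sup>+y. ennreal ((u x)\<^sup>2 / \<eta>) * ennreal (k (x - y)) \<partial>lborel \<partial>lborel)
     + (\<integral>\<^sup>+x. \<integral>\<^sup>+y. ennreal (\<eta> * (g y)\<^sup>2) * ennreal (k (x - y)) \<partial>lborel \<partial>lborel)"
    by (simp add: nn_integral_add)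
  also have "(\<integral>\<^sup>+x. \<integral>\<^sup>+y. ennreal (\<eta> * (g y)\<^sup>2) * ennreal (k (x - y)) \<partial>lborel \<partial>lborel)
     = (\<integral>\<^sup>+y. \<integral>\<^sup>+x. ennreal (\<eta> * (g y)\<^sup>2) * ennreal (k (x - y)) \<partial>lborel \<partial>lborel)"
    by (rule lborel_pair.Fubini'[symmetric]) (simp add: lborel_prod case_prod_beta)
  also have "\<dots> = (\<integral>\<^sup>+x. k x \<partial>lborel) * (\<integral>\<^sup>+y. \<eta> * (g y)\<^sup>2 \<partial>lborel)"
    by (simp add: nn_integral_cmult nn_integral_multc nn_integral_lborel_shift[of "\<lambda>x. ennreal (k x)"] mult_ac)
  also have "(\<integral>\<^sup>+x. \<integral>\<^sup>+y. ennreal ((u x)\<^sup>2 / \<eta>) * ennreal (k (x - y)) \<partial>lborel \<partial>lborel) = (\<integral>\<^sup>+x. k x \<partial>lborel) * (\<integral>\<^sup>+x. (u x)\<^sup>2 / \<eta> \<partial>lborel)"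
    by (simp add: nn_integral_cmult nn_integral_multc nn_integral_lborel_reflect[of "\<lambda>x. ennreal (k x)"] mult_ac)
  finally show ?thesis by (simp add: distrib_left)
qed

text \<open>An integral over the product measure, so that one integrability condition gives both
  iterated integrals, \<open>form_iterated\<close> and \<open>form_iterated'\<close>.\<close>

definition form :: "('a::euclidean_space \<Rightarrow> real) \<Rightarrow> ('a \<Rightarrow> real) \<Rightarrow> ('a \<Rightarrow> real) \<Rightarrow> real" where
  "form k u g = (\<integral>q. k (fst q - snd q) * u (fst q) * g (snd q) \<partial>(lborel \<Otimes>\<^sub>M lborel))"

abbreviation form_integrable :: "('a::euclidean_space \<Rightarrow> real) \<Rightarrow> ('a \<Rightarrow> real) \<Rightarrow> ('a \<Rightarrow> real) \<Rightarrow> bool" where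
  "form_integrable k u g \<equiv> integrable (lborel \<Otimes>\<^sub>M lborel) (\<lambda>q. k (fst q - snd q) * u (fst q) * g (snd q))"

lemma form_iterated:
  assumes "form_integrable k u g"
  shows "form k u g = (LBINT x. u x * (LBINT y. k (x - y) * g y))"
proof -
  have "form k u g = (LBINT x. LBINT y. k (x - y) * u x * g y)"
    unfolding form_def using lborel_pair.integral_fst'[OF assms] by simp
  also have "\<dots> = (LBINT x. LBINT y. u x * (k (x - y) * g y))" by (simp add: mult_ac)
  finally show ?thesis by simp
qed

lemma form_iterated':
  assumes "form_integrable k u g"
  shows "form k u g = (LBINT y. g y * (LBINT x. k (x - y) * u x))"
proof -
  have "form k u g = (LBINT y. LBINT x. k (x - y) * u x * g y)"
    unfolding form_def using lborel_pair.integral_snd[of "\<lambda>x y. k (x - y) * u x * g y"] assms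
    by (simp add: case_prod_unfold)
  also have "\<dots> = (LBINT y. LBINT x. g y * (k (x - y) * u x))" by (simp add: mult_ac)
  finally show ?thesis by simp
qed

lemma form_integrable_bounded:
  fixes k u g :: "'a::euclidean_space \<Rightarrow> real"
  assumes k: "integrable lborel k" "\<And>x. k x \<ge> 0" and u: "u \<in> borel_measurable borel" "\<And>x. \<bar>u x\<bar> \<le> B"
    and g: "integrable lborel g"
  shows "form_integrable k u g"
proof (rule integrable_lborel_pairI)
  have [measurable]: "k \<in> borel_measurable borel" "u \<in> borel_measurable borel" "g \<in> borel_measurable borel"
    using k u g by auto
  show "(\<lambda>q. k (fst q - snd q) * u (fst q) * g (snd q)) \<in> borel_measurable borel" by measurable
  have "(\<integral>\<^sup>+x. \<integral>\<^sup>+y. ennreal \<bar>k (x - y) * u x * g y\<bar> \<partial>lborel \<partial>lborel)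
     \<le> ennreal B * (\<integral>\<^sup>+x. k x \<partial>lborel) * (\<integral>\<^sup>+y. \<bar>g y\<bar> \<partial>lborel)"
    using k(2) u(2) by (intro nn_integral_form_bounded) auto
  also have "\<dots> < \<infinity>" using k g by (simp add: integrable_iff_bounded ennreal_mult_less_top)
  finally show "(\<integral>\<^sup>+x. \<integral>\<^sup>+y. ennreal \<bar>k (fst (x, y) - snd (x, y)) * u (fst (x, y)) * g (snd (x, y))\<bar> \<partial>lborel \<partial>lborel) < \<infinity>"
    by simp
qed

lemma nn_integral_form_L1:
  fixes k u g :: "'a::euclidean_space \<Rightarrow> real"
  assumes [measurable]: "u \<in> borel_measurable borel" "g \<in> borel_measurable borel"
    and k: "\<And>x. \<bar>k x\<bar> \<le> B"
  shows "(\<integral>\<^sup>+x. \<integral>\<^sup>+y. ennreal \<bar>k (x - y) * u x * g y\<bar> \<partial>lborel \<partial>lborel)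
     \<le> ennreal B * ((\<integral>\<^sup>+x. \<bar>u x\<bar> \<partial>lborel) * (\<integral>\<^sup>+y. \<bar>g y\<bar> \<partial>lborel))"
proof -
  have B: "B \<ge> 0" using k[of 0] by linarith
  have "(\<integral>\<^sup>+x. \<integral>\<^sup>+y. ennreal \<bar>k (x - y) * u x * g y\<bar> \<partial>lborel \<partial>lborel)
      \<le> (\<integral>\<^sup>+x. \<integral>\<^sup>+y. ennreal B * (ennreal \<bar>u x\<bar> * ennreal \<bar>g y\<bar>) \<partial>lborel \<partial>lborel)"
  proof (intro nn_integral_mono)
    fix x y
    have "\<bar>k (x - y) * u x * g y\<bar> \<le> B * (\<bar>u x\<bar> * \<bar>g y\<bar>)"
      using mult_right_mono[OF k[of "x - y"], of "\<bar>u x\<bar> * \<bar>g y\<bar>"] by (simp add: abs_mult mult_ac)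
    then show "ennreal \<bar>k (x - y) * u x * g y\<bar> \<le> ennreal B * (ennreal \<bar>u x\<bar> * ennreal \<bar>g y\<bar>)"
      using B by (simp add: ennreal_mult'[symmetric] ennreal_leI)
  qed
  also have "\<dots> = ennreal B * ((\<integral>\<^sup>+x. \<bar>u x\<bar> \<partial>lborel) * (\<integral>\<^sup>+y. \<bar>g y\<bar> \<partial>lborel))"
    by (simp add: nn_integral_cmult nn_integral_multc)
  finally show ?thesis .
qed

lemma form_L1:
  fixes k u g :: "'a::euclidean_space \<Rightarrow> real"
  assumes k: "k \<in> borel_measurable borel" "\<And>x. \<bar>k x\<bar> \<le> B"
    and u: "integrable lborel u" and g: "integrable lborel g"
  shows "form_integrable k u g" "\<bar>form k u g\<bar> \<le> B * ((LBINT x. \<bar>u x\<bar>) * (LBINT x. \<bar>g x\<bar>))"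
proof -
  have [measurable]: "k \<in> borel_measurable borel" "u \<in> borel_measurable borel" "g \<in> borel_measurable borel"
    using k u g by auto
  have B: "B \<ge> 0" using k(2)[of 0] by linarith
  let ?I = "\<integral>\<^sup>+x. \<integral>\<^sup>+y. ennreal \<bar>k (x - y) * u x * g y\<bar> \<partial>lborel \<partial>lborel"
  have "?I \<le> ennreal B * ((\<integral>\<^sup>+x. \<bar>u x\<bar> \<partial>lborel) * (\<integral>\<^sup>+y. \<bar>g y\<bar> \<partial>lborel))"
    using k(2) by (intro nn_integral_form_L1) auto
  also have "(\<integral>\<^sup>+x. \<bar>u x\<bar> \<partial>lborel) = ennreal (LBINT x. \<bar>u x\<bar>)"
    using u by (intro nn_integral_eq_integral) auto
  also have "(\<integral>\<^sup>+x. \<bar>g x\<bar> \<partial>lborel) = ennreal (LBINT x. \<bar>g x\<bar>)"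
    using g by (intro nn_integral_eq_integral) auto
  finally have bd: "?I \<le> ennreal (B * ((LBINT x. \<bar>u x\<bar>) * (LBINT x. \<bar>g x\<bar>)))"
    using B by (simp add: ennreal_mult'[symmetric])
  show int: "form_integrable k u g"
  proof (rule integrable_lborel_pairI)
    show "(\<lambda>q. k (fst q - snd q) * u (fst q) * g (snd q)) \<in> borel_measurable borel" by measurable
    show "(\<integral>\<^sup>+x. \<integral>\<^sup>+y. ennreal \<bar>k (fst (x, y) - snd (x, y)) * u (fst (x, y)) * g (snd (x, y))\<bar> \<partial>lborel \<partial>lborel) < \<infinity>"
      using le_less_trans[OF bd ennreal_less_top] by simp
  qed
  have m: "(\<lambda>q. ennreal (norm (k (fst q - snd q) * u (fst q) * g (snd q)))) \<in> borel_measurable (lborel \<Otimes>\<^sub>M lborel)"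
    by (simp add: lborel_prod)
  have "ennreal (norm (form k u g)) \<le> (\<integral>\<^sup>+q. norm (k (fst q - snd q) * u (fst q) * g (snd q)) \<partial>(lborel \<Otimes>\<^sub>M lborel))"
    unfolding form_def by (rule integral_norm_bound_ennreal[OF int])
  also have "\<dots> = ?I" using lborel.nn_integral_fst[OF m] by simp
  also note bd
  finally show "\<bar>form k u g\<bar> \<le> B * ((LBINT x. \<bar>u x\<bar>) * (LBINT x. \<bar>g x\<bar>))"
    using B by (subst (asm) ennreal_le_iff) auto
qed

lemma form_L2:
  fixes k u g :: "'a::euclidean_space \<Rightarrow> real"
  assumes k: "integrable lborel k" "\<And>x. k x \<ge> 0"
    and u: "u \<in> borel_measurable borel" "integrable lborel (\<lambda>x. (u x)\<^sup>2)"
    and g: "g \<in> borel_measurable borel" "integrable lborel (\<lambda>x. (g x)\<^sup>2)"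
  shows "form_integrable k u g"
    and "\<eta> > 0 \<Longrightarrow> \<bar>form k u g\<bar> \<le> (LBINT x. k x) * ((LBINT x. (u x)\<^sup>2) / \<eta> + \<eta> * (LBINT x. (g x)\<^sup>2))"
proof -
  have [measurable]: "k \<in> borel_measurable borel" "u \<in> borel_measurable borel" "g \<in> borel_measurable borel"
    using k u g by auto
  let ?I = "\<integral>\<^sup>+x. \<integral>\<^sup>+y. ennreal \<bar>k (x - y) * u x * g y\<bar> \<partial>lborel \<partial>lborel"
  have bd: "?I \<le> ennreal ((LBINT x. k x) * ((LBINT x. (u x)\<^sup>2) / \<eta> + \<eta> * (LBINT x. (g x)\<^sup>2)))"
    if \<eta>: "\<eta> > 0" for \<eta>
  proof -
    have "?I \<le> (\<integral>\<^sup>+x. k x \<partial>lborel) * ((\<integral>\<^sup>+x. (u x)\<^sup>2 / \<eta> \<partial>lborel) + (\<integral>\<^sup>+y. \<eta> * (g y)\<^sup>2 \<partial>lborel))"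
      using k(2) \<eta> by (intro nn_integral_form_L2) auto
    also have "(\<integral>\<^sup>+x. k x \<partial>lborel) = ennreal (LBINT x. k x)"
      using k by (intro nn_integral_eq_integral) auto
    also have "(\<integral>\<^sup>+x. (u x)\<^sup>2 / \<eta> \<partial>lborel) = ennreal (LBINT x. (u x)\<^sup>2 / \<eta>)"
      using u \<eta> by (intro nn_integral_eq_integral) auto
    also have "(\<integral>\<^sup>+x. \<eta> * (g x)\<^sup>2 \<partial>lborel) = ennreal (LBINT x. \<eta> * (g x)\<^sup>2)"
      using g \<eta> by (intro nn_integral_eq_integral) auto
    finally show ?thesis
      using \<eta> k(2) by (simp add: ennreal_plus[symmetric] ennreal_mult'[symmetric] del: ennreal_plus)
  qed
  show int: "form_integrable k u g"
  proof (rule integrable_lborel_pairI)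
    show "(\<lambda>q. k (fst q - snd q) * u (fst q) * g (snd q)) \<in> borel_measurable borel" by measurable
    show "(\<integral>\<^sup>+x. \<integral>\<^sup>+y. ennreal \<bar>k (fst (x, y) - snd (x, y)) * u (fst (x, y)) * g (snd (x, y))\<bar> \<partial>lborel \<partial>lborel) < \<infinity>"
      using le_less_trans[OF bd[of 1] ennreal_less_top] by simp
  qed
  show "\<bar>form k u g\<bar> \<le> (LBINT x. k x) * ((LBINT x. (u x)\<^sup>2) / \<eta> + \<eta> * (LBINT x. (g x)\<^sup>2))"
    if \<eta>: "\<eta> > 0"
  proof -
    have m: "(\<lambda>q. ennreal (norm (k (fst q - snd q) * u (fst q) * g (snd q)))) \<in> borel_measurable (lborel \<Otimes>\<^sub>M lborel)"
      by (simp add: lborel_prod)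
    have "ennreal (norm (form k u g)) \<le> (\<integral>\<^sup>+q. norm (k (fst q - snd q) * u (fst q) * g (snd q)) \<partial>(lborel \<Otimes>\<^sub>M lborel))"
      unfolding form_def by (rule integral_norm_bound_ennreal[OF int])
    also have "\<dots> = ?I" using lborel.nn_integral_fst[OF m] by simp
    also have "\<dots> \<le> ennreal ((LBINT x. k x) * ((LBINT x. (u x)\<^sup>2) / \<eta> + \<eta> * (LBINT x. (g x)\<^sup>2)))"
      by (rule bd[OF \<eta>])
    finally show ?thesis using \<eta> k(2) by (subst (asm) ennreal_le_iff) auto
  qed
qed

text \<open>Positive definiteness of the Gaussian: by \<open>gauss_conv\<close> the kernel
  \<open>gauss c\<close> is, up to a positive constant, the self-convolution of
  \<open>gauss (2 * c)\<close>, so the form is a squared L2 norm. The exchange of integrals is done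
  for a function of three points \<open>(x, (y, y'))\<close>, integrable because \<open>g\<close> is
  and the Gaussian is bounded by \<open>1\<close>.\<close>

lemma form_gauss_self:
  fixes g :: "'a::euclidean_space \<Rightarrow> real"
  assumes g: "integrable lborel g" and c: "c > 0"
  shows "integrable lborel (\<lambda>x. (LBINT y. gauss (2 * c) (x - y) * g y)\<^sup>2)"
    and "(LBINT x. (LBINT y. gauss (2 * c) (x - y) * g y)\<^sup>2) = (LBINT x. gauss (4 * c) (x::'a)) * form (gauss c) g g"
proof -
  have [measurable]: "g \<in> borel_measurable borel" using g by auto
  let ?A = "\<integral>x. gauss (4 * c) (x::'a) \<partial>lborel"
  define F where "F q = gauss (2 * c) (fst q - fst (snd q)) * g (fst (snd q)) * (gauss (2 * c) (fst q - snd (snd q)) * g (snd (snd q)))"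
    for q :: "'a \<times> 'a \<times> 'a"
  have [measurable]: "F \<in> borel_measurable borel" unfolding F_def by measurable
  have conv: "(LBINT x. gauss (2 * c) (x - y) * gauss (2 * c) (x - y')) = ?A * gauss c (y - y')" for y y' :: 'a
    by (rule gauss_conv)
  have nnconv: "(\<integral>\<^sup>+x. ennreal (gauss (2 * c) (x - y) * gauss (2 * c) (x - y')) \<partial>lborel) = ennreal (?A * gauss c (y - y'))" for y y' :: 'a
  proof -
    have "integrable lborel (\<lambda>x. gauss (2 * c) (x - y) * gauss (2 * c) (x - y'))"
      using c gauss_le_1[of "2 * c"]
      by (intro integrable_mult_bounded[where B=1] integrable_lborel_shift integrable_gauss) auto
    then show ?thesis unfolding conv[symmetric] by (intro nn_integral_eq_integral) auto
  qed
  have int: "integrable (lborel \<Otimes>\<^sub>M lborel) F"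
  proof (rule integrable_lborel_pairI)
    have "(\<integral>\<^sup>+x. \<integral>\<^sup>+y. ennreal \<bar>F (x, y)\<bar> \<partial>lborel \<partial>lborel) = (\<integral>\<^sup>+y. \<integral>\<^sup>+x. ennreal \<bar>F (x, y)\<bar> \<partial>lborel \<partial>lborel)"
      by (rule lborel_pair.Fubini'[symmetric]) (simp add: lborel_prod case_prod_beta)
    also have "\<dots> = (\<integral>\<^sup>+y. \<integral>\<^sup>+x. ennreal (\<bar>g (fst y)\<bar> * \<bar>g (snd y)\<bar>) * ennreal (gauss (2 * c) (x - fst y) * gauss (2 * c) (x - snd y)) \<partial>lborel \<partial>lborel)"
      by (intro nn_integral_cong) (simp add: F_def abs_mult ennreal_mult'[symmetric] mult_ac)
    also have "\<dots> = (\<integral>\<^sup>+y. ennreal (\<bar>g (fst y)\<bar> * \<bar>g (snd y)\<bar>) * ennreal (?A * gauss c (fst y - snd y)) \<partial>lborel)"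
      by (simp add: nn_integral_cmult nnconv)
    also have "\<dots> \<le> (\<integral>\<^sup>+y. ennreal ?A * (ennreal \<bar>g (fst y)\<bar> * ennreal \<bar>g (snd y)\<bar>) \<partial>lborel)"
    proof (intro nn_integral_mono)
      fix y :: "'a \<times> 'a"
      have "?A * gauss c (fst y - snd y) \<le> ?A * 1"
        using c gauss_le_1[of c "fst y - snd y"] by (intro mult_left_mono) auto
      from mult_left_mono[OF this, of "\<bar>g (fst y)\<bar> * \<bar>g (snd y)\<bar>"]
      show "ennreal (\<bar>g (fst y)\<bar> * \<bar>g (snd y)\<bar>) * ennreal (?A * gauss c (fst y - snd y))
          \<le> ennreal ?A * (ennreal \<bar>g (fst y)\<bar> * ennreal \<bar>g (snd y)\<bar>)"
        by (simp add: ennreal_mult'[symmetric] ennreal_leI mult_ac)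
    qed
    also have "\<dots> = ennreal ?A * (\<integral>\<^sup>+y. ennreal \<bar>g (fst y)\<bar> * ennreal \<bar>g (snd y)\<bar> \<partial>(lborel \<Otimes>\<^sub>M lborel))"
      by (simp add: nn_integral_cmult lborel_prod)
    also have "\<dots> = ennreal ?A * (\<integral>\<^sup>+x. \<integral>\<^sup>+y. ennreal \<bar>g x\<bar> * ennreal \<bar>g y\<bar> \<partial>lborel \<partial>lborel)"
      using lborel.nn_integral_fst[of "\<lambda>y. ennreal \<bar>g (fst y)\<bar> * ennreal \<bar>g (snd y)\<bar>" "lborel :: 'a measure"] by simp
    also have "\<dots> = ennreal ?A * ((\<integral>\<^sup>+x. ennreal \<bar>g x\<bar> \<partial>lborel) * (\<integral>\<^sup>+x. ennreal \<bar>g x\<bar> \<partial>lborel))"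
      by (simp add: nn_integral_cmult nn_integral_multc)
    also have "\<dots> < \<infinity>" using g by (simp add: integrable_iff_bounded ennreal_mult_less_top)
    finally show "(\<integral>\<^sup>+x. \<integral>\<^sup>+y. ennreal \<bar>F (x, y)\<bar> \<partial>lborel \<partial>lborel) < \<infinity>" .
  qed simp
  have sq: "(LBINT y. F (x, y)) = (LBINT y. gauss (2 * c) (x - y) * g y)\<^sup>2" for x
  proof -
    let ?h = "\<lambda>y. gauss (2 * c) (x - y) * g y"
    have h: "integrable lborel ?h"
    proof -
      have "integrable lborel (\<lambda>y. g y * gauss (2 * c) (x - y))"
        using c by (intro integrable_mult_bounded[OF g, of _ 1]) (auto intro: gauss_le_1)
      then show ?thesis by (simp add: mult.commute)
    qed
    have "integrable (lborel \<Otimes>\<^sub>M lborel) (\<lambda>q. ?h (fst q) * ?h (snd q))"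
    proof (rule integrable_lborel_pairI)
      have "(\<integral>\<^sup>+y. \<integral>\<^sup>+y'. ennreal \<bar>?h y * ?h y'\<bar> \<partial>lborel \<partial>lborel) = (\<integral>\<^sup>+y. \<integral>\<^sup>+y'. ennreal \<bar>?h y\<bar> * ennreal \<bar>?h y'\<bar> \<partial>lborel \<partial>lborel)"
        by (simp only: abs_mult[of "?h _" "?h _"] ennreal_mult'[OF abs_ge_zero])
      also have "\<dots> = (\<integral>\<^sup>+y. ennreal \<bar>?h y\<bar> \<partial>lborel) * (\<integral>\<^sup>+y. ennreal \<bar>?h y\<bar> \<partial>lborel)"
        by (subst nn_integral_cmult, measurable, subst nn_integral_multc, measurable)
      also have "\<dots> < \<infinity>" using h by (simp add: integrable_iff_bounded ennreal_mult_less_top)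
      finally show "(\<integral>\<^sup>+y. \<integral>\<^sup>+y'. ennreal \<bar>?h (fst (y, y')) * ?h (snd (y, y'))\<bar> \<partial>lborel \<partial>lborel) < \<infinity>" by simp
    qed measurable
    from lborel_pair.integral_fst'[OF this]
    have "(\<integral>q. ?h (fst q) * ?h (snd q) \<partial>(lborel \<Otimes>\<^sub>M lborel)) = (LBINT y. ?h y)\<^sup>2"
      by (simp add: power2_eq_square)
    then show ?thesis by (simp add: F_def lborel_prod)
  qed
  show "integrable lborel (\<lambda>x. (LBINT y. gauss (2 * c) (x - y) * g y)\<^sup>2)"
    using lborel_pair.integrable_fst'[OF int] by (simp add: sq)
  have "(LBINT x. (LBINT y. gauss (2 * c) (x - y) * g y)\<^sup>2) = (LBINT y. LBINT x. F (x, y))"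
    using lborel_pair.Fubini_integral[of "\<lambda>x y. F (x, y)"] int by (simp add: sq)
  also have "\<dots> = (LBINT y. LBINT x. (g (fst y) * g (snd y)) * (gauss (2 * c) (x - fst y) * gauss (2 * c) (x - snd y)))"
    by (simp add: F_def mult_ac)
  also have "\<dots> = (LBINT y. ?A * (gauss c (fst y - snd y) * g (fst y) * g (snd y)))"
    unfolding integral_mult_right_zero[of _ "g _ * g _"] conv
    by (rule Bochner_Integration.integral_cong) (auto simp: mult_ac)
  also have "\<dots> = ?A * form (gauss c) g g" by (simp add: form_def lborel_prod)
  finally show "(LBINT x. (LBINT y. gauss (2 * c) (x - y) * g y)\<^sup>2) = ?A * form (gauss c) g g" .
qed

lemma form_heat: "form (heat r :: 'a::euclidean_space \<Rightarrow> real) u g = r powr (- real DIM('a) / 2) * form (gauss (1 / (4 * r))) u g"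
  unfolding form_def heat_def mult.assoc by simp

text \<open>Doubling the exponent \<open>1 / (4 * r)\<close> corresponds to halving
  \<open>r\<close>, so zero energy at \<open>r\<close> kills the smoothing of \<open>g\<close> at
  scale \<open>r / 2\<close>.\<close>

lemma form_heat_self:
  fixes g :: "'a::euclidean_space \<Rightarrow> real"
  assumes g: "integrable lborel g" and r: "r > 0"
  shows "form (heat r) g g \<ge> 0"
    and "form (heat r) g g = 0 \<Longrightarrow> AE x in lborel. (LBINT y. heat (r / 2) (x - y) * g y) = 0"
proof -
  let ?c = "1 / (4 * r)"
  have c: "?c > 0" using r by simp
  note s = form_gauss_self[OF g c]
  have A: "(LBINT x. gauss (4 * ?c) (x::'a)) > 0" using c by (intro integral_gauss_pos) simp
  have "(LBINT x. gauss (4 * ?c) (x::'a)) * form (gauss ?c) g g \<ge> 0"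
    unfolding s(2)[symmetric] by (rule integral_nonneg_AE) simp
  then have "form (gauss ?c) g g \<ge> 0" using A by (simp only: zero_le_mult_iff) linarith
  then show "form (heat r) g g \<ge> 0" unfolding form_heat by (intro mult_nonneg_nonneg) auto
  assume "form (heat r) g g = 0"
  then have "form (gauss ?c) g g = 0" unfolding form_heat using r by simp
  then have "(LBINT x. (LBINT y. gauss (2 * ?c) (x - y) * g y)\<^sup>2) = 0" using s(2) by simp
  then have "AE x in lborel. (LBINT y. gauss (2 * ?c) (x - y) * g y)\<^sup>2 = 0"
    using integral_nonneg_eq_0_iff_AE[OF s(1)] by simp
  then show "AE x in lborel. (LBINT y. heat (r / 2) (x - y) * g y) = 0"
    by eventually_elim (simp add: heat_def mult.assoc)
qed

text \<open>With \<open>v = x - y\<close> and parabolic scaling, the form becomes the integral of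
  \<open>heat 1 v\<close> against the correlation \<open>C (sqrt r *\<^sub>R v)\<close>. Since
  \<open>C\<close> is bounded and continuous, dominated convergence puts \<open>C 0\<close> in the
  limit; \<open>u\<close> itself may be discontinuous.\<close>

lemma form_heat_tendsto_bounded:
  fixes u g :: "'a::euclidean_space \<Rightarrow> real"
  assumes u[measurable]: "u \<in> borel_measurable borel" and B: "\<And>x. \<bar>u x\<bar> \<le> B" and g: "integrable lborel g"
    and \<delta>: "\<And>n. \<delta> n > 0" "\<delta> \<longlonglongrightarrow> 0"
  shows "(\<lambda>n. form (heat (\<delta> n)) u g) \<longlonglongrightarrow> heat_mass TYPE('a) * (LBINT x. u x * g x)"
proof -
  have [measurable]: "g \<in> borel_measurable borel" using g by auto
  define C where "C v = (LBINT x. g (x - v) * u x)" for v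
  have cont: "continuous_on UNIV C" unfolding C_def by (rule continuous_on_correlation[OF g u B])
  have [measurable]: "C \<in> borel_measurable borel" by (rule borel_measurable_continuous_onI[OF cont])
  have Cb: "\<bar>C v\<bar> \<le> B * (LBINT x. \<bar>g x\<bar>)" for v
  proof -
    have gv: "integrable lborel (\<lambda>x. g (x - v))" by (rule integrable_lborel_shift[OF g])
    have "\<bar>C v\<bar> \<le> (LBINT x. \<bar>g (x - v) * u x\<bar>)"
      unfolding C_def by (rule integral_abs_bound)
    also have "\<dots> \<le> (LBINT x. B * \<bar>g (x - v)\<bar>)"
    proof (rule integral_mono)
      show "integrable lborel (\<lambda>x. \<bar>g (x - v) * u x\<bar>)"
        using integrable_mult_bounded[OF gv u B] by simp
      show "\<bar>g (x - v) * u x\<bar> \<le> B * \<bar>g (x - v)\<bar>" for x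
        using mult_left_mono[OF B[of x], of "\<bar>g (x - v)\<bar>"] by (simp add: abs_mult mult_ac)
    qed (use gv in simp)
    also have "\<dots> = B * (LBINT x. \<bar>g x\<bar>)"
      by (simp add: integral_lborel_shift[of "\<lambda>x. \<bar>g x\<bar>"])
    finally show ?thesis .
  qed
  have eq: "form (heat r) u g = (LBINT v. heat 1 v * C (sqrt r *\<^sub>R v))" if r: "r > 0" for r
  proof -
    have fi: "form_integrable (heat r) u g" by (rule form_integrable_bounded[OF integrable_heat[OF r] _ u B g]) simp
    have "form (heat r) u g = (LBINT x. u x * (LBINT y. heat r (x - y) * g y))"
      by (rule form_iterated[OF fi])
    also have "\<dots> = (LBINT x. (LBINT v. heat r v * (g (x - v) * u x)))"
    proof (rule Bochner_Integration.integral_cong[OF refl])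
      fix x
      have "(LBINT y. heat r (x - y) * g y) = (LBINT v. heat r v * g (x - v))"
        using integral_lborel_reflect[of "\<lambda>v. heat r v * g (x - v)" x] by simp
      then have "u x * (LBINT y. heat r (x - y) * g y) = (LBINT v. u x * (heat r v * g (x - v)))" by simp
      then show "u x * (LBINT y. heat r (x - y) * g y) = (LBINT v. heat r v * (g (x - v) * u x))"
        by (simp add: mult_ac)
    qed
    also have "\<dots> = (LBINT v. (LBINT x. heat r v * (g (x - v) * u x)))"
    proof (rule lborel_pair.Fubini_integral[symmetric], rule integrable_lborel_pairI)
      have "(\<integral>\<^sup>+x. \<integral>\<^sup>+v. ennreal \<bar>heat r v * (g (x - v) * u x)\<bar> \<partial>lborel \<partial>lborel)
         = (\<integral>\<^sup>+x. \<integral>\<^sup>+y. ennreal \<bar>heat r (x - y) * u x * g y\<bar> \<partial>lborel \<partial>lborel)"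
      proof (rule nn_integral_cong)
        fix x
        show "(\<integral>\<^sup>+v. ennreal \<bar>heat r v * (g (x - v) * u x)\<bar> \<partial>lborel) = (\<integral>\<^sup>+y. ennreal \<bar>heat r (x - y) * u x * g y\<bar> \<partial>lborel)"
          using nn_integral_lborel_reflect[of "\<lambda>v. ennreal \<bar>heat r v * (g (x - v) * u x)\<bar>" x]
          by (simp add: mult_ac)
      qed
      also have "\<dots> \<le> ennreal B * (\<integral>\<^sup>+x. heat r (x::'a) \<partial>lborel) * (\<integral>\<^sup>+y. \<bar>g y\<bar> \<partial>lborel)"
        by (rule nn_integral_form_bounded[of "heat r" u g B]) (use B in auto)
      also have "\<dots> < \<infinity>" using g integrable_heat[OF r, where 'a='a] by (simp add: integrable_iff_bounded ennreal_mult_less_top)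
      finally show "(\<integral>\<^sup>+x. \<integral>\<^sup>+v. ennreal \<bar>case (x, v) of (x, v) \<Rightarrow> heat r v * (g (x - v) * u x)\<bar> \<partial>lborel \<partial>lborel) < \<infinity>" by simp
    qed measurable
    also have "\<dots> = (LBINT v. heat r v * C v)" by (simp add: C_def)
    also have "\<dots> = (LBINT v. heat 1 v * C (sqrt r *\<^sub>R v))" by (rule integral_heat_scale[OF _ r]) simp
    finally show ?thesis .
  qed
  have "(\<lambda>n. \<integral>v. heat 1 v * C (sqrt (\<delta> n) *\<^sub>R v) \<partial>lborel) \<longlonglongrightarrow> (LBINT v. heat 1 (v::'a) * C 0)"
  proof (rule integral_dominated_convergence[where w="\<lambda>v. heat 1 v * (B * (LBINT x. \<bar>g x\<bar>))"])
    show "integrable lborel (\<lambda>v::'a. heat 1 v * (B * (LBINT x. \<bar>g x\<bar>)))"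
      using integrable_heat[of 1, where 'a='a] by simp
    show "AE v in lborel. (\<lambda>n. heat 1 v * C (sqrt (\<delta> n) *\<^sub>R v)) \<longlonglongrightarrow> heat 1 (v::'a) * C 0"
    proof (intro AE_I2 tendsto_mult tendsto_const)
      fix v :: 'a
      have "(\<lambda>n. sqrt (\<delta> n) *\<^sub>R v) \<longlonglongrightarrow> sqrt 0 *\<^sub>R v" by (intro tendsto_intros \<delta>(2))
      then have "(\<lambda>n. sqrt (\<delta> n) *\<^sub>R v) \<longlonglongrightarrow> 0" by simp
      then show "(\<lambda>n. C (sqrt (\<delta> n) *\<^sub>R v)) \<longlonglongrightarrow> C 0"
        using continuous_on_tendsto_compose[OF cont] by auto
    qed
    show "AE v in lborel. norm (heat 1 v * C (sqrt (\<delta> n) *\<^sub>R v)) \<le> heat 1 v * (B * (LBINT x. \<bar>g x\<bar>))" for n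
      using Cb by (intro AE_I2) (auto simp: abs_mult intro!: mult_left_mono)
  qed measurable
  then show ?thesis using eq[OF \<delta>(1)] by (simp add: heat_mass_def C_def mult.commute)
qed

text \<open>Truncation reduces to bounded \<open>u\<close>: the remainder \<open>u - U N\<close> is
  small in L2, and \<open>form_L2\<close> bounds its contribution uniformly in
  \<open>\<delta> n\<close> because the mass of the kernel does not depend on the scale.\<close>

lemma form_heat_tendsto_L2:
  fixes u g :: "'a::euclidean_space \<Rightarrow> real"
  assumes u: "u \<in> borel_measurable borel" "integrable lborel (\<lambda>x. (u x)\<^sup>2)"
    and g: "integrable lborel g" "integrable lborel (\<lambda>x. (g x)\<^sup>2)"
    and \<delta>: "\<And>n. \<delta> n > 0" "\<delta> \<longlonglongrightarrow> 0"
  shows "(\<lambda>n. form (heat (\<delta> n)) u g) \<longlonglongrightarrow> heat_mass TYPE('a) * (LBINT x. u x * g x)"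
proof -
  have [measurable]: "u \<in> borel_measurable borel" "g \<in> borel_measurable borel" using u g by auto
  let ?m = "heat_mass TYPE('a)"
  define U where "U N x = (if \<bar>u x\<bar> \<le> real N then u x else 0)" for N x
  have [measurable]: "U N \<in> borel_measurable borel" for N unfolding U_def by measurable
  have Ub: "\<bar>U N x\<bar> \<le> real N" for N x by (simp add: U_def)
  have UL2: "integrable lborel (\<lambda>x. (U N x)\<^sup>2)" "integrable lborel (\<lambda>x. (u x - U N x)\<^sup>2)" for N
    by (auto intro!: Bochner_Integration.integrable_bound[OF u(2)] AE_I2 simp: U_def)
  have prod_int: "integrable lborel (\<lambda>x. v x * g x)" and prod_bd: "\<eta> > 0 \<Longrightarrow> \<bar>\<integral>x. v x * g x \<partial>lborel\<bar> \<le> (LBINT x. (v x)\<^sup>2) / \<eta> + \<eta> * (LBINT x. (g x)\<^sup>2)"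
    if v[measurable]: "v \<in> borel_measurable borel" "integrable lborel (\<lambda>x. (v x)\<^sup>2)" for v \<eta>
  proof -
    have am: "\<bar>v x * g x\<bar> \<le> (v x)\<^sup>2 / \<eta> + \<eta> * (g x)\<^sup>2" if \<eta>: "\<eta> > 0" for x \<eta>
    proof -
      have "0 \<le> (\<bar>v x\<bar> - \<eta> * \<bar>g x\<bar>)\<^sup>2 / \<eta>" using \<eta> by simp
      also have "\<dots> = (v x)\<^sup>2 / \<eta> + \<eta> * (g x)\<^sup>2 - 2 * (\<bar>v x\<bar> * \<bar>g x\<bar>)"
        using \<eta> by (simp add: power2_diff power_mult_distrib field_simps) (simp add: power2_eq_square)
      finally have "2 * (\<bar>v x\<bar> * \<bar>g x\<bar>) \<le> (v x)\<^sup>2 / \<eta> + \<eta> * (g x)\<^sup>2" by simp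
      moreover have "0 \<le> \<bar>v x\<bar> * \<bar>g x\<bar>" by simp
      ultimately show ?thesis unfolding abs_mult by linarith
    qed
    have i: "integrable lborel (\<lambda>x. (v x)\<^sup>2 / \<eta> + \<eta> * (g x)\<^sup>2)" for \<eta>
      using v g by auto
    show int: "integrable lborel (\<lambda>x. v x * g x)"
      using am[of 1] by (intro Bochner_Integration.integrable_bound[OF i[of 1]] AE_I2) (auto intro: order_trans[OF _ abs_ge_self])
    assume \<eta>: "\<eta> > 0"
    have "\<bar>\<integral>x. v x * g x \<partial>lborel\<bar> \<le> (LBINT x. \<bar>v x * g x\<bar>)" by (rule integral_abs_bound)
    also have "\<dots> \<le> (LBINT x. (v x)\<^sup>2 / \<eta> + \<eta> * (g x)\<^sup>2)"
      using int i am[OF \<eta>] by (intro integral_mono) auto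
    also have "\<dots> = (LBINT x. (v x)\<^sup>2) / \<eta> + \<eta> * (LBINT x. (g x)\<^sup>2)"
      using v g by simp
    finally show "\<bar>\<integral>x. v x * g x \<partial>lborel\<bar> \<le> (LBINT x. (v x)\<^sup>2) / \<eta> + \<eta> * (LBINT x. (g x)\<^sup>2)" .
  qed
  have m: "?m > 0" by (rule heat_mass_pos)
  have g2: "(LBINT x. (g x)\<^sup>2) \<ge> 0" by simp
  have Ulim: "(\<lambda>N. \<integral>x. (u x - U N x)\<^sup>2 \<partial>lborel) \<longlonglongrightarrow> (\<integral>x. 0 \<partial>(lborel :: 'a measure))"
  proof (rule integral_dominated_convergence[where w="\<lambda>x. (u x)\<^sup>2"])
    show "AE x in lborel. (\<lambda>N. (u x - U N x)\<^sup>2) \<longlonglongrightarrow> 0"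
    proof (intro AE_I2 tendsto_eventually)
      fix x
      obtain N0 where "\<bar>u x\<bar> \<le> real N0" using real_arch_simple by blast
      then show "\<forall>\<^sub>F N in sequentially. (u x - U N x)\<^sup>2 = 0"
        by (intro eventually_sequentiallyI[of N0]) (auto simp: U_def)
    qed
  qed (use u in \<open>auto simp: U_def\<close>)
  show ?thesis
  proof (rule LIMSEQ_I)
    fix e :: real assume e: "e > 0"
    \<comment> \<open>This weight is fixed before the truncation level \<open>N\<close>, since the
      L2 norm of the remainder is divided by it. The summand \<open>1\<close> keeps the denominator
      positive when \<open>g\<close> vanishes.\<close>
    define \<eta> where "\<eta> = e / (8 * ?m * ((LBINT x. (g x)\<^sup>2) + 1))"
    have \<eta>: "\<eta> > 0" using e m g2 by (auto simp: \<eta>_def intro!: divide_pos_pos mult_pos_pos add_nonneg_pos)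
    have \<eta>1: "?m * (\<eta> * (LBINT x. (g x)\<^sup>2)) \<le> e / 8"
    proof -
      have "8 * ?m * ((LBINT x. (g x)\<^sup>2) + 1) > 0" using m g2 by (auto intro!: mult_pos_pos add_nonneg_pos)
      then have "\<eta> * (8 * ?m * ((LBINT x. (g x)\<^sup>2) + 1)) = e" unfolding \<eta>_def by (metis less_irrefl nonzero_eq_divide_eq)
      moreover have "\<eta> * ?m > 0" using \<eta> m by simp
      ultimately show ?thesis by (simp add: algebra_simps)
    qed
    have "e * \<eta> / (8 * ?m) > 0" using e \<eta> m by simp
    from LIMSEQ_D[OF Ulim this] obtain N where "norm ((LBINT x. (u x - U N x)\<^sup>2) - (\<integral>x. 0 \<partial>(lborel :: 'a measure))) < e * \<eta> / (8 * ?m)" by blast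
    then have N: "(LBINT x. (u x - U N x)\<^sup>2) < e * \<eta> / (8 * ?m)" by simp
    have small: "?m * ((LBINT x. (u x - U N x)\<^sup>2) / \<eta> + \<eta> * (LBINT x. (g x)\<^sup>2)) \<le> e / 4"
    proof -
      have "?m * ((LBINT x. (u x - U N x)\<^sup>2) / \<eta>) \<le> e / 8"
        using N \<eta> m by (simp add: field_simps)
      then show ?thesis using \<eta>1 unfolding distrib_left by linarith
    qed
    from LIMSEQ_D[OF form_heat_tendsto_bounded[of "U N" "real N" g \<delta>], of "e / 4"] e Ub g(1) \<delta>
    obtain n0 where n0: "\<And>n. n \<ge> n0 \<Longrightarrow> norm (form (heat (\<delta> n)) (U N) g - ?m * (LBINT x. U N x * g x)) < e / 4"
      by auto
    have "norm (form (heat (\<delta> n)) u g - ?m * (LBINT x. u x * g x)) < e" if n: "n \<ge> n0" for n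
    proof -
      have kk: "integrable lborel (heat (\<delta> n) :: 'a \<Rightarrow> real)" "\<And>x::'a. heat (\<delta> n) x \<ge> 0" using integrable_heat[OF \<delta>(1)] by auto
      have i1: "form_integrable (heat (\<delta> n)) (U N) g" by (rule form_L2(1)[OF kk _ UL2(1) _ g(2)]) auto
      have i2: "form_integrable (heat (\<delta> n)) (\<lambda>x. u x - U N x) g" by (rule form_L2(1)[OF kk _ UL2(2) _ g(2)]) auto
      have "form (heat (\<delta> n)) u g = form (heat (\<delta> n)) (U N) g + form (heat (\<delta> n)) (\<lambda>x. u x - U N x) g"
        unfolding form_def Bochner_Integration.integral_add[OF i1 i2, symmetric]
        by (rule Bochner_Integration.integral_cong) (auto simp: algebra_simps)
      moreover have "(LBINT x. u x * g x) = (LBINT x. U N x * g x) + (LBINT x. (u x - U N x) * g x)"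
        using prod_int[OF _ UL2(1)[of N]] prod_int[OF _ UL2(2)[of N]]
        by (subst Bochner_Integration.integral_add[symmetric]) (auto simp: algebra_simps)
      moreover have "\<bar>form (heat (\<delta> n)) (\<lambda>x. u x - U N x) g\<bar> \<le> e / 4"
      proof -
        have "\<bar>form (heat (\<delta> n)) (\<lambda>x. u x - U N x) g\<bar> \<le> ?m * ((LBINT x. (u x - U N x)\<^sup>2) / \<eta> + \<eta> * (LBINT x. (g x)\<^sup>2))"
          using form_L2(2)[OF kk _ UL2(2) _ g(2) \<eta>, of N] integral_heat[OF \<delta>(1)[of n], where 'a='a] by simp
        then show ?thesis using small by linarith
      qed
      moreover have "?m * \<bar>\<integral>x. (u x - U N x) * g x \<partial>lborel\<bar> \<le> e / 4"
        by (rule order_trans[OF mult_left_mono[OF prod_bd[OF _ UL2(2)[of N] \<eta>]] small]) (use m in auto)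
      then have "\<bar>?m * (LBINT x. (u x - U N x) * g x)\<bar> \<le> e / 4" using m by (simp add: abs_mult)
      ultimately show ?thesis using n0[OF n] e by (simp only: distrib_left real_norm_def)
    qed
    then show "\<exists>n0. \<forall>n\<ge>n0. norm (form (heat (\<delta> n)) u g - ?m * (LBINT x. u x * g x)) < e" by blast
  qed
qed

section \<open>The energy identity\<close>

lemma nn_integral_lborel_pair:
  fixes F :: "'a::euclidean_space \<times> 'b::euclidean_space \<Rightarrow> ennreal"
  assumes "F \<in> borel_measurable borel"
  shows "(\<integral>\<^sup>+p. F p \<partial>lborel) = (\<integral>\<^sup>+x. \<integral>\<^sup>+y. F (x, y) \<partial>lborel \<partial>lborel)"
  using lborel.nn_integral_fst[of F "lborel :: 'a measure"] assms by (simp add: lborel_prod)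

lemma integral_lborel_pair:
  fixes F :: "'a::euclidean_space \<times> 'b::euclidean_space \<Rightarrow> real"
  assumes "integrable lborel F"
  shows "(LBINT p. F p) = (LBINT x. LBINT y. F (x, y))"
    and "integrable lborel (\<lambda>x. \<integral>y. F (x, y) \<partial>lborel)"
    and "AE x in lborel. integrable lborel (\<lambda>y. F (x, y))"
  using assms lborel_pair.integral_fst'[of F] lborel_pair.integrable_fst'[of F] lborel_pair.AE_integrable_fst'[of F]
  by (simp_all add: lborel_prod)

text \<open>Common to \<open>heat\<close>, \<open>heat_dr\<close> and \<open>heat_drr\<close> at a
  fixed positive parameter. A Gaussian majorant is at once bounded and integrable, which is what the
  two parts in the splitting of \<open>w\<close> ask for.\<close>

definition gauss_bounded :: "('a::euclidean_space \<Rightarrow> real) \<Rightarrow> bool" where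
  "gauss_bounded K \<longleftrightarrow> K \<in> borel_measurable borel \<and> (\<exists>C c. C \<ge> 0 \<and> c > 0 \<and> (\<forall>x. \<bar>K x\<bar> \<le> C * gauss c x))"

lemma gauss_bounded_heat: "r > 0 \<Longrightarrow> gauss_bounded (heat r :: 'a::euclidean_space \<Rightarrow> real)"
  unfolding gauss_bounded_def heat_def
  by (intro conjI exI[of _ "r powr (- real DIM('a) / 2)"] exI[of _ "1 / (4 * r)"]) (auto simp: abs_mult)

lemma gauss_bounded_heat_dr: 
  assumes "r > 0"
  shows "gauss_bounded (heat_dr r :: 'a::euclidean_space \<Rightarrow> real)"
proof -
  obtain C c where "C \<ge> 0" "c > 0" "\<And>s x::'a. r \<le> s \<Longrightarrow> s \<le> r \<Longrightarrow> \<bar>heat_dr s x\<bar> \<le> C * gauss c x"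
    using heat_dr_le_gauss[OF assms, of r] by metis
  then show ?thesis unfolding gauss_bounded_def by auto
qed

lemma gauss_bounded_heat_drr:
  assumes "r > 0"
  shows "gauss_bounded (heat_drr r :: 'a::euclidean_space \<Rightarrow> real)"
  using heat_drr_le_gauss[OF assms] unfolding gauss_bounded_def by (metis borel_measurable_heat_drr)

text \<open>
  Here \<open>f\<close> is the density of the difference of the solutions, \<open>w = a f\<close>, and \<open>D\<close> is a set of full
  measure of good times. The dominating function \<open>w1\<close> is \<open>w\<^sup>2\<close> under (B1) and \<open>\<bar>w\<bar>\<close> under (B2); it lets
  both cases share all estimates except the limit of vanishing kernel parameter.
\<close>

locale heat_energy =
  fixes T M :: real and D :: "real set" and f w w1 :: "real \<times> 'a::euclidean_space \<Rightarrow> real"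
  assumes T_pos: "T > 0" and M_nonneg: "M \<ge> 0"
    and D_sub: "D \<subseteq> {0<..T}"
    and f_meas[measurable]: "f \<in> borel_measurable borel"
    and w_meas[measurable]: "w \<in> borel_measurable borel"
    and w_out: "\<And>s y. s \<notin> D \<Longrightarrow> w (s, y) = 0"
    and f_int: "\<And>s. integrable lborel (\<lambda>y. f (s, y))"
    and f_norm: "\<And>s. (LBINT y. \<bar>f (s, y)\<bar>) \<le> M"
    and w1_int: "integrable lborel w1" and w1_nonneg: "\<And>p. w1 p \<ge> 0"
    and w_le: "\<And>\<eta> s y. \<eta> \<ge> 1 \<Longrightarrow> \<bar>w (s, y)\<bar> \<le> indicator {0..T} s / \<eta> + \<eta> * w1 (s, y)"
    and fw: "\<And>p. w p * f p \<ge> 0"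
    and eq0: "\<And>t r x0. t \<in> D \<Longrightarrow> r > 0 \<Longrightarrow>
       (LBINT y. heat r (y - x0) * f (t, y)) = (LBINT p. indicator {..t} (fst p) * (heat_dr r (snd p - x0) * w p))"
    and eq1: "\<And>t r x0. t \<in> D \<Longrightarrow> r > 0 \<Longrightarrow>
       (LBINT y. heat_dr r (y - x0) * f (t, y)) = (LBINT p. indicator {..t} (fst p) * (heat_drr r (snd p - x0) * w p))"
    and ww: "\<And>c. c > 0 \<Longrightarrow> (\<integral>\<^sup>+p. \<integral>\<^sup>+q. ennreal (gauss c (snd q - snd p) * \<bar>w p\<bar> * \<bar>w q\<bar>) \<partial>lborel \<partial>lborel) < \<infinity>"
begin

lemma w1_meas[measurable]: "w1 \<in> borel_measurable borel" using w1_int by auto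

text \<open>By \<open>w_le\<close>, \<open>w\<close> splits into a part of size
  \<open>1 / \<eta>\<close> on \<open>[0,T]\<close>, against which the kernel is integrated in
  space, and a part \<open>\<eta> * w1\<close>, against which the kernel is replaced by its bound
  \<open>B\<close>. The free \<open>\<eta>\<close> is what later makes both contributions
  decay.\<close>

lemma nn_integral_wg:
  fixes k :: "'a \<Rightarrow> real" and g :: "real \<times> 'a \<Rightarrow> real"
  assumes [measurable]: "k \<in> borel_measurable borel" "g \<in> borel_measurable borel"
    and g: "\<And>s. (\<integral>\<^sup>+y. ennreal \<bar>g (s, y)\<bar> \<partial>lborel) \<le> ennreal M"
    and k: "\<And>x. 0 \<le> k x" "\<And>x. k x \<le> B" and \<eta>: "\<eta> \<ge> 1"
  shows "(\<integral>\<^sup>+p. \<integral>\<^sup>+y. ennreal \<bar>k (snd p - y) * w p * g (fst p, y)\<bar> \<partial>lborel \<partial>lborel)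
    \<le> ennreal (T * M / \<eta>) * (\<integral>\<^sup>+x. k x \<partial>lborel) + ennreal (\<eta> * B * M) * (\<integral>\<^sup>+p. w1 p \<partial>lborel)"
proof -
  have B: "B \<ge> 0" using k[of 0] by linarith
  let ?a = "\<lambda>p y. ennreal (indicator {0..T} (fst p) / \<eta>) * (ennreal \<bar>g (fst p, y)\<bar> * ennreal (k (snd p - y)))"
  let ?b = "\<lambda>p y. ennreal (\<eta> * B) * (ennreal (w1 p) * ennreal \<bar>g (fst p, y)\<bar>)"
  have "(\<integral>\<^sup>+p. \<integral>\<^sup>+y. ennreal \<bar>k (snd p - y) * w p * g (fst p, y)\<bar> \<partial>lborel \<partial>lborel)
     \<le> (\<integral>\<^sup>+p. \<integral>\<^sup>+y. ?a p y + ?b p y \<partial>lborel \<partial>lborel)"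
  proof (intro nn_integral_mono)
    fix p :: "real \<times> 'a" and y :: 'a
    let ?G = "\<bar>g (fst p, y)\<bar>" and ?k = "k (snd p - y)"
    have "\<bar>w p\<bar> \<le> indicator {0..T} (fst p) / \<eta> + \<eta> * w1 p" using w_le[OF \<eta>, of "fst p" "snd p"] by simp
    then have "\<bar>w p\<bar> * (?G * ?k) \<le> (indicator {0..T} (fst p) / \<eta> + \<eta> * w1 p) * (?G * ?k)"
      using k by (intro mult_right_mono) auto
    also have "\<dots> = indicator {0..T} (fst p) / \<eta> * (?G * ?k) + \<eta> * w1 p * (?G * ?k)" by (simp only: distrib_right)
    also have "\<dots> \<le> indicator {0..T} (fst p) / \<eta> * (?G * ?k) + \<eta> * w1 p * (?G * B)"
      using k \<eta> w1_nonneg by (intro add_left_mono mult_left_mono) auto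
    finally have "\<bar>?k * w p * g (fst p, y)\<bar> \<le> indicator {0..T} (fst p) / \<eta> * (?G * ?k) + \<eta> * B * (w1 p * ?G)"
      using k(1)[of "snd p - y"] by (simp add: abs_mult mult_ac)
    then show "ennreal \<bar>?k * w p * g (fst p, y)\<bar> \<le> ?a p y + ?b p y"
      using \<eta> k B w1_nonneg by (simp add: ennreal_mult'[symmetric] ennreal_plus[symmetric] ennreal_leI del: ennreal_plus)
  qed
  also have "\<dots> = (\<integral>\<^sup>+p. \<integral>\<^sup>+y. ?a p y \<partial>lborel \<partial>lborel) + (\<integral>\<^sup>+p. \<integral>\<^sup>+y. ?b p y \<partial>lborel \<partial>lborel)"
    by (simp add: nn_integral_add)
  also have "(\<integral>\<^sup>+p. \<integral>\<^sup>+y. ?b p y \<partial>lborel \<partial>lborel) \<le> ennreal (\<eta> * B * M) * (\<integral>\<^sup>+p. w1 p \<partial>lborel)"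
  proof -
    have "(\<integral>\<^sup>+p. \<integral>\<^sup>+y. ?b p y \<partial>lborel \<partial>lborel) = (\<integral>\<^sup>+p. ennreal (\<eta> * B) * (ennreal (w1 p) * (\<integral>\<^sup>+y. ennreal \<bar>g (fst p, y)\<bar> \<partial>lborel)) \<partial>lborel)"
      by (simp add: nn_integral_cmult)
    also have "\<dots> \<le> (\<integral>\<^sup>+p. ennreal (\<eta> * B) * (ennreal (w1 p) * ennreal M) \<partial>lborel)"
      by (intro nn_integral_mono mult_left_mono g) auto
    also have "\<dots> = ennreal (\<eta> * B * M) * (\<integral>\<^sup>+p. w1 p \<partial>lborel)"
      using \<eta> B M_nonneg by (simp add: nn_integral_cmult nn_integral_multc ennreal_mult mult_ac)
    finally show ?thesis .
  qed
  also have "(\<integral>\<^sup>+p. \<integral>\<^sup>+y. ?a p y \<partial>lborel \<partial>lborel) \<le> ennreal (T * M / \<eta>) * (\<integral>\<^sup>+x. k x \<partial>lborel)"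
  proof -
    have "(\<integral>\<^sup>+p. \<integral>\<^sup>+y. ?a p y \<partial>lborel \<partial>lborel) = (\<integral>\<^sup>+s. \<integral>\<^sup>+x. \<integral>\<^sup>+y. ?a (s, x) y \<partial>lborel \<partial>lborel \<partial>lborel)"
      by (rule nn_integral_lborel_pair) measurable
    also have "\<dots> = (\<integral>\<^sup>+s. ennreal (indicator {0..T} s / \<eta>) * (\<integral>\<^sup>+x. \<integral>\<^sup>+y. ennreal \<bar>g (s, y)\<bar> * ennreal (k (x - y)) \<partial>lborel \<partial>lborel) \<partial>lborel)"
      by (simp add: nn_integral_cmult)
    also have "\<dots> \<le> (\<integral>\<^sup>+s. ennreal (indicator {0..T} s / \<eta>) * (ennreal M * (\<integral>\<^sup>+x. k x \<partial>lborel)) \<partial>lborel)"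
    proof (intro nn_integral_mono mult_left_mono)
      fix s :: real
      have "(\<integral>\<^sup>+x. \<integral>\<^sup>+y. ennreal \<bar>g (s, y)\<bar> * ennreal (k (x - y)) \<partial>lborel \<partial>lborel)
         = (\<integral>\<^sup>+y. \<integral>\<^sup>+x. ennreal \<bar>g (s, y)\<bar> * ennreal (k (x - y)) \<partial>lborel \<partial>lborel)"
        by (rule lborel_pair.Fubini'[symmetric]) (simp add: lborel_prod case_prod_beta)
      also have "\<dots> = (\<integral>\<^sup>+y. ennreal \<bar>g (s, y)\<bar> \<partial>lborel) * (\<integral>\<^sup>+x. k x \<partial>lborel)"
        by (simp add: nn_integral_cmult nn_integral_multc nn_integral_lborel_shift[of "\<lambda>x. ennreal (k x)"])
      also have "\<dots> \<le> ennreal M * (\<integral>\<^sup>+x. k x \<partial>lborel)" by (intro mult_right_mono g) auto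
      finally show "(\<integral>\<^sup>+x. \<integral>\<^sup>+y. ennreal \<bar>g (s, y)\<bar> * ennreal (k (x - y)) \<partial>lborel \<partial>lborel) \<le> ennreal M * (\<integral>\<^sup>+x. k x \<partial>lborel)" .
    qed auto
    also have "\<dots> = (\<integral>\<^sup>+s. ennreal (1 / \<eta>) * indicator {0..T} s \<partial>lborel) * (ennreal M * (\<integral>\<^sup>+x. k x \<partial>lborel))"
      by (subst nn_integral_multc[symmetric]) (auto intro!: nn_integral_cong simp: indicator_def)
    also have "(\<integral>\<^sup>+s. ennreal (1 / \<eta>) * indicator {0..T} s \<partial>lborel) = ennreal (T / \<eta>)"
      using T_pos \<eta> by (simp add: nn_integral_cmult_indicator ennreal_mult'[symmetric])
    finally show ?thesis using T_pos \<eta> M_nonneg by (simp add: ennreal_mult'[symmetric] mult.assoc[symmetric])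
  qed
  finally show ?thesis by (simp add: add_mono)
qed

text \<open>Stated for a general \<open>g\<close> because it is needed for \<open>f\<close> itself,
  through \<open>W\<close>, and for the slice \<open>f (t, snd p)\<close> frozen at the final
  time.\<close>

lemma integrable_wg:
  fixes K :: "'a \<Rightarrow> real" and g :: "real \<times> 'a \<Rightarrow> real"
  assumes K: "gauss_bounded K" and [measurable]: "g \<in> borel_measurable borel"
    and g: "\<And>s. integrable lborel (\<lambda>y. g (s, y))" "\<And>s. (LBINT y. \<bar>g (s, y)\<bar>) \<le> M"
  shows "integrable (lborel \<Otimes>\<^sub>M lborel) (\<lambda>q. indicator {..t} (fst (fst q)) * (K (snd (fst q) - snd q) * w (fst q) * g (fst (fst q), snd q)))"
proof (rule integrable_lborel_pairI)
  have [measurable]: "K \<in> borel_measurable borel" using K by (simp add: gauss_bounded_def)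
  obtain C c where C: "C \<ge> 0" "c > 0" "\<And>x. \<bar>K x\<bar> \<le> C * gauss c x" using K by (auto simp: gauss_bounded_def)
  show "(\<lambda>q. indicator {..t} (fst (fst q)) * (K (snd (fst q) - snd q) * w (fst q) * g (fst (fst q), snd q))) \<in> borel_measurable borel"
    by measurable
  have gs: "(\<integral>\<^sup>+y. ennreal \<bar>g (s, y)\<bar> \<partial>lborel) \<le> ennreal M" for s
    using g(1)[of s] g(2)[of s] by (subst nn_integral_eq_integral) (auto intro: ennreal_leI)
  have "(\<integral>\<^sup>+p. \<integral>\<^sup>+y. ennreal \<bar>indicator {..t} (fst p) * (K (snd p - y) * w p * g (fst p, y))\<bar> \<partial>lborel \<partial>lborel)
     \<le> (\<integral>\<^sup>+p. \<integral>\<^sup>+y. ennreal \<bar>(C * gauss c (snd p - y)) * w p * g (fst p, y)\<bar> \<partial>lborel \<partial>lborel)"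
  proof (intro nn_integral_mono ennreal_leI)
    fix p :: "real \<times> 'a" and y
    have "\<bar>indicator {..t} (fst p) * (K (snd p - y) * w p * g (fst p, y))\<bar> \<le> \<bar>K (snd p - y)\<bar> * (\<bar>w p\<bar> * \<bar>g (fst p, y)\<bar>)"
      by (auto simp: indicator_def abs_mult)
    also have "\<dots> \<le> (C * gauss c (snd p - y)) * (\<bar>w p\<bar> * \<bar>g (fst p, y)\<bar>)" by (intro mult_right_mono C) auto
    also have "\<dots> = \<bar>(C * gauss c (snd p - y)) * w p * g (fst p, y)\<bar>" using C by (simp add: abs_mult mult.assoc)
    finally show "\<bar>indicator {..t} (fst p) * (K (snd p - y) * w p * g (fst p, y))\<bar> \<le> \<bar>(C * gauss c (snd p - y)) * w p * g (fst p, y)\<bar>" .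
  qed
  also have "\<dots> \<le> ennreal (T * M / 1) * (\<integral>\<^sup>+x. C * gauss c (x::'a) \<partial>lborel) + ennreal (1 * C * M) * (\<integral>\<^sup>+p. w1 p \<partial>lborel)"
    using C gauss_le_1[of c] by (intro nn_integral_wg gs) (auto intro: mult_left_le)
  also have "\<dots> < \<infinity>"
    using integrable_gauss[OF C(2), where 'a='a] w1_int C w1_nonneg
    by (simp add: integrable_iff_bounded ennreal_mult_less_top ennreal_mult' nn_integral_cmult)
  finally show "(\<integral>\<^sup>+p. \<integral>\<^sup>+y. ennreal \<bar>indicator {..t} (fst (fst (p, y))) * (K (snd (fst (p, y)) - snd (p, y)) * w (fst (p, y)) * g (fst (fst (p, y)), snd (p, y)))\<bar> \<partial>lborel \<partial>lborel) < \<infinity>"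
    by simp
qed

definition W :: "('a \<Rightarrow> real) \<Rightarrow> (real \<times> 'a) \<times> 'a \<Rightarrow> real" where
  "W K q = K (snd (fst q) - snd q) * w (fst q) * f (fst (fst q), snd q)"

text \<open>\<open>E t (heat r)\<close> is the quantity \<open>H\<close> of the overview at
  \<open>(t, r)\<close>. The lower time limit \<open>0\<close> is implicit because \<open>w\<close>
  vanishes off \<open>D\<close>, a set of positive times.\<close>

definition E :: "real \<Rightarrow> ('a \<Rightarrow> real) \<Rightarrow> real" where
  "E t K = (\<integral>q. indicator {..t} (fst (fst q)) * W K q \<partial>(lborel \<Otimes>\<^sub>M lborel))"

lemma W_int: "gauss_bounded K \<Longrightarrow> integrable (lborel \<Otimes>\<^sub>M lborel) (\<lambda>q. indicator {..t} (fst (fst q)) * W K q)"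
  unfolding W_def by (rule integrable_wg) (auto intro: f_int f_norm)

lemma E_iterated:
  assumes "gauss_bounded K"
  shows "E t K = (LBINT p. indicator {..t} (fst p) * w p * (LBINT y. K (snd p - y) * f (fst p, y)))"
proof -
  have "E t K = (LBINT p. LBINT y. indicator {..t} (fst p) * W K (p, y))"
    unfolding E_def using lborel_pair.integral_fst'[OF W_int[OF assms, of t]] by simp
  also have "\<dots> = (LBINT p. LBINT y. (indicator {..t} (fst p) * w p) * (K (snd p - y) * f (fst p, y)))"
    by (simp add: W_def mult_ac)
  finally show ?thesis by simp
qed

text \<open>The bounded factor \<open>\<phi>\<close> stands for the cut-offs that encode a time
  ordering, so that \<open>ww\<close> yields integrability over every region that the energy
  identity needs.\<close>

lemma V_int:
  assumes r: "r > 0" and [measurable]: "\<phi> \<in> borel_measurable borel" and \<phi>: "\<And>x. \<bar>\<phi> x\<bar> \<le> 1"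
  shows "integrable (lborel \<Otimes>\<^sub>M lborel) (\<lambda>(p, q). \<phi> (p, q) * (heat_drr r (snd q - snd p) * w p * w q))"
proof (rule integrable_lborel_pairI)
  obtain C c where C: "C \<ge> 0" "c > 0" "\<And>x::'a. \<bar>heat_drr r x\<bar> \<le> C * gauss c x" using heat_drr_le_gauss[OF r] by metis
  show "(\<lambda>(p, q). \<phi> (p, q) * (heat_drr r (snd q - snd p) * w p * w q)) \<in> borel_measurable borel"
    unfolding case_prod_unfold by measurable
  have "(\<integral>\<^sup>+p. \<integral>\<^sup>+q. ennreal \<bar>\<phi> (p, q) * (heat_drr r (snd q - snd p) * w p * w q)\<bar> \<partial>lborel \<partial>lborel)
     \<le> (\<integral>\<^sup>+p. \<integral>\<^sup>+q. ennreal C * ennreal (gauss c (snd q - snd p) * \<bar>w p\<bar> * \<bar>w q\<bar>) \<partial>lborel \<partial>lborel)"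
  proof (intro nn_integral_mono)
    fix p q :: "real \<times> 'a"
    have "\<bar>\<phi> (p, q) * (heat_drr r (snd q - snd p) * w p * w q)\<bar> \<le> 1 * (\<bar>heat_drr r (snd q - snd p)\<bar> * (\<bar>w p\<bar> * \<bar>w q\<bar>))"
      unfolding abs_mult mult.assoc by (intro mult_right_mono \<phi>) auto
    also have "\<dots> \<le> (C * gauss c (snd q - snd p)) * (\<bar>w p\<bar> * \<bar>w q\<bar>)"
      unfolding mult_1 by (intro mult_right_mono C) auto
    finally show "ennreal \<bar>\<phi> (p, q) * (heat_drr r (snd q - snd p) * w p * w q)\<bar> \<le> ennreal C * ennreal (gauss c (snd q - snd p) * \<bar>w p\<bar> * \<bar>w q\<bar>)"
      using C(1) by (simp add: ennreal_mult'[symmetric] ennreal_leI mult.assoc)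
  qed
  also have "\<dots> = ennreal C * (\<integral>\<^sup>+p. \<integral>\<^sup>+q. ennreal (gauss c (snd q - snd p) * \<bar>w p\<bar> * \<bar>w q\<bar>) \<partial>lborel \<partial>lborel)"
    by (simp add: nn_integral_cmult)
  also have "\<dots> < \<infinity>" using ww[OF C(2)] by (simp add: ennreal_mult_less_top)
  finally show "(\<integral>\<^sup>+p. \<integral>\<^sup>+q. ennreal \<bar>case (p, q) of (p, q) \<Rightarrow> \<phi> (p, q) * (heat_drr r (snd q - snd p) * w p * w q)\<bar> \<partial>lborel \<partial>lborel) < \<infinity>" by simp
qed

text \<open>
  Applying the weak formulation to both factors turns the form into an integral over \<open>(s, s') \<in> [0,t]\<^sup>2\<close>
  that is symmetric; on the half \<open>s' \<le> s\<close> the inner integral is again given by the weak formulation.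
\<close>

lemma energy_identity:
  assumes t: "t \<in> D" and r: "r > 0"
  shows "form (heat r) (\<lambda>y. f (t, y)) (\<lambda>y. f (t, y)) = 2 * E t (heat_dr r)"
proof -
  let ?I = "\<lambda>t p. indicator {..t} (fst p) :: real"
  \<comment> \<open>With \<open>p = (s, x)\<close> and \<open>q = (s', x')\<close>, the three
    regions are \<open>s' \<le> s \<le> t\<close>, then \<open>s < s' \<le> t\<close>, then the
    square \<open>s, s' \<le> t\<close>. The strict inequality makes the first two a disjoint
    decomposition of the third.\<close>
  have 1: "integrable (lborel \<Otimes>\<^sub>M lborel) (\<lambda>(p, q). (?I t p * ?I (fst p) q) * (heat_drr r (snd q - snd p) * w p * w q))"
  proof -
    have m: "(\<lambda>z::(real \<times> 'a) \<times> (real \<times> 'a). ?I t (fst z) * (if fst (snd z) \<le> fst (fst z) then 1 else 0)) \<in> borel_measurable borel"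
      by measurable
    have "integrable (lborel \<Otimes>\<^sub>M lborel) (\<lambda>(p, q). (?I t (fst (p, q)) * (if fst (snd (p, q)) \<le> fst (fst (p, q)) then 1 else 0)) * (heat_drr r (snd q - snd p) * w p * w q))"
      by (rule V_int[OF r m]) (auto simp: indicator_def)
    then show ?thesis by (simp add: indicator_def of_bool_def)
  qed
  have 2: "integrable (lborel \<Otimes>\<^sub>M lborel) (\<lambda>(p, q). (?I t q * indicator {..<fst q} (fst p)) * (heat_drr r (snd q - snd p) * w p * w q))"
  proof -
    have m: "(\<lambda>z::(real \<times> 'a) \<times> (real \<times> 'a). ?I t (snd z) * (if fst (fst z) < fst (snd z) then 1 else 0)) \<in> borel_measurable borel"
      by measurable
    have "integrable (lborel \<Otimes>\<^sub>M lborel) (\<lambda>(p, q). (?I t (snd (p, q)) * (if fst (fst (p, q)) < fst (snd (p, q)) then 1 else 0)) * (heat_drr r (snd q - snd p) * w p * w q))"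
      by (rule V_int[OF r m]) (auto simp: indicator_def)
    then show ?thesis by (simp add: indicator_def of_bool_def)
  qed
  have 3: "integrable (lborel \<Otimes>\<^sub>M lborel) (\<lambda>(p, q). (?I t p * ?I t q) * (heat_drr r (snd q - snd p) * w p * w q))"
  proof -
    have m: "(\<lambda>z::(real \<times> 'a) \<times> (real \<times> 'a). ?I t (fst z) * ?I t (snd z)) \<in> borel_measurable borel"
      by measurable
    have "integrable (lborel \<Otimes>\<^sub>M lborel) (\<lambda>(p, q). (?I t (fst (p, q)) * ?I t (snd (p, q))) * (heat_drr r (snd q - snd p) * w p * w q))"
      by (rule V_int[OF r m]) (auto simp: indicator_def)
    then show ?thesis by simp
  qed
  have fi: "form_integrable (heat r) (\<lambda>y. f (t, y)) (\<lambda>y. f (t, y))"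
    using heat_le[OF r, where 'a='a] by (intro form_L1[where B="r powr (- real DIM('a) / 2)"] f_int) auto
  \<comment> \<open>Testing with \<open>heat r\<close> and then with \<open>heat_dr r\<close>
    replaces each factor \<open>f (t, y)\<close> by a time integral of \<open>w\<close>; by then two
    Laplacians have landed on the kernel.\<close>
  have "form (heat r) (\<lambda>y. f (t, y)) (\<lambda>y. f (t, y)) = (LBINT y. f (t, y) * (LBINT p. ?I t p * (heat_dr r (snd p - y) * w p)))"
    unfolding form_iterated'[OF fi] eq0[OF t r] ..
  also have "\<dots> = (LBINT y. LBINT p. ?I t p * (heat_dr r (snd p - y) * w p * f (t, y)))"
    unfolding integral_mult_right_zero[symmetric] by (simp add: mult_ac)
  also have "\<dots> = (LBINT p. LBINT y. ?I t p * (heat_dr r (snd p - y) * w p * f (t, y)))"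
    using integrable_wg[OF gauss_bounded_heat_dr[OF r], of "\<lambda>p. f (t, snd p)" t] f_int f_norm
    by (intro lborel_pair.Fubini_integral) (simp add: case_prod_unfold)
  also have "\<dots> = (LBINT p. ?I t p * w p * (LBINT y. heat_dr r (y - snd p) * f (t, y)))"
    unfolding integral_mult_right_zero[symmetric] by (simp add: mult_ac heat_commute(2)[of r _ "snd _"])
  also have "\<dots> = (LBINT p. ?I t p * w p * (LBINT q. ?I t q * (heat_drr r (snd q - snd p) * w q)))"
    unfolding eq1[OF t r] ..
  also have "\<dots> = (LBINT p. LBINT q. (?I t p * ?I t q) * (heat_drr r (snd q - snd p) * w p * w q))"
    unfolding integral_mult_right_zero[symmetric] by (simp add: mult_ac)
  also have "\<dots> = (\<integral>(p, q). (?I t p * ?I t q) * (heat_drr r (snd q - snd p) * w p * w q) \<partial>(lborel \<Otimes>\<^sub>M lborel))"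
    using lborel_pair.integral_fst[OF 3] by simp
  also have "\<dots> = (\<integral>(p, q). (?I t p * ?I (fst p) q) * (heat_drr r (snd q - snd p) * w p * w q) \<partial>(lborel \<Otimes>\<^sub>M lborel))
      + (\<integral>(p, q). (?I t q * indicator {..<fst q} (fst p)) * (heat_drr r (snd q - snd p) * w p * w q) \<partial>(lborel \<Otimes>\<^sub>M lborel))"
  proof -
    show ?thesis
      unfolding Bochner_Integration.integral_add[OF 1 2, symmetric]
      by (rule Bochner_Integration.integral_cong) (auto simp: indicator_def)
  qed
  also have "(\<integral>(p, q). (?I t p * ?I (fst p) q) * (heat_drr r (snd q - snd p) * w p * w q) \<partial>(lborel \<Otimes>\<^sub>M lborel)) = E t (heat_dr r)"
  proof -
    have "(\<integral>(p, q). (?I t p * ?I (fst p) q) * (heat_drr r (snd q - snd p) * w p * w q) \<partial>(lborel \<Otimes>\<^sub>M lborel))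
       = (LBINT p. LBINT q. (?I t p * w p) * (?I (fst p) q * (heat_drr r (snd q - snd p) * w q)))"
      using lborel_pair.integral_fst[OF 1] by (simp add: mult_ac)
    also have "\<dots> = (LBINT p. (?I t p * w p) * (LBINT q. ?I (fst p) q * (heat_drr r (snd q - snd p) * w q)))"
      by simp
    also have "\<dots> = E t (heat_dr r)"
      unfolding E_iterated[OF gauss_bounded_heat_dr[OF r]]
    proof (rule Bochner_Integration.integral_cong[OF refl])
      fix p :: "real \<times> 'a"
      \<comment> \<open>\<open>eq1\<close> is available at times in \<open>D\<close> only; at all
        other times the factor \<open>w p\<close> makes both sides vanish.\<close>
      show "(?I t p * w p) * (LBINT q. ?I (fst p) q * (heat_drr r (snd q - snd p) * w q))
          = ?I t p * w p * (LBINT y. heat_dr r (snd p - y) * f (fst p, y))"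
      proof (cases "fst p \<in> D")
        case True
        have "(LBINT y. heat_dr r (snd p - y) * f (fst p, y)) = (LBINT y. heat_dr r (y - snd p) * f (fst p, y))"
          by (simp add: heat_commute(2)[of r "snd p"])
        then show ?thesis unfolding eq1[OF True r] by simp
      next
        case False
        then have "w p = 0" using w_out[of "fst p" "snd p"] by simp
        then show ?thesis by simp
      qed
    qed
    finally show ?thesis .
  qed
  also have "(\<integral>(p, q). (?I t q * indicator {..<fst q} (fst p)) * (heat_drr r (snd q - snd p) * w p * w q) \<partial>(lborel \<Otimes>\<^sub>M lborel)) = E t (heat_dr r)"
  proof -
    have "(\<integral>(p, q). (?I t q * indicator {..<fst q} (fst p)) * (heat_drr r (snd q - snd p) * w p * w q) \<partial>(lborel \<Otimes>\<^sub>M lborel))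
       = (LBINT q. LBINT p. (?I t q * indicator {..<fst q} (fst p)) * (heat_drr r (snd q - snd p) * w p * w q))"
      using lborel_pair.integral_snd[OF 2] by simp
    also have "\<dots> = (LBINT q. LBINT p. (?I t q * w q) * (indicator {..<fst q} (fst p) * (heat_drr r (snd p - snd q) * w p)))"
      by (intro Bochner_Integration.integral_cong refl) (subst heat_commute(3), simp only: mult_ac)
    also have "\<dots> = (LBINT q. (?I t q * w q) * (LBINT p. indicator {..<fst q} (fst p) * (heat_drr r (snd p - snd q) * w p)))"
      by simp
    also have "\<dots> = E t (heat_dr r)"
      unfolding E_iterated[OF gauss_bounded_heat_dr[OF r]]
    proof (rule Bochner_Integration.integral_cong[OF refl])
      fix q :: "real \<times> 'a"
      show "(?I t q * w q) * (LBINT p. indicator {..<fst q} (fst p) * (heat_drr r (snd p - snd q) * w p))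
          = ?I t q * w q * (LBINT y. heat_dr r (snd q - y) * f (fst q, y))"
      proof (cases "fst q \<in> D")
        case True
        have "(LBINT y. heat_dr r (snd q - y) * f (fst q, y)) = (LBINT y. heat_dr r (y - snd q) * f (fst q, y))"
          by (simp add: heat_commute(2)[of r "snd q"])
        \<comment> \<open>The slice \<open>fst p = fst q\<close> is null, so the strict half may be
          replaced by the closed one, the form in which \<open>eq1\<close> is stated.\<close>
        moreover have "(LBINT p. indicator {..<fst q} (fst p) * (heat_drr r (snd p - snd q) * w p))
            = (LBINT p. ?I (fst q) p * (heat_drr r (snd p - snd q) * w p))"
          using AE_lborel_fst_neq[of "fst q", where 'a='a]
          by (intro integral_cong_AE) (measurable, auto elim!: eventually_mono simp: indicator_def)
        ultimately show ?thesis unfolding eq1[OF True r] by simp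
      next
        case False
        then have "w q = 0" using w_out[of "fst q" "snd q"] by simp
        then show ?thesis by simp
      qed
    qed
    finally show ?thesis .
  qed
  finally show ?thesis by simp
qed

end

section \<open>Integration in the kernel parameter\<close>

lemma integral_heat_dr_time:
  fixes x :: "'a::euclidean_space"
  assumes "0 < \<delta>" "\<delta> \<le> R"
  shows "(LBINT r. indicator {\<delta>..R} r * heat_dr r x) = heat R x - heat \<delta> x"
proof -
  have "(LBINT r. heat_dr r x * indicator {\<delta>..R} r) = heat R x - heat \<delta> x"
  proof (rule integral_FTC_Icc_real[OF assms(2)])
    fix r assume "\<delta> \<le> r" "r \<le> R"
    then have r: "r > 0" using assms by simp
    show "DERIV (\<lambda>r. heat r x) r :> heat_dr r x" by (rule DERIV_heat[OF r])
    show "isCont (\<lambda>r. heat_dr r x) r"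
      unfolding heat_dr_def heat_def gauss_def using r by (intro continuous_intros) auto
  qed
  then show ?thesis by (simp add: mult.commute)
qed

context heat_energy
begin

text \<open>Fubini moves the integral over \<open>r\<close> onto the kernel, where the fundamental
  theorem of calculus applies pointwise. Keeping \<open>\<delta>\<close> positive gives a single
  Gaussian majorant for all \<open>r\<close> in the range.\<close>

lemma E_heat_dr_integral:
  assumes \<delta>: "0 < \<delta>" "\<delta> \<le> R"
  shows "(LBINT r. indicator {\<delta>..R} r * E t (heat_dr r)) = E t (heat R) - E t (heat \<delta>)"
    and "integrable lborel (\<lambda>r. indicator {\<delta>..R} r * E t (heat_dr r))"
proof -
  obtain C c where C: "C \<ge> 0" "c > 0" "\<And>r x::'a. \<delta> \<le> r \<Longrightarrow> r \<le> R \<Longrightarrow> \<bar>heat_dr r x\<bar> \<le> C * gauss c x"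
    using heat_dr_le_gauss[OF \<delta>(1), of R] by metis
  let ?Z = "\<lambda>q::(real \<times> 'a) \<times> 'a. indicator {..t} (fst (fst q)) * (w (fst q) * f (fst (fst q), snd q))"
  let ?x = "\<lambda>q::(real \<times> 'a) \<times> 'a. snd (fst q) - snd q"
  let ?F = "\<lambda>z. indicator {\<delta>..R} (fst z) * (heat_dr (fst z) (?x (snd z)) * ?Z (snd z))"
  have gb: "gauss_bounded (\<lambda>x::'a. C * gauss c x)"
    unfolding gauss_bounded_def using C by (intro conjI exI[of _ C] exI[of _ c]) (auto simp: abs_mult)
  have i0: "integrable lborel (\<lambda>q. indicator {..t} (fst (fst q)) * W (\<lambda>x. C * gauss c x) q)"
    using W_int[OF gb, of t] by (simp add: lborel_prod)
  have int: "integrable (lborel \<Otimes>\<^sub>M lborel) ?F"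
  proof (rule integrable_lborel_pairI)
    have "(\<integral>\<^sup>+r. \<integral>\<^sup>+q. ennreal \<bar>?F (r, q)\<bar> \<partial>lborel \<partial>lborel)
      \<le> (\<integral>\<^sup>+r. \<integral>\<^sup>+q. indicator {\<delta>..R} r * ennreal \<bar>indicator {..t} (fst (fst q)) * W (\<lambda>x. C * gauss c x) q\<bar> \<partial>lborel \<partial>lborel)"
    proof (intro nn_integral_mono)
      fix r and q :: "(real \<times> 'a) \<times> 'a"
      show "ennreal \<bar>?F (r, q)\<bar> \<le> indicator {\<delta>..R} r * ennreal \<bar>indicator {..t} (fst (fst q)) * W (\<lambda>x. C * gauss c x) q\<bar>"
      proof (cases "r \<in> {\<delta>..R}")
        case True
        have "\<bar>heat_dr r (?x q)\<bar> * \<bar>?Z q\<bar> \<le> (C * gauss c (?x q)) * \<bar>?Z q\<bar>"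
          using True by (intro mult_right_mono C) auto
        then show ?thesis using True C by (auto simp: W_def abs_mult mult_ac intro!: ennreal_leI)
      qed simp
    qed
    also have "\<dots> = (\<integral>\<^sup>+q. ennreal \<bar>indicator {..t} (fst (fst q)) * W (\<lambda>x. C * gauss c x) q\<bar> \<partial>lborel) * emeasure lborel {\<delta>..R}"
      using borel_measurable_integrable[OF i0] by (simp add: nn_integral_cmult nn_integral_multc mult.commute)
    also have "\<dots> < \<infinity>" using i0 \<delta> by (simp add: integrable_iff_bounded ennreal_mult_less_top)
    finally show "(\<integral>\<^sup>+r. \<integral>\<^sup>+q. ennreal \<bar>?F (r, q)\<bar> \<partial>lborel \<partial>lborel) < \<infinity>" .
  qed measurable
  have inner: "(LBINT q. ?F (r, q)) = indicator {\<delta>..R} r * E t (heat_dr r)" for r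
    unfolding E_def W_def lborel_prod integral_mult_right_zero[symmetric] by (simp add: mult_ac)
  show "integrable lborel (\<lambda>r. indicator {\<delta>..R} r * E t (heat_dr r))"
    using lborel_pair.integrable_fst'[OF int] unfolding inner .
  have "(LBINT r. indicator {\<delta>..R} r * E t (heat_dr r)) = (LBINT q. LBINT r. ?F (r, q))"
    unfolding inner[symmetric] using int by (intro lborel_pair.Fubini_integral[symmetric]) (simp add: case_prod_unfold)
  also have "\<dots> = (LBINT q. LBINT r. (indicator {\<delta>..R} r * heat_dr r (?x q)) * ?Z q)"
    by (simp add: mult_ac)
  also have "\<dots> = (LBINT q. (heat R (?x q) - heat \<delta> (?x q)) * ?Z q)"
    by (simp only: integral_mult_left_zero integral_heat_dr_time[OF \<delta>])
  also have "\<dots> = (LBINT q. indicator {..t} (fst (fst q)) * W (heat R) q - indicator {..t} (fst (fst q)) * W (heat \<delta>) q)"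
    by (simp add: W_def algebra_simps)
  also have "\<dots> = E t (heat R) - E t (heat \<delta>)"
    unfolding E_def lborel_prod
    using W_int[OF gauss_bounded_heat, of R t] W_int[OF gauss_bounded_heat, of \<delta> t] \<delta>
    by (intro Bochner_Integration.integral_diff) (simp_all add: lborel_prod)
  finally show "(LBINT r. indicator {\<delta>..R} r * E t (heat_dr r)) = E t (heat R) - E t (heat \<delta>)" .
qed

abbreviation G :: "real \<Rightarrow> real \<Rightarrow> real" where
  "G t r \<equiv> form (heat r) (\<lambda>y. f (t, y)) (\<lambda>y. f (t, y))"

lemma G_nonneg: "r > 0 \<Longrightarrow> G t r \<ge> 0"
  by (rule form_heat_self(1)[OF f_int])

text \<open>The relation \<open>G = 2 \<partial>H/\<partial>r\<close> in integrated form, so that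
  \<open>E t (heat r)\<close> never has to be differentiated in \<open>r\<close>.\<close>

lemma G_integral:
  assumes t: "t \<in> D" and \<delta>: "0 < \<delta>" "\<delta> \<le> R"
  shows "(LBINT r. indicator {\<delta>..R} r * G t r) = 2 * (E t (heat R) - E t (heat \<delta>))"
    and "integrable lborel (\<lambda>r. indicator {\<delta>..R} r * G t r)"
proof -
  have eq: "indicator {\<delta>..R} r * G t r = 2 * (indicator {\<delta>..R} r * E t (heat_dr r))" for r
    using energy_identity[OF t, of r] \<delta> by (cases "r \<in> {\<delta>..R}") auto
  show "(LBINT r. indicator {\<delta>..R} r * G t r) = 2 * (E t (heat R) - E t (heat \<delta>))"
    "integrable lborel (\<lambda>r. indicator {\<delta>..R} r * G t r)"
    unfolding eq using E_heat_dr_integral[OF \<delta>, of t] by auto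
qed

lemma E_heat_mono:
  assumes t: "t \<in> D" and \<delta>: "0 < \<delta>" "\<delta> \<le> R"
  shows "E t (heat \<delta>) \<le> E t (heat R)"
proof -
  have "0 \<le> (LBINT r. indicator {\<delta>..R} r * G t r)"
    using \<delta> by (intro integral_nonneg_AE AE_I2) (auto simp: indicator_def intro!: G_nonneg)
  then show ?thesis using G_integral(1)[OF assms] by simp
qed

text \<open>The weight \<open>\<eta> = R\<^bsup>d/4\<^esup>\<close> balances the mass of the kernel against its supremum \<open>R\<^bsup>-d/2\<^esup>\<close>.\<close>

lemma E_heat_decay:
  assumes R: "R \<ge> 1"
  shows "\<bar>E t (heat R)\<bar> \<le> R powr (- real DIM('a) / 4) * (M * (T * heat_mass TYPE('a) + (LBINT p. w1 p)))"
proof -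
  let ?d = "real DIM('a)" and ?m = "heat_mass TYPE('a)" and ?w = "\<integral>p. w1 p \<partial>lborel"
  let ?\<rho> = "R powr (- ?d / 4)"
  have nn: "?m \<ge> 0" "?w \<ge> 0" "?\<rho> \<ge> 0"
    using less_imp_le[OF heat_mass_pos[where 'a='a]] w1_nonneg by auto
  have fs: "(\<integral>\<^sup>+y. ennreal \<bar>f (s, y)\<bar> \<partial>lborel) \<le> ennreal M" for s
    using f_int[of s] f_norm[of s] by (subst nn_integral_eq_integral) (auto intro: ennreal_leI)
  have hkR: "heat R x \<le> R powr (- ?d / 2)" for x :: 'a using R by (intro heat_le) simp
  have \<eta>: "R powr (?d / 4) \<ge> 1" using R by (simp add: ge_one_powr_ge_zero)
  have i: "integrable (lborel \<Otimes>\<^sub>M lborel) (\<lambda>q. indicator {..t} (fst (fst q)) * W (heat R) q)"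
    using R by (intro W_int gauss_bounded_heat) auto
  have m: "(\<lambda>q. ennreal (norm (indicator {..t} (fst (fst q)) * W (heat R) q))) \<in> borel_measurable (lborel \<Otimes>\<^sub>M lborel)"
    using borel_measurable_integrable[OF i] by simp
  have "ennreal (norm (E t (heat R))) \<le> (\<integral>\<^sup>+q. norm (indicator {..t} (fst (fst q)) * W (heat R) q) \<partial>(lborel \<Otimes>\<^sub>M lborel))"
    unfolding E_def by (rule integral_norm_bound_ennreal[OF i])
  also have "\<dots> = (\<integral>\<^sup>+p. \<integral>\<^sup>+y. norm (indicator {..t} (fst p) * W (heat R) (p, y)) \<partial>lborel \<partial>lborel)"
    using lborel.nn_integral_fst[OF m] by simp
  also have "\<dots> \<le> (\<integral>\<^sup>+p. \<integral>\<^sup>+y. ennreal \<bar>heat R (snd p - y) * w p * f (fst p, y)\<bar> \<partial>lborel \<partial>lborel)"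
  proof (intro nn_integral_mono ennreal_leI)
    fix p :: "real \<times> 'a" and y
    show "norm (indicator {..t} (fst p) * W (heat R) (p, y)) \<le> \<bar>heat R (snd p - y) * w p * f (fst p, y)\<bar>"
      by (cases "fst p \<le> t") (auto simp: W_def)
  qed
  also have "\<dots> \<le> ennreal (T * M / R powr (?d / 4)) * (\<integral>\<^sup>+x. heat R (x::'a) \<partial>lborel)
      + ennreal (R powr (?d / 4) * R powr (- ?d / 2) * M) * (\<integral>\<^sup>+p. w1 p \<partial>lborel)"
    by (rule nn_integral_wg[OF _ _ fs heat_nonneg hkR \<eta>]) measurable
  also have "\<dots> = ennreal (?\<rho> * (M * (T * ?m + ?w)))"
  proof -
    have 1: "(\<integral>\<^sup>+x. heat R (x::'a) \<partial>lborel) = ennreal ?m"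
    proof -
      have "(\<integral>\<^sup>+x. heat R (x::'a) \<partial>lborel) = ennreal (LBINT x. heat R (x::'a))"
        using R by (intro nn_integral_eq_integral integrable_heat) auto
      then show ?thesis using integral_heat[of R, where 'a='a] R by simp
    qed
    have 2: "(\<integral>\<^sup>+p. w1 p \<partial>lborel) = ennreal ?w"
      using w1_int w1_nonneg by (intro nn_integral_eq_integral) auto
    have 3: "R powr (?d / 4) * R powr (- ?d / 2) = ?\<rho>"
    proof -
      have "?d / 4 + - ?d / 2 = - ?d / 4" by simp
      then show ?thesis by (simp only: powr_add[symmetric])
    qed
    have 4: "T * M / R powr (?d / 4) = ?\<rho> * (T * M)"
    proof -
      have "?\<rho> = inverse (R powr (?d / 4))" using powr_minus[of R "?d / 4"] by simp
      then show ?thesis by (simp only: divide_inverse mult.commute)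
    qed
    have 5: "ennreal (?\<rho> * (T * M)) * ennreal ?m = ennreal (?\<rho> * (T * M) * ?m)"
      using nn by (intro ennreal_mult''[symmetric])
    have 6: "ennreal (?\<rho> * M) * ennreal ?w = ennreal (?\<rho> * M * ?w)"
      using nn by (intro ennreal_mult''[symmetric])
    have 7: "ennreal (?\<rho> * (T * M) * ?m) + ennreal (?\<rho> * M * ?w) = ennreal (?\<rho> * (T * M) * ?m + ?\<rho> * M * ?w)"
      using nn T_pos M_nonneg by (intro ennreal_plus[symmetric] mult_nonneg_nonneg) auto
    have 8: "\<rho> * (T * M) * m + \<rho> * M * v = \<rho> * (M * (T * m + v))" for \<rho> m v
      by (simp add: algebra_simps)
    show ?thesis unfolding 1 2 3 4 5 6 7 8 ..
  qed
  finally have "ennreal \<bar>E t (heat R)\<bar> \<le> ennreal (?\<rho> * (M * (T * ?m + ?w)))" unfolding real_norm_def .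
  moreover have "0 \<le> ?\<rho> * (M * (T * ?m + ?w))"
    using nn T_pos M_nonneg by (intro mult_nonneg_nonneg add_nonneg_nonneg) auto
  ultimately show ?thesis by (rule ennreal_le_iff[THEN iffD1, rotated])
qed

text \<open>A nondecreasing function of the scale that tends to \<open>0\<close> at infinity cannot
  be positive anywhere.\<close>

lemma E_heat_nonpos:
  assumes t: "t \<in> D" and \<delta>: "\<delta> > 0"
  shows "E t (heat \<delta>) \<le> 0"
proof (rule tendsto_lowerbound)
  let ?d = "real DIM('a)"
  let ?K = "M * (T * heat_mass TYPE('a) + (LBINT p. w1 p))"
  have "((\<lambda>R. R powr (- (?d / 4))) \<longlongrightarrow> 0) at_top"
    by (intro tendsto_neg_powr filterlim_ident) (simp add: DIM_positive)
  then show "((\<lambda>R. R powr (- ?d / 4) * ?K) \<longlongrightarrow> 0) at_top"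
    using tendsto_mult_left_zero by fastforce
  show "\<forall>\<^sub>F R in at_top. E t (heat \<delta>) \<le> R powr (- ?d / 4) * ?K"
    using eventually_ge_at_top[of "max 1 \<delta>"]
  proof eventually_elim
    case (elim R)
    then have "E t (heat \<delta>) \<le> E t (heat R)" using t \<delta> by (intro E_heat_mono) auto
    also have "\<dots> \<le> R powr (- ?d / 4) * ?K" using E_heat_decay[of R t] elim by linarith
    finally show ?case .
  qed
qed simp

text \<open>Hypothesis \<open>low\<close> says that the limit of \<open>E t (heat \<delta>)\<close>
  at \<open>\<delta> = 0\<close> is not negative. Monotonicity and \<open>E_heat_nonpos\<close> then
  squeeze \<open>E\<close> to \<open>0\<close> at every scale, so \<open>G t\<close> integrates to
  \<open>0\<close> over each compact range of positive scales. This is the common end of both cases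
  of the hypothesis.\<close>

lemma vanishing:
  assumes t: "t \<in> D"
    and low: "\<And>e. e > 0 \<Longrightarrow> \<exists>\<delta>0>0. \<forall>\<delta>. 0 < \<delta> \<and> \<delta> < \<delta>0 \<longrightarrow> E t (heat \<delta>) \<ge> - e"
  shows "AE y in lborel. f (t, y) = 0"
proof -
  have E0: "E t (heat \<delta>) = 0" if \<delta>: "\<delta> > 0" for \<delta>
  proof (rule antisym[OF E_heat_nonpos[OF t \<delta>]], rule field_le_epsilon)
    fix e :: real assume "e > 0"
    then obtain \<delta>0 where \<delta>0: "\<delta>0 > 0" "\<And>\<delta>. 0 < \<delta> \<Longrightarrow> \<delta> < \<delta>0 \<Longrightarrow> E t (heat \<delta>) \<ge> - e"
      using low by blast
    define \<delta>' where "\<delta>' = min \<delta> (\<delta>0 / 2)"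
    have "- e \<le> E t (heat \<delta>')" using \<delta> \<delta>0 by (auto simp: \<delta>'_def min_def)
    also have "\<dots> \<le> E t (heat \<delta>)" using t \<delta> \<delta>0(1) by (intro E_heat_mono) (auto simp: \<delta>'_def)
    finally show "0 \<le> E t (heat \<delta>) + e" by simp
  qed
  \<comment> \<open>A vanishing integral gives \<open>G t r = 0\<close> only for almost every
    \<open>r\<close>; an interval of positive length below each \<open>1 / real (Suc n)\<close>
    still provides a sequence of zeros tending to \<open>0\<close>.\<close>
  have "\<exists>r. 0 < r \<and> r \<le> 1 / real (Suc n) \<and> G t r = 0" for n
  proof (rule ccontr)
    assume neg: "\<not> ?thesis"
    let ?R = "1 / real (Suc n)" and ?\<delta> = "1 / (2 * real (Suc n))"
    have \<delta>: "0 < ?\<delta>" "?\<delta> \<le> ?R" by (auto simp: field_simps)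
    have "(LBINT r. indicator {?\<delta>..?R} r * G t r) = 0"
      using G_integral(1)[OF t \<delta>] E0[of ?R] E0[of ?\<delta>] \<delta> by simp
    then have "AE r in lborel. indicator {?\<delta>..?R} r * G t r = 0"
    proof (subst (asm) integral_nonneg_eq_0_iff_AE[OF G_integral(2)[OF t \<delta>] AE_I2])
      show "0 \<le> indicator {?\<delta>..?R} r * G t r" for r
        using less_le_trans[OF \<delta>(1), of r] G_nonneg[of r t] by (cases "r \<in> {?\<delta>..?R}") (auto simp del: of_nat_Suc)
    qed
    then have "AE r in lborel. r \<notin> {?\<delta>..?R}"
    proof eventually_elim
      case (elim r)
      show ?case
      proof
        assume r: "r \<in> {?\<delta>..?R}"
        then have "G t r = 0" using elim by simp
        moreover have "0 < r" "r \<le> ?R" using r \<delta>(1) by (auto simp only: atLeastAtMost_iff intro: less_le_trans)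
        ultimately show False using neg by blast
      qed
    qed
    then have "emeasure lborel {?\<delta>..?R} = 0"
      by (subst (asm) AE_iff_measurable[where N="{?\<delta>..?R}"]) auto
    then show False using \<delta> by (simp add: field_simps)
  qed
  then obtain r where r: "\<And>n. 0 < r n" "\<And>n. r n \<le> 1 / real (Suc n)" "\<And>n. G t (r n) = 0" by metis
  have rlim: "(\<lambda>n. r n / 2) \<longlonglongrightarrow> 0"
  proof -
    have "r \<longlonglongrightarrow> 0"
      by (rule tendsto_sandwich[OF _ _ tendsto_const LIMSEQ_inverse_real_of_nat])
         (use r in \<open>auto simp: less_imp_le inverse_eq_divide\<close>)
    then show ?thesis using tendsto_divide_zero by blast
  qed
  let ?g = "\<lambda>y. f (t, y)"
  have g: "integrable lborel ?g" by (rule f_int)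
  \<comment> \<open>Pairing with the sign makes the limit the L1 norm of \<open>?g\<close> times the
    kernel mass, while each term is \<open>0\<close> because the smoothing at scale
    \<open>r n / 2\<close> vanishes.\<close>
  have "(\<lambda>n. form (heat (r n / 2)) (\<lambda>y. sgn (?g y)) ?g) \<longlonglongrightarrow> heat_mass TYPE('a) * (LBINT y. sgn (?g y) * ?g y)"
    using r(1) rlim g by (intro form_heat_tendsto_bounded[where B=1]) (auto simp: sgn_if)
  moreover have "form (heat (r n / 2)) (\<lambda>y. sgn (?g y)) ?g = 0" for n
  proof -
    have "form_integrable (heat (r n / 2)) (\<lambda>y. sgn (?g y)) ?g"
      using r(1)[of n] by (intro form_integrable_bounded[where B=1] integrable_heat g) (auto simp: sgn_if)
    then have "form (heat (r n / 2)) (\<lambda>y. sgn (?g y)) ?g = (LBINT x. sgn (?g x) * (LBINT y. heat (r n / 2) (x - y) * ?g y))"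
      by (rule form_iterated)
    also have "\<dots> = 0"
      using form_heat_self(2)[OF g r(1) r(3), of n] by (intro integral_eq_zero_AE) auto
    finally show ?thesis .
  qed
  ultimately have "heat_mass TYPE('a) * (LBINT y. sgn (?g y) * ?g y) = 0"
    by (simp add: LIMSEQ_const_iff)
  then have "(LBINT y. \<bar>?g y\<bar>) = 0"
    using heat_mass_pos[where 'a='a] by (simp add: abs_sgn mult.commute)
  then show ?thesis using integral_nonneg_eq_0_iff_AE[of lborel "\<lambda>y. \<bar>?g y\<bar>"] g by simp
qed

end

section \<open>Small-parameter limits\<close>

text \<open>The majorant of \<open>G t r\<close> near \<open>r = 0\<close> in dimension one. In
  dimension \<open>d\<close> the exponent would be \<open>- d / 2\<close>, which is not integrable
  at \<open>0\<close> for \<open>d \<ge> 2\<close>; this is where (B2) uses its restriction on the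
  dimension.\<close>

lemma integrable_inverse_sqrt: "integrable lborel (\<lambda>r::real. indicator {0<..1} r * r powr (- 1 / 2))"
proof -
  have "(\<lambda>x::real. x powr (- 1 / 2)) absolutely_integrable_on {0<..1}"
    by (intro nonnegative_absolutely_integrable_1 integrable_on_powr_from_0') auto
  then have "integrable lebesgue (\<lambda>r::real. indicator {0<..1} r * r powr (- 1 / 2))"
    by (simp add: set_integrable_def)
  then show ?thesis by (subst (asm) integrable_completion) measurable
qed

context heat_energy
begin

text \<open>At almost every time in \<open>{t0<..t}\<close> both \<open>w\<close> and
  \<open>f\<close> are square integrable in space, so the approximate identity applies slice by
  slice; \<open>form_L2\<close> with weight \<open>1\<close> gives a majorant independent of the
  scale. The limit is the kernel mass times the integral of \<open>w * f\<close> over the strip,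
  nonnegative by \<open>fw\<close>. Starting at \<open>t0\<close> admits square integrability away
  from time \<open>0\<close> only.\<close>

lemma E_diff_tendsto:
  assumes t0: "t0 \<le> t"
    and L2w: "integrable lborel (\<lambda>p. indicator {t0<..} (fst p) * (w p)\<^sup>2)"
    and L2f: "integrable lborel (\<lambda>p. indicator {t0<..} (fst p) * (f p)\<^sup>2)"
    and \<delta>: "\<And>n. \<delta> n > 0" "\<delta> \<longlonglongrightarrow> 0"
  obtains l where "l \<ge> 0" "(\<lambda>n. E t (heat (\<delta> n)) - E t0 (heat (\<delta> n))) \<longlonglongrightarrow> l"
proof -
  let ?\<chi> = "indicator {t0<..t} :: real \<Rightarrow> real" and ?m = "heat_mass TYPE('a)"
  define h where "h r s = ?\<chi> s * (LBINT x. w (s, x) * (LBINT y. heat r (x - y) * f (s, y)))" for r s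
  have E_diff: "E t (heat r) - E t0 (heat r) = (LBINT s. h r s)" and h_int: "integrable lborel (h r)" if r: "r > 0" for r
  proof -
    have i: "integrable lborel (\<lambda>p. indicator {..t} (fst p) * w p * (LBINT y. heat r (snd p - y) * f (fst p, y)))" for t
    proof -
      have "integrable lborel (\<lambda>p. \<integral>y. indicator {..t} (fst p) * W (heat r) (p, y) \<partial>lborel)"
        using lborel_pair.integrable_fst'[OF W_int[OF gauss_bounded_heat[OF r], of t]] by simp
      moreover have "(LBINT y. indicator {..t} (fst p) * W (heat r) (p, y))
          = indicator {..t} (fst p) * w p * (LBINT y. heat r (snd p - y) * f (fst p, y))" for p
        unfolding integral_mult_right_zero[symmetric] by (simp add: W_def mult_ac)
      ultimately show ?thesis by (simp only:)
    qed
    let ?F = "\<lambda>p. ?\<chi> (fst p) * (w p * (LBINT y. heat r (snd p - y) * f (fst p, y)))"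
    have eq: "?F p = indicator {..t} (fst p) * w p * (LBINT y. heat r (snd p - y) * f (fst p, y))
        - indicator {..t0} (fst p) * w p * (LBINT y. heat r (snd p - y) * f (fst p, y))" for p
      using t0 by (auto simp: indicator_def)
    have F: "integrable lborel ?F" unfolding eq by (intro Bochner_Integration.integrable_diff i)
    have hF: "(\<lambda>s. \<integral>x. ?F (s, x) \<partial>lborel) = h r" by (simp add: h_def fun_eq_iff)
    show "integrable lborel (h r)" using integral_lborel_pair(2)[OF F] unfolding hF .
    have "E t (heat r) - E t0 (heat r) = (LBINT p. ?F p)"
      unfolding E_iterated[OF gauss_bounded_heat[OF r]] eq by (intro Bochner_Integration.integral_diff[symmetric] i)
    also have "\<dots> = (LBINT s. h r s)" unfolding integral_lborel_pair(1)[OF F] by (simp add: h_def)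
    finally show "E t (heat r) - E t0 (heat r) = (LBINT s. h r s)" .
  qed
  let ?a = "\<lambda>s. \<integral>x. indicator {t0<..} s * (w (s, x))\<^sup>2 \<partial>lborel"
  let ?b = "\<lambda>s. \<integral>x. indicator {t0<..} s * (f (s, x))\<^sup>2 \<partial>lborel"
  define l where "l s = ?\<chi> s * (?m * (LBINT x. w (s, x) * f (s, x)))" for s
  have [measurable]: "l \<in> borel_measurable borel" unfolding l_def by measurable
  have AEw: "AE s in lborel. integrable lborel (\<lambda>x. indicator {t0<..} s * (w (s, x))\<^sup>2)"
    using integral_lborel_pair(3)[OF L2w] by simp
  have AEf: "AE s in lborel. integrable lborel (\<lambda>x. indicator {t0<..} s * (f (s, x))\<^sup>2)"
    using integral_lborel_pair(3)[OF L2f] by simp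
  have form: "h r s = form (heat r) (\<lambda>x. w (s, x)) (\<lambda>x. f (s, x))" "integrable lborel (\<lambda>x. (w (s, x))\<^sup>2)" "integrable lborel (\<lambda>x. (f (s, x))\<^sup>2)"
    if "s \<in> {t0<..t}" "r > 0" "integrable lborel (\<lambda>x. indicator {t0<..} s * (w (s, x))\<^sup>2)"
      "integrable lborel (\<lambda>x. indicator {t0<..} s * (f (s, x))\<^sup>2)" for s r
  proof -
    show w2: "integrable lborel (\<lambda>x. (w (s, x))\<^sup>2)" and f2: "integrable lborel (\<lambda>x. (f (s, x))\<^sup>2)"
      using that by auto
    have "form_integrable (heat r) (\<lambda>x. w (s, x)) (\<lambda>x. f (s, x))"
      by (rule form_L2(1)[OF integrable_heat[OF that(2)] _ _ w2 _ f2]) auto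
    from form_iterated[OF this] show "h r s = form (heat r) (\<lambda>x. w (s, x)) (\<lambda>x. f (s, x))"
      using that by (simp add: h_def)
  qed
  have "(\<lambda>n. \<integral>s. h (\<delta> n) s \<partial>lborel) \<longlonglongrightarrow> (LBINT s. l s)"
  proof (rule integral_dominated_convergence[where w="\<lambda>s. ?m * (?a s + ?b s)"])
    show "integrable lborel (\<lambda>s. ?m * (?a s + ?b s))"
      using integral_lborel_pair(2)[OF L2w] integral_lborel_pair(2)[OF L2f] by auto
    show "AE s in lborel. (\<lambda>n. h (\<delta> n) s) \<longlonglongrightarrow> l s"
      using AEw AEf
    proof eventually_elim
      case (elim s)
      show ?case
      proof (cases "s \<in> {t0<..t}")
        case True
        note F = form[OF True _ elim]
        have "(\<lambda>n. form (heat (\<delta> n)) (\<lambda>x. w (s, x)) (\<lambda>x. f (s, x))) \<longlonglongrightarrow> ?m * (LBINT x. w (s, x) * f (s, x))"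
          using F(2,3)[of 1] by (intro form_heat_tendsto_L2 \<delta> f_int) auto
        then show ?thesis using True F(1)[OF \<delta>(1)] by (simp add: l_def)
      qed (simp add: h_def l_def)
    qed
    show "AE s in lborel. norm (h (\<delta> n) s) \<le> ?m * (?a s + ?b s)" for n
      using AEw AEf
    proof eventually_elim
      case (elim s)
      show ?case
      proof (cases "s \<in> {t0<..t}")
        case True
        note F = form[OF True \<delta>(1) elim]
        have "\<bar>form (heat (\<delta> n)) (\<lambda>x. w (s, x)) (\<lambda>x. f (s, x))\<bar>
          \<le> (LBINT x. heat (\<delta> n) (x::'a)) * ((LBINT x. (w (s, x))\<^sup>2) / 1 + 1 * (LBINT x. (f (s, x))\<^sup>2))"
          by (rule form_L2(2)[OF integrable_heat[OF \<delta>(1)] _ _ F(2) _ F(3)]) auto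
        then show ?thesis unfolding F(1) using True integral_heat[OF \<delta>(1)[of n], where 'a='a] by simp
      next
        case False
        have "0 \<le> ?m * (?a s + ?b s)" using heat_mass_pos[where 'a='a]
          by (intro mult_nonneg_nonneg add_nonneg_nonneg integral_nonneg_AE) auto
        then show ?thesis using False by (simp add: h_def)
      qed
    qed
  qed (use h_int \<delta> in auto)
  then have "(\<lambda>n. E t (heat (\<delta> n)) - E t0 (heat (\<delta> n))) \<longlonglongrightarrow> (LBINT s. l s)"
    using E_diff[OF \<delta>(1)] by simp
  moreover have "(LBINT s. l s) \<ge> 0"
  proof (intro integral_nonneg_AE AE_I2)
    fix s
    have "(LBINT x. w (s, x) * f (s, x)) \<ge> 0" by (intro integral_nonneg_AE AE_I2 fw)
    then show "l s \<ge> 0" using heat_mass_pos[where 'a='a] by (auto simp: l_def indicator_def)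
  qed
  ultimately show ?thesis using that by blast
qed

text \<open>Dominated convergence yields limits along sequences, whereas \<open>vanishing\<close>
  asks for a full neighbourhood of \<open>0\<close>. If that failed, some sequence of scales tending
  to \<open>0\<close> would keep \<open>E\<close> below \<open>- e\<close> at every index, so one
  good index per sequence is enough.\<close>

lemma vanishing_sequential:
  assumes t: "t \<in> D"
    and low: "\<And>e \<delta>. e > 0 \<Longrightarrow> (\<And>n. \<delta> n > 0) \<Longrightarrow> \<delta> \<longlonglongrightarrow> 0 \<Longrightarrow> \<exists>n::nat. E t (heat (\<delta> n)) \<ge> - e"
  shows "AE y in lborel. f (t, y) = 0"
proof (rule vanishing[OF t], rule ccontr)
  fix e :: real
  assume e: "e > 0" and neg: "\<not> (\<exists>\<delta>0>0. \<forall>\<delta>. 0 < \<delta> \<and> \<delta> < \<delta>0 \<longrightarrow> - e \<le> E t (heat \<delta>))"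
  have "\<exists>\<delta>. 0 < \<delta> \<and> \<delta> < 1 / real (Suc n) \<and> E t (heat \<delta>) < - e" for n
  proof -
    have "1 / real (Suc n) > 0" by simp
    then show ?thesis using neg by (meson not_le)
  qed
  then obtain \<delta> where \<delta>: "\<And>n. 0 < \<delta> n" "\<And>n. \<delta> n < 1 / real (Suc n)" "\<And>n. E t (heat (\<delta> n)) < - e" by metis
  have "\<delta> \<longlonglongrightarrow> 0"
    by (rule tendsto_sandwich[OF _ _ tendsto_const LIMSEQ_inverse_real_of_nat])
       (use \<delta> in \<open>auto simp: inverse_eq_divide intro!: always_eventually less_imp_le\<close>)
  from low[OF e \<delta>(1) this] \<delta>(3) show False by (meson not_le)
qed

lemma W_nonpos_time: "fst (fst q) \<le> 0 \<Longrightarrow> W K q = 0"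
proof -
  assume "fst (fst q) \<le> 0"
  then have "fst (fst q) \<notin> D" using D_sub by auto
  then have "w (fst q) = 0" using w_out[of "fst (fst q)" "snd (fst q)"] by simp
  then show ?thesis by (simp add: W_def)
qed

text \<open>Case (B1): square integrability reaches down to time \<open>0\<close>, where
  \<open>E 0 K = 0\<close> leaves no boundary term.\<close>

lemma vanishing_L2:
  assumes t: "t \<in> D" and "integrable lborel (\<lambda>p. (w p)\<^sup>2)" "integrable lborel (\<lambda>p. (f p)\<^sup>2)"
  shows "AE y in lborel. f (t, y) = 0"
proof (rule vanishing_sequential[OF t])
  fix e :: real and \<delta> :: "nat \<Rightarrow> real" assume e: "e > 0" and \<delta>: "\<And>n. \<delta> n > 0" "\<delta> \<longlonglongrightarrow> 0"
  have ind: "integrable lborel (\<lambda>p. indicator {0<..} (fst p) * g p)" if "integrable lborel g" for g :: "real \<times> 'a \<Rightarrow> real"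
  proof -
    have [measurable]: "g \<in> borel_measurable borel" using that by auto
    show ?thesis by (rule Bochner_Integration.integrable_bound[OF that]) (auto simp: indicator_def)
  qed
  have "0 \<le> t" using t D_sub by auto
  from E_diff_tendsto[OF this ind[OF assms(2)] ind[OF assms(3)] \<delta>]
  obtain l where l: "l \<ge> 0" "(\<lambda>n. E t (heat (\<delta> n)) - E 0 (heat (\<delta> n))) \<longlonglongrightarrow> l" by blast
  have E0: "E 0 K = 0" for K
    unfolding E_def by (rule integral_eq_zero_AE) (auto simp: indicator_def W_nonpos_time)
  from order_tendstoD(1)[OF l(2), of "- e"] e l(1)
  have "\<forall>\<^sub>F n in sequentially. - e < E t (heat (\<delta> n))" by (simp add: E0)
  then show "\<exists>n. E t (heat (\<delta> n)) \<ge> - e" using eventually_happens'[OF sequentially_bot] less_imp_le by blast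
qed

text \<open>The kernel is fixed and only the time window shrinks; the integrand cut off at
  \<open>T\<close> dominates because \<open>ts n \<le> T\<close>.\<close>

lemma E_tendsto_0:
  assumes K: "gauss_bounded K" and ts: "\<And>n. ts n \<in> D" "ts \<longlonglongrightarrow> 0"
  shows "(\<lambda>n. E (ts n) K) \<longlonglongrightarrow> 0"
proof -
  have m: "(\<lambda>q. indicator {..t} (fst (fst q)) * W K q) \<in> borel_measurable (lborel \<Otimes>\<^sub>M lborel)" for t
    using borel_measurable_integrable[OF W_int[OF K]] .
  have "(\<lambda>n. E (ts n) K) \<longlonglongrightarrow> (\<integral>q. 0 \<partial>((lborel :: (real \<times> 'a) measure) \<Otimes>\<^sub>M (lborel :: 'a measure)))"
    unfolding E_def
  proof (rule integral_dominated_convergence[where w="\<lambda>q. norm (indicator {..T} (fst (fst q)) * W K q)", OF _ m])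
    show "integrable (lborel \<Otimes>\<^sub>M lborel) (\<lambda>q. norm (indicator {..T} (fst (fst q)) * W K q))"
      using W_int[OF K] by (rule integrable_norm)
    show "AE q in lborel \<Otimes>\<^sub>M lborel. (\<lambda>n. indicator {..ts n} (fst (fst q)) * W K q) \<longlonglongrightarrow> 0"
    proof (intro AE_I2)
      fix q :: "(real \<times> 'a) \<times> 'a"
      show "(\<lambda>n. indicator {..ts n} (fst (fst q)) * W K q) \<longlonglongrightarrow> 0"
      proof (cases "fst (fst q) \<le> 0")
        case True
        then show ?thesis by (simp add: W_nonpos_time)
      next
        case False
        then have "\<forall>\<^sub>F n in sequentially. ts n < fst (fst q)" by (intro order_tendstoD(2)[OF ts(2)]) auto
        then have "\<forall>\<^sub>F n in sequentially. indicator {..ts n} (fst (fst q)) * W K q = 0"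
          by eventually_elim auto
        then show ?thesis by (rule tendsto_eventually)
      qed
    qed
    show "AE q in lborel \<Otimes>\<^sub>M lborel. norm (indicator {..ts n} (fst (fst q)) * W K q) \<le> norm (indicator {..T} (fst (fst q)) * W K q)" for n
      using ts(1)[of n] D_sub by (intro AE_I2) (auto simp: indicator_def)
  qed simp
  then show ?thesis by simp
qed

lemma G_measurable[measurable]: "G t \<in> borel_measurable borel"
proof -
  have "(\<lambda>r. \<integral>q. heat r (fst q - snd q) * f (t, fst q) * f (t, snd q) \<partial>lborel) \<in> borel_measurable borel"
    by measurable
  then show ?thesis by (simp add: form_def lborel_prod)
qed

text \<open>The point is uniformity in \<open>\<delta>\<close>. For each fixed scale,
  \<open>G (ts n) r = 2 * E (ts n) (heat_dr r)\<close> tends to \<open>0\<close>, and in dimension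
  one it is dominated by \<open>M * M * r powr (- 1 / 2)\<close>; hence its integral over
  \<open>(0,1]\<close> tends to \<open>0\<close>. That integral controls the drop of
  \<open>E\<close> from scale \<open>1\<close> to any smaller \<open>\<delta>\<close>.\<close>

lemma energy_small_time:
  assumes dim: "DIM('a) = 1" and ts: "\<And>n. ts n \<in> D" "ts \<longlonglongrightarrow> 0" and e: "e > 0"
  shows "\<forall>\<^sub>F n in sequentially. \<forall>\<delta>. 0 < \<delta> \<and> \<delta> \<le> 1 \<longrightarrow> E (ts n) (heat \<delta>) \<ge> - e"
proof -
  let ?dom = "\<lambda>r. M * M * (indicator {0<..1} r * r powr (- 1 / 2))"
  have dom_int: "integrable lborel ?dom" using integrable_inverse_sqrt by simp
  have G_le: "norm (indicator {0<..1} r * G t r) \<le> ?dom r" for t r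
  proof (cases "r \<in> {0<..1}")
    case True
    then have heat_dr: "\<bar>heat r x\<bar> \<le> r powr (- 1 / 2)" for x :: 'a using heat_le[of r x] dim by simp
    have "\<bar>G t r\<bar> \<le> r powr (- 1 / 2) * ((LBINT x. \<bar>f (t, x)\<bar>) * (LBINT x. \<bar>f (t, x)\<bar>))"
      by (rule form_L1(2)[OF _ heat_dr f_int f_int]) measurable
    also have "\<dots> \<le> r powr (- 1 / 2) * (M * M)"
      using M_nonneg by (intro mult_left_mono mult_mono f_norm) auto
    finally show ?thesis using True by (simp add: mult_ac)
  qed simp
  have G_int: "integrable lborel (\<lambda>r. indicator {0<..1} r * G t r)" for t
    by (rule Bochner_Integration.integrable_bound[OF dom_int])
      (use G_le in \<open>auto intro!: AE_I2 intro: order_trans[OF _ abs_ge_self]\<close>)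
  have "(\<lambda>n. \<integral>r. indicator {0<..1} r * G (ts n) r \<partial>lborel) \<longlonglongrightarrow> (\<integral>r. 0 \<partial>(lborel :: real measure))"
  proof (rule integral_dominated_convergence[where w="?dom", OF _ _ dom_int])
    show "AE r in lborel. (\<lambda>n. indicator {0<..1} r * G (ts n) r) \<longlonglongrightarrow> 0"
    proof (intro AE_I2)
      fix r :: real
      show "(\<lambda>n. indicator {0<..1} r * G (ts n) r) \<longlonglongrightarrow> 0"
      proof (cases "r \<in> {0<..1}")
        case True
        then have "(\<lambda>n. 2 * E (ts n) (heat_dr r)) \<longlonglongrightarrow> 2 * 0"
          by (intro tendsto_mult tendsto_const E_tendsto_0 gauss_bounded_heat_dr ts) auto
        then show ?thesis using True energy_identity[OF ts(1)] by simp
      qed simp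
    qed
    show "AE r in lborel. norm (indicator {0<..1} r * G (ts n) r) \<le> ?dom r" for n
      using G_le by (intro AE_I2)
  qed auto
  then have lim1: "(\<lambda>n. \<integral>r. indicator {0<..1} r * G (ts n) r \<partial>lborel) \<longlonglongrightarrow> 0" by simp
  have lim2: "(\<lambda>n. E (ts n) (heat 1)) \<longlonglongrightarrow> 0" by (intro E_tendsto_0 gauss_bounded_heat ts) auto
  have "\<forall>\<^sub>F n in sequentially. (LBINT r. indicator {0<..1} r * G (ts n) r) < e"
    using lim1 e by (intro order_tendstoD(2)) auto
  moreover have "\<forall>\<^sub>F n in sequentially. - e / 2 < E (ts n) (heat 1)"
    using lim2 e by (intro order_tendstoD(1)) auto
  ultimately show ?thesis
  proof eventually_elim
    case (elim n)
    show ?case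
    proof (intro allI impI)
      fix \<delta> :: real assume \<delta>: "0 < \<delta> \<and> \<delta> \<le> 1"
      have "2 * (E (ts n) (heat 1) - E (ts n) (heat \<delta>)) = (LBINT r. indicator {\<delta>..1} r * G (ts n) r)"
        using G_integral(1)[OF ts(1), of \<delta> 1 n] \<delta> by simp
      also have "\<dots> \<le> (LBINT r. indicator {0<..1} r * G (ts n) r)"
      proof (rule integral_mono[OF _ G_int])
        show "integrable lborel (\<lambda>r. indicator {\<delta>..1} r * G (ts n) r)" using G_integral(2)[OF ts(1), of \<delta> 1 n] \<delta> by simp
        show "indicator {\<delta>..1} r * G (ts n) r \<le> indicator {0<..1} r * G (ts n) r" for r
          using \<delta> G_nonneg[of r "ts n"] by (auto simp: indicator_def)
      qed
      also have "\<dots> < e" by (rule elim(1))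
      finally show "E (ts n) (heat \<delta>) \<ge> - e" using elim(2) by (simp add: field_simps)
    qed
  qed
qed

text \<open>Case (B2): square integrability fails only near time \<open>0\<close>. The contribution
  up to a small time \<open>ts k\<close> is bounded below by \<open>energy_small_time\<close>, the
  rest by the nonnegative limit in \<open>E_diff_tendsto\<close>.\<close>

lemma vanishing_dim1:
  assumes dim: "DIM('a) = 1" and t: "t \<in> D"
    and D_small: "\<And>e. e > 0 \<Longrightarrow> \<exists>s\<in>D. s < e"
    and L2: "\<And>t0. t0 > 0 \<Longrightarrow> integrable lborel (\<lambda>p. indicator {t0<..} (fst p) * (w p)\<^sup>2)"
      "\<And>t0. t0 > 0 \<Longrightarrow> integrable lborel (\<lambda>p. indicator {t0<..} (fst p) * (f p)\<^sup>2)"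
  shows "AE y in lborel. f (t, y) = 0"
proof (rule vanishing_sequential[OF t])
  fix e :: real and \<delta> :: "nat \<Rightarrow> real" assume e: "e > 0" and \<delta>: "\<And>n. \<delta> n > 0" "\<delta> \<longlonglongrightarrow> 0"
  have "\<exists>s\<in>D. s < 1 / real (Suc n)" for n by (rule D_small) simp
  then obtain ts where ts: "\<And>n. ts n \<in> D" "\<And>n. ts n < 1 / real (Suc n)" by metis
  have tslim: "ts \<longlonglongrightarrow> 0"
  proof (rule tendsto_sandwich[OF _ _ tendsto_const LIMSEQ_inverse_real_of_nat])
    show "\<forall>\<^sub>F n in sequentially. 0 \<le> ts n" using ts(1) D_sub by (intro always_eventually allI) (metis greaterThanAtMost_iff less_imp_le subsetD)
    show "\<forall>\<^sub>F n in sequentially. ts n \<le> inverse (real (Suc n))"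
      using ts(2) by (intro always_eventually allI) (auto simp: inverse_eq_divide less_imp_le)
  qed
  have tpos: "t > 0" using t D_sub by auto
  have "\<forall>\<^sub>F n in sequentially. ts n < t" using tslim tpos by (rule order_tendstoD(2))
  moreover have "\<forall>\<^sub>F n in sequentially. \<forall>\<delta>. 0 < \<delta> \<and> \<delta> \<le> 1 \<longrightarrow> E (ts n) (heat \<delta>) \<ge> - (e / 2)"
    using e by (intro energy_small_time[OF dim ts(1) tslim]) auto
  ultimately have "\<forall>\<^sub>F n in sequentially. ts n < t \<and> (\<forall>\<delta>. 0 < \<delta> \<and> \<delta> \<le> 1 \<longrightarrow> E (ts n) (heat \<delta>) \<ge> - (e / 2))"
    by eventually_elim auto
  \<comment> \<open>The starting time is frozen before the scale tends to \<open>0\<close>, which is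
    legitimate because its lower bound holds for all scales up to \<open>1\<close>.\<close>
  then obtain k where k: "ts k < t" "\<And>\<delta>. 0 < \<delta> \<Longrightarrow> \<delta> \<le> 1 \<Longrightarrow> E (ts k) (heat \<delta>) \<ge> - (e / 2)"
    using eventually_happens'[OF sequentially_bot] by blast
  have k0: "ts k > 0" using ts(1)[of k] D_sub by auto
  from E_diff_tendsto[OF less_imp_le[OF k(1)] L2(1)[OF k0] L2(2)[OF k0] \<delta>]
  obtain l where l: "l \<ge> 0" "(\<lambda>n. E t (heat (\<delta> n)) - E (ts k) (heat (\<delta> n))) \<longlonglongrightarrow> l" by blast
  have "\<forall>\<^sub>F n in sequentially. - (e / 2) < E t (heat (\<delta> n)) - E (ts k) (heat (\<delta> n))"
    using e l(1) by (intro order_tendstoD(1)[OF l(2)]) auto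
  moreover have "\<forall>\<^sub>F n in sequentially. \<delta> n < 1" using \<delta>(2) by (rule order_tendstoD(2)) simp
  ultimately have "\<forall>\<^sub>F n in sequentially. - e \<le> E t (heat (\<delta> n))"
  proof eventually_elim
    case (elim n)
    have "E (ts k) (heat (\<delta> n)) \<ge> - (e / 2)" using k(2)[OF \<delta>(1), of n] elim(2) by simp
    then show ?case using elim(1) by linarith
  qed
  then show "\<exists>n. E t (heat (\<delta> n)) \<ge> - e" using eventually_happens'[OF sequentially_bot] by blast
qed

end

section \<open>Passing from measures to densities\<close>

text \<open>The measures act as bounded functionals on the Banach space of bounded continuous
  functions. For each test function, weak continuity on a compact interval gives a bound over
  \<open>t\<close>; \<open>uniform_boundedness\<close> makes it uniform over test functions.\<close>

lemma weakly_continuous_uniform_bound: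
  fixes z :: "real \<Rightarrow> 'a::euclidean_space smeasure"
  assumes fin: "\<And>t. t \<in> {a..b} \<Longrightarrow> fin_smeasure (z t)" and cont: "weakly_continuous_on {a..b} z"
  obtains M where "M \<ge> 0"
    "\<And>t u B. t \<in> {a..b} \<Longrightarrow> continuous_on UNIV u \<Longrightarrow> (\<And>x. \<bar>u x\<bar> \<le> B) \<Longrightarrow> \<bar>sint (z t) u\<bar> \<le> M * B"
proof -
  define \<Phi> where "\<Phi> t F = sint (z t) (apply_bcontfun F)" for t and F :: "'a \<Rightarrow>\<^sub>C real"
  have si: "sintegrable (z t) (apply_bcontfun F)" if "t \<in> {a..b}" for t and F :: "'a \<Rightarrow>\<^sub>C real"
    using norm_bounded[of F]
    by (intro integrable_bounded_fin_smeasure[OF fin[OF that], where B="norm F"] borel_measurable_continuous_onI) auto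
  have lin: "bounded_linear (\<Phi> t)" if t: "t \<in> {a..b}" for t
  proof (rule bounded_linear_intro[where K="measure (fst (z t)) (space (fst (z t))) + measure (snd (z t)) (space (snd (z t)))"])
    interpret p: finite_measure "fst (z t)" using fin[OF t] by (simp add: fin_smeasure_def)
    interpret n: finite_measure "snd (z t)" using fin[OF t] by (simp add: fin_smeasure_def)
    note i = si[OF t, unfolded sintegrable_def]
    show "\<Phi> t (F + F') = \<Phi> t F + \<Phi> t F'" for F F'
      using i by (simp add: \<Phi>_def sint_def)
    show "\<Phi> t (r *\<^sub>R F) = r *\<^sub>R \<Phi> t F" for r F
      by (simp add: \<Phi>_def sint_def right_diff_distrib)
    fix F :: "'a \<Rightarrow>\<^sub>C real"
    have bd: "\<bar>\<integral>x. F x \<partial>\<mu>\<bar> \<le> norm F * measure \<mu> (space \<mu>)" if "finite_measure \<mu>" "integrable \<mu> F" for \<mu>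
    proof -
      interpret finite_measure \<mu> by fact
      have "\<bar>\<integral>x. F x \<partial>\<mu>\<bar> \<le> (\<integral>x. \<bar>F x\<bar> \<partial>\<mu>)" by (rule integral_abs_bound)
      also have "\<dots> \<le> (\<integral>x. norm F \<partial>\<mu>)"
        using that(2) norm_bounded[of F] by (intro integral_mono) auto
      finally show ?thesis by (simp add: mult.commute)
    qed
    show "norm (\<Phi> t F) \<le> norm F * (measure (fst (z t)) (space (fst (z t))) + measure (snd (z t)) (space (snd (z t))))"
      using bd[OF p.finite_measure_axioms] bd[OF n.finite_measure_axioms] i[of F]
      by (simp add: \<Phi>_def sint_def distrib_left)
  qed
  have ptw: "bounded ((\<lambda>t. \<Phi> t F) ` {a..b})" for F
  proof -
    have "continuous_on {a..b} (\<lambda>t. \<Phi> t F)"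
      using cont unfolding weakly_continuous_on_def \<Phi>_def by auto
    then show ?thesis by (intro compact_imp_bounded compact_continuous_image) auto
  qed
  obtain M where M: "M \<ge> 0" "\<And>t F. t \<in> {a..b} \<Longrightarrow> \<bar>\<Phi> t F\<bar> \<le> M * norm F"
    using uniform_boundedness[of "{a..b}" \<Phi>, OF lin ptw] by metis
  have "\<bar>sint (z t) u\<bar> \<le> M * B" if "t \<in> {a..b}" "continuous_on UNIV u" "\<And>x. \<bar>u x\<bar> \<le> B" for t u B
  proof -
    have "u \<in> bcontfun" using that by (intro bcontfun_normI) auto
    then have F: "apply_bcontfun (Bcontfun u) = u" by (simp add: Bcontfun_inverse)
    then have "norm (Bcontfun u) \<le> B" using that(3) by (intro norm_bound) auto
    then show ?thesis using M(2)[OF that(1), of "Bcontfun u"] mult_left_mono[OF _ M(1)] F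
      by (fastforce simp: \<Phi>_def)
  qed
  then show ?thesis using M(1) that by blast
qed

text \<open>The optimal test function \<open>sgn (g x)\<close> is discontinuous. Its smoothing by
  \<open>heat\<close> is continuous with supremum at most the kernel mass, and the pairings converge
  to the mass times the L1 norm, so the mass cancels.\<close>

lemma L1_norm_le_of_continuous_tests:
  fixes g :: "'a::euclidean_space \<Rightarrow> real"
  assumes g: "integrable lborel g"
    and test: "\<And>u B. continuous_on UNIV u \<Longrightarrow> (\<And>x. \<bar>u x\<bar> \<le> B) \<Longrightarrow> \<bar>\<integral>x. u x * g x \<partial>lborel\<bar> \<le> M * B"
  shows "(LBINT x. \<bar>g x\<bar>) \<le> M"
proof -
  let ?m = "heat_mass TYPE('a)" and ?\<delta> = "\<lambda>n. 1 / real (Suc n)"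
  have [measurable]: "g \<in> borel_measurable borel" using g by auto
  have sgn1: "\<bar>sgn (g x)\<bar> \<le> 1" for x by (simp add: sgn_if)
  have "(\<lambda>n. form (heat (?\<delta> n)) (\<lambda>x. sgn (g x)) g) \<longlonglongrightarrow> ?m * (LBINT x. sgn (g x) * g x)"
    using LIMSEQ_inverse_real_of_nat sgn1 g
    by (intro form_heat_tendsto_bounded[where B=1]) (auto simp: inverse_eq_divide)
  moreover have "form (heat (?\<delta> n)) (\<lambda>x. sgn (g x)) g \<le> M * ?m" for n
  proof -
    let ?u = "\<lambda>y. \<integral>x. heat (?\<delta> n) (x - y) * sgn (g x) \<partial>lborel"
    have k: "integrable lborel (heat (?\<delta> n) :: 'a \<Rightarrow> real)" by (rule integrable_heat) simp
    have "form_integrable (heat (?\<delta> n)) (\<lambda>x. sgn (g x)) g"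
      by (rule form_integrable_bounded[OF k _ _ sgn1 g]) auto
    from form_iterated'[OF this] have "form (heat (?\<delta> n)) (\<lambda>x. sgn (g x)) g = (LBINT y. ?u y * g y)"
      by (simp add: mult.commute)
    also have "\<dots> \<le> \<bar>\<integral>y. ?u y * g y \<partial>lborel\<bar>" by simp
    also have "\<dots> \<le> M * ?m"
    proof (rule test)
      show "continuous_on UNIV ?u" by (rule continuous_on_correlation[OF k _ sgn1]) measurable
      fix y :: 'a
      have ky: "integrable lborel (\<lambda>x. heat (?\<delta> n) (x - y))" by (rule integrable_lborel_shift[OF k])
      have "\<bar>?u y\<bar> \<le> (LBINT x. \<bar>heat (?\<delta> n) (x - y) * sgn (g x)\<bar>)" by (rule integral_abs_bound)
      also have "\<dots> \<le> (LBINT x. heat (?\<delta> n) (x - y))"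
      proof (rule integral_mono[OF _ ky])
        show "integrable lborel (\<lambda>x. \<bar>heat (?\<delta> n) (x - y) * sgn (g x)\<bar>)"
          using integrable_mult_bounded[OF ky _ sgn1] by simp
        show "\<bar>heat (?\<delta> n) (x - y) * sgn (g x)\<bar> \<le> heat (?\<delta> n) (x - y)" for x
          using mult_left_mono[OF sgn1 heat_nonneg, of "?\<delta> n" "x - y" x] by (simp add: abs_mult)
      qed
      also have "\<dots> = ?m" using integral_heat[of "?\<delta> n", where 'a='a] integral_lborel_shift[of "heat (?\<delta> n)" y] by simp
      finally show "\<bar>?u y\<bar> \<le> ?m" .
    qed
    finally show ?thesis .
  qed
  ultimately have "?m * (LBINT x. sgn (g x) * g x) \<le> M * ?m" by (intro LIMSEQ_le_const2) auto
  moreover have "(LBINT x. sgn (g x) * g x) = (LBINT x. \<bar>g x\<bar>)" by (simp add: abs_sgn mult.commute)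
  ultimately show ?thesis using heat_mass_pos[where 'a='a] by (simp add: mult.commute)
qed

lemma finite_strip_integral_integrable:
  fixes h :: "real \<Rightarrow> 'a::euclidean_space \<Rightarrow> real"
  assumes "finite_strip_integral t0 t1 h" and F: "F \<in> borel_measurable borel"
    and le: "\<And>p. \<bar>F p\<bar> \<le> indicator ({t0..t1} \<times> UNIV) p * h (fst p) (snd p)"
  shows "integrable lborel F"
proof -
  have "(\<integral>\<^sup>+p. ennreal (norm (F p)) \<partial>lborel)
      \<le> (\<integral>\<^sup>+p. indicator ({t0..t1} \<times> UNIV) p * ennreal (h (fst p) (snd p)) \<partial>lborel)"
  proof (intro nn_integral_mono)
    fix p :: "real \<times> 'a"
    show "ennreal (norm (F p)) \<le> indicator ({t0..t1} \<times> UNIV) p * ennreal (h (fst p) (snd p))"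
      using le[of p] by (cases "p \<in> {t0..t1} \<times> UNIV") (auto intro: ennreal_leI)
  qed
  also have "\<dots> < \<infinity>" using assms(1) unfolding finite_strip_integral_def .
  finally show ?thesis using F by (simp add: integrable_iff_bounded)
qed

text \<open>Subtracting the two equations removes the initial datum. At almost every time the
  difference of the two pairings with \<open>laplacian \<phi> x * a s x\<close> is an integral
  against the density, which turns the right-hand side into a space-time integral of
  \<open>w\<close>.\<close>

lemma weak_formulation_density:
  fixes a zt :: "real \<Rightarrow> 'a::euclidean_space \<Rightarrow> real"
  assumes fin1: "\<And>t. t \<in> {0..T} \<Longrightarrow> fin_smeasure (z1 t)" and fin2: "\<And>t. t \<in> {0..T} \<Longrightarrow> fin_smeasure (z2 t)"
    and sol1: "dist_solution T a z0 z1" and sol2: "dist_solution T a z0 z2"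
    and D: "D \<subseteq> {0<..T}" "AE s in lborel. s \<in> {0..T} \<longrightarrow> s \<in> D"
    and dens: "\<And>t. t \<in> D \<Longrightarrow> integrable lborel (zt t)"
      "\<And>t A. t \<in> D \<Longrightarrow> A \<in> sets borel \<Longrightarrow> sval (z1 t) A - sval (z2 t) A = (LINT x:A|lborel. zt t x)"
    and \<phi>: "schwartz \<phi>" "\<phi> \<in> borel_measurable borel" "\<And>x. \<bar>\<phi> x\<bar> \<le> B"
    and w: "\<And>s y. w (s, y) = indicator D s * (a s y * zt s y)"
    and int: "integrable lborel (\<lambda>p. laplacian \<phi> (snd p) * w p)"
    and t: "t \<in> D"
  shows "(LBINT y. \<phi> y * zt t y) = (LBINT p. indicator {..t} (fst p) * (laplacian \<phi> (snd p) * w p))"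
proof -
  have t0T: "t \<in> {0..T}" using t D(1) by auto
  let ?k = "\<lambda>z s. sint (z s) (\<lambda>x. laplacian \<phi> x * a s x)"
  have "(LBINT y. \<phi> y * zt t y) = sint (z1 t) \<phi> - sint (z2 t) \<phi>"
  proof (rule sint_diff_density[symmetric, OF fin1[OF t0T] fin2[OF t0T] dens(1)[OF t] dens(2)[OF t]])
    show "sintegrable (z1 t) \<phi>" "sintegrable (z2 t) \<phi>"
      by (rule integrable_bounded_fin_smeasure[OF _ \<phi>(2,3)], rule fin1 fin2, rule t0T)+
    show "integrable lborel (\<lambda>x. \<phi> x * zt t x)"
      using integrable_mult_bounded[OF dens(1)[OF t] \<phi>(2,3)] by (simp add: mult.commute)
  qed
  also have "\<dots> = (LINT s:{0..t}|lborel. ?k z1 s) - (LINT s:{0..t}|lborel. ?k z2 s)"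
    using sol1 sol2 \<phi>(1) t0T by (simp add: dist_solution_def)
  also have "\<dots> = (LINT s:{0..t}|lborel. ?k z1 s - ?k z2 s)"
  proof (rule set_integral_diff(2)[symmetric])
    have 1: "set_integrable lborel {0..T} (?k z1)" and 2: "set_integrable lborel {0..T} (?k z2)"
      using sol1 sol2 \<phi>(1) by (auto simp: dist_solution_def)
    show "set_integrable lborel {0..t} (?k z1)" "set_integrable lborel {0..t} (?k z2)"
      using t0T by (auto intro: set_integrable_subset[OF 1] set_integrable_subset[OF 2])
  qed
  also have "\<dots> = (LBINT s. indicator {..t} s * (LBINT y. laplacian \<phi> y * w (s, y)))"
    unfolding set_lebesgue_integral_def
  proof (rule integral_cong_AE)
    show "(\<lambda>s. indicator {0..t} s *\<^sub>R (?k z1 s - ?k z2 s)) \<in> borel_measurable lborel"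
    proof -
      have 1: "set_integrable lborel {0..T} (?k z1)" and 2: "set_integrable lborel {0..T} (?k z2)"
        using sol1 sol2 \<phi>(1) by (auto simp: dist_solution_def)
      have "set_integrable lborel {0..t} (\<lambda>s. ?k z1 s - ?k z2 s)"
        using t0T by (intro set_integral_diff(1) set_integrable_subset[OF 1] set_integrable_subset[OF 2]) auto
      then show ?thesis by (auto simp: set_integrable_def)
    qed
    show "(\<lambda>s. indicator {..t} s * (LBINT y. laplacian \<phi> y * w (s, y))) \<in> borel_measurable lborel"
      using borel_measurable_integrable[OF integral_lborel_pair(2)[OF int]] by simp
    have s1: "AE s in lborel. s \<in> {0..T} \<longrightarrow> sintegrable (z1 s) (\<lambda>x. laplacian \<phi> x * a s x)"
      and s2: "AE s in lborel. s \<in> {0..T} \<longrightarrow> sintegrable (z2 s) (\<lambda>x. laplacian \<phi> x * a s x)"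
      using sol1 sol2 \<phi>(1) by (auto simp: dist_solution_def)
    have s3: "AE s in lborel. integrable lborel (\<lambda>y. laplacian \<phi> y * w (s, y))"
      using integral_lborel_pair(3)[OF int] by simp
    show "AE s in lborel. indicator {0..t} s *\<^sub>R (?k z1 s - ?k z2 s) = indicator {..t} s * (LBINT y. laplacian \<phi> y * w (s, y))"
      using s1 s2 s3 D(2)
    proof eventually_elim
      case (elim s)
      show ?case
      proof (cases "s \<in> {0..t}")
        case True
        then have sT: "s \<in> {0..T}" using t0T by auto
        then have sD: "s \<in> D" using elim by blast
        have eq: "laplacian \<phi> x * a s x * zt s x = laplacian \<phi> x * w (s, x)" for x using sD by (simp add: w)
        have "?k z1 s - ?k z2 s = (LBINT x. laplacian \<phi> x * a s x * zt s x)"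
          using elim(1,2,3) sT unfolding eq[symmetric]
          by (intro sint_diff_density[OF fin1[OF sT] fin2[OF sT] dens(1)[OF sD] dens(2)[OF sD]]) auto
        then show ?thesis using True by (simp add: eq)
      next
        case False
        \<comment> \<open>A time in \<open>{..t}\<close> but outside \<open>{0..t}\<close> is
          negative, hence outside \<open>D\<close>, and \<open>w\<close> vanishes off
          \<open>D\<close>.\<close>
        then have "s \<notin> {..t} \<or> w (s, y) = 0" for y using D(1) by (auto simp: w indicator_def)
        then show ?thesis using False by (auto simp: indicator_def)
      qed
    qed
  qed
  also have "\<dots> = (LBINT p. indicator {..t} (fst p) * (laplacian \<phi> (snd p) * w p))"
  proof -
    have [measurable]: "(\<lambda>p. laplacian \<phi> (snd p) * w p) \<in> borel_measurable borel" using int by auto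
    have "integrable lborel (\<lambda>p. indicator {..t} (fst p) * (laplacian \<phi> (snd p) * w p))"
      by (rule Bochner_Integration.integrable_bound[OF int]) (auto simp: indicator_def)
    from integral_lborel_pair(1)[OF this] show ?thesis by simp
  qed
  finally show ?thesis .
qed

text \<open>Each part of the majorant of \<open>w\<close> uses one property of the Gaussian: the
  part bounded in space-time its integrability, the integrable part its boundedness.\<close>

lemma integrable_gauss_bounded_mult:
  fixes w w1 :: "real \<times> 'a::euclidean_space \<Rightarrow> real"
  assumes \<psi>: "gauss_bounded \<psi>" and [measurable]: "w \<in> borel_measurable borel"
    and w1: "integrable lborel w1" and le: "\<And>s y. \<bar>w (s, y)\<bar> \<le> indicator {0..T} s + w1 (s, y)"
  shows "integrable lborel (\<lambda>p. \<psi> (snd p - x0) * w p)"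
proof -
  have [measurable]: "\<psi> \<in> borel_measurable borel" using \<psi> by (simp add: gauss_bounded_def)
  obtain C c where C: "C \<ge> 0" "c > 0" "\<And>x. \<bar>\<psi> x\<bar> \<le> C * gauss c x" using \<psi> by (auto simp: gauss_bounded_def)
  have g: "integrable lborel (\<lambda>x::'a. gauss c (x - x0))" by (intro integrable_lborel_shift integrable_gauss C)
  have i1: "integrable lborel (\<lambda>p::real \<times> 'a. gauss c (snd p - x0) * indicator {0..T} (fst p))"
  proof -
    have "integrable (lborel \<Otimes>\<^sub>M lborel) (\<lambda>p::real \<times> 'a. gauss c (snd p - x0) * indicator {0..T} (fst p))"
    proof (rule integrable_lborel_pairI)
      have "(\<integral>\<^sup>+s. \<integral>\<^sup>+y. ennreal \<bar>gauss c (y - x0) * indicator {0..T} s\<bar> \<partial>lborel \<partial>lborel)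
        = (\<integral>\<^sup>+s. \<integral>\<^sup>+y. ennreal (gauss c (y - x0)) * indicator {0..T} s \<partial>lborel \<partial>(lborel :: real measure))"
        by (intro nn_integral_cong) (auto simp: indicator_def)
      also have "\<dots> = (\<integral>\<^sup>+y. ennreal (gauss c (y - x0)) \<partial>lborel) * emeasure lborel {0..T}"
        by (simp add: nn_integral_cmult nn_integral_multc)
      also have "\<dots> < \<infinity>" using g by (cases "0 \<le> T") (auto simp: integrable_iff_bounded ennreal_mult_less_top)
      finally show "(\<integral>\<^sup>+s. \<integral>\<^sup>+y. ennreal \<bar>gauss c (snd (s, y) - x0) * indicator {0..T} (fst (s, y))\<bar> \<partial>lborel \<partial>lborel) < \<infinity>"
        by simp
    qed measurable
    then show ?thesis by (simp add: lborel_prod)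
  qed
  show ?thesis
  proof (rule Bochner_Integration.integrable_bound)
    show "integrable lborel (\<lambda>p. C * (gauss c (snd p - x0) * indicator {0..T} (fst p)) + C * \<bar>w1 p\<bar>)"
      using i1 w1 by auto
    show "AE p in lborel. norm (\<psi> (snd p - x0) * w p) \<le> norm (C * (gauss c (snd p - x0) * indicator {0..T} (fst p)) + C * \<bar>w1 p\<bar>)"
    proof (intro AE_I2)
      fix p :: "real \<times> 'a"
      have "\<bar>w p\<bar> \<le> indicator {0..T} (fst p) + \<bar>w1 p\<bar>" using le[of "fst p" "snd p"] by simp
      then have "norm (\<psi> (snd p - x0) * w p) \<le> (C * gauss c (snd p - x0)) * (indicator {0..T} (fst p) + \<bar>w1 p\<bar>)"
        unfolding real_norm_def abs_mult using C by (intro mult_mono) auto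
      also have "\<dots> \<le> C * (gauss c (snd p - x0) * indicator {0..T} (fst p)) + C * \<bar>w1 p\<bar>"
        using C(1) mult_left_le_one_le[of "\<bar>w1 p\<bar>" "gauss c (snd p - x0)"] gauss_le_1[of c "snd p - x0"] C(2)
        by (simp add: distrib_left mult.assoc mult_left_mono)
      finally show "norm (\<psi> (snd p - x0) * w p) \<le> norm (C * (gauss c (snd p - x0) * indicator {0..T} (fst p)) + C * \<bar>w1 p\<bar>)"
        by simp
    qed
  qed measurable
qed

lemma nn_integral_gauss_pair_L1:
  fixes w :: "real \<times> 'a::euclidean_space \<Rightarrow> real"
  assumes w: "integrable lborel w" and c: "c > 0"
  shows "(\<integral>\<^sup>+p. \<integral>\<^sup>+q. ennreal (gauss c (snd q - snd p) * \<bar>w p\<bar> * \<bar>w q\<bar>) \<partial>lborel \<partial>lborel) < \<infinity>"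
proof -
  have [measurable]: "w \<in> borel_measurable borel" using w by auto
  have "(\<integral>\<^sup>+p. \<integral>\<^sup>+q. ennreal (gauss c (snd q - snd p) * \<bar>w p\<bar> * \<bar>w q\<bar>) \<partial>lborel \<partial>lborel)
     \<le> (\<integral>\<^sup>+p. \<integral>\<^sup>+q. ennreal \<bar>w p\<bar> * ennreal \<bar>w q\<bar> \<partial>lborel \<partial>lborel)"
  proof (intro nn_integral_mono)
    fix p q :: "real \<times> 'a"
    have "gauss c (snd q - snd p) * (\<bar>w p\<bar> * \<bar>w q\<bar>) \<le> 1 * (\<bar>w p\<bar> * \<bar>w q\<bar>)"
      using c by (intro mult_right_mono gauss_le_1) auto
    then show "ennreal (gauss c (snd q - snd p) * \<bar>w p\<bar> * \<bar>w q\<bar>) \<le> ennreal \<bar>w p\<bar> * ennreal \<bar>w q\<bar>"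
      by (simp add: ennreal_mult'[symmetric] mult.assoc ennreal_leI)
  qed
  also have "\<dots> = (\<integral>\<^sup>+p. ennreal \<bar>w p\<bar> \<partial>lborel) * (\<integral>\<^sup>+q. ennreal \<bar>w q\<bar> \<partial>lborel)"
    by (simp add: nn_integral_cmult nn_integral_multc)
  also have "\<dots> < \<infinity>" using w by (simp add: integrable_iff_bounded ennreal_mult_less_top)
  finally show ?thesis .
qed

text \<open>The Gaussian decays in space only, so integrability in time comes from \<open>w\<close>
  vanishing outside \<open>[0,T]\<close>. Young's inequality reduces the product to two terms that
  the exchange of \<open>p\<close> and \<open>q\<close> shows to be equal.\<close>

lemma nn_integral_gauss_pair_L2:
  fixes w :: "real \<times> 'a::euclidean_space \<Rightarrow> real"
  assumes [measurable]: "w \<in> borel_measurable borel" and w: "integrable lborel (\<lambda>p. (w p)\<^sup>2)"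
    and out: "\<And>s y. s \<notin> {0..T} \<Longrightarrow> w (s, y) = 0" and c: "c > 0"
  shows "(\<integral>\<^sup>+p. \<integral>\<^sup>+q. ennreal (gauss c (snd q - snd p) * \<bar>w p\<bar> * \<bar>w q\<bar>) \<partial>lborel \<partial>lborel) < \<infinity>"
proof -
  let ?e = "\<lambda>p q :: real \<times> 'a. ennreal ((w p)\<^sup>2) * (ennreal (gauss c (snd q - snd p)) * indicator {0..T} (fst q))"
  let ?J = "\<integral>\<^sup>+p. \<integral>\<^sup>+q. ?e p q \<partial>lborel \<partial>lborel"
  have gauss_comm: "gauss c (x - y) = gauss c (y - x)" for x y :: 'a by (simp add: gauss_def norm_minus_commute)
  have inner: "(\<integral>\<^sup>+q. ennreal (gauss c (snd q - x)) * indicator {0..T} (fst q) \<partial>lborel)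
      = emeasure lborel {0..T} * (\<integral>\<^sup>+y. gauss c (y::'a) \<partial>lborel)" for x :: 'a
  proof -
    have "(\<integral>\<^sup>+q. ennreal (gauss c (snd q - x)) * indicator {0..T} (fst q) \<partial>lborel)
        = (\<integral>\<^sup>+s. \<integral>\<^sup>+y. ennreal (gauss c (y - x)) * indicator {0..T} s \<partial>lborel \<partial>lborel)"
      by (subst nn_integral_lborel_pair) auto
    then show ?thesis
      by (simp add: nn_integral_cmult nn_integral_multc mult.commute nn_integral_lborel_shift[of "\<lambda>y. ennreal (gauss c y)"])
  qed
  have "?J = (\<integral>\<^sup>+p. ennreal ((w p)\<^sup>2) \<partial>lborel) * (emeasure lborel {0..T} * (\<integral>\<^sup>+y. gauss c (y::'a) \<partial>lborel))"
    by (simp add: nn_integral_cmult nn_integral_multc inner)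
  also have "\<dots> < \<infinity>"
    using w integrable_gauss[OF c, where 'a='a]
    by (cases "0 \<le> T") (auto simp: integrable_iff_bounded ennreal_mult_less_top)
  finally have J: "?J < \<infinity>" .
  have "(\<integral>\<^sup>+p. \<integral>\<^sup>+q. ennreal (gauss c (snd q - snd p) * \<bar>w p\<bar> * \<bar>w q\<bar>) \<partial>lborel \<partial>lborel)
     \<le> (\<integral>\<^sup>+p. \<integral>\<^sup>+q. ?e p q + ?e q p \<partial>lborel \<partial>lborel)"
  proof (intro nn_integral_mono)
    fix p q :: "real \<times> 'a"
    show "ennreal (gauss c (snd q - snd p) * \<bar>w p\<bar> * \<bar>w q\<bar>) \<le> ?e p q + ?e q p"
    proof (cases "w p = 0 \<or> w q = 0")
      case False
      then have ind: "fst p \<in> {0..T}" "fst q \<in> {0..T}"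
        using out[of "fst p" "snd p"] out[of "fst q" "snd q"] by auto
      have "2 * (\<bar>w p\<bar> * \<bar>w q\<bar>) \<le> (w p)\<^sup>2 + (w q)\<^sup>2"
        using zero_le_power2[of "\<bar>w p\<bar> - \<bar>w q\<bar>"] by (simp add: power2_diff)
      moreover have "0 \<le> \<bar>w p\<bar> * \<bar>w q\<bar>" by simp
      ultimately have "\<bar>w p\<bar> * \<bar>w q\<bar> \<le> (w p)\<^sup>2 + (w q)\<^sup>2" by linarith
      from mult_left_mono[OF this, of "gauss c (snd q - snd p)"]
      have "gauss c (snd q - snd p) * \<bar>w p\<bar> * \<bar>w q\<bar> \<le> (w p)\<^sup>2 * gauss c (snd q - snd p) + (w q)\<^sup>2 * gauss c (snd p - snd q)"
        by (simp add: gauss_comm[of "snd p" "snd q"] algebra_simps)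
      then show ?thesis using ind
        by (simp add: ennreal_mult'[symmetric] ennreal_plus[symmetric] ennreal_leI del: ennreal_plus)
    qed auto
  qed
  also have "\<dots> = ?J + (\<integral>\<^sup>+p. \<integral>\<^sup>+q. ?e q p \<partial>lborel \<partial>lborel)"
    by (simp add: nn_integral_add)
  also have "(\<integral>\<^sup>+p. \<integral>\<^sup>+q. ?e q p \<partial>lborel \<partial>lborel) = ?J"
    by (rule lborel_pair.Fubini') (simp add: lborel_prod case_prod_unfold)
  also have "?J + ?J < \<infinity>" using J by simp
  finally show ?thesis .
qed

text \<open>Within any distance \<open>e\<close> of a point of \<open>[0,T]\<close> lies an open
  interval of positive length inside \<open>[0,T]\<close>, one-sided at the endpoints; a null set
  cannot contain it.\<close>

lemma closure_full_measure:
  fixes D :: "real set"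
  assumes "T > 0" and D: "D \<subseteq> {0..T}" and N: "N \<in> null_sets lborel" "{0<..T} - N \<subseteq> D"
  shows "closure D = {0..T}"
proof
  show "closure D \<subseteq> {0..T}" using D by (rule closure_minimal) simp
  show "{0..T} \<subseteq> closure D"
  proof
    fix t assume t: "t \<in> {0..T}"
    show "t \<in> closure D"
      unfolding closure_approachable
    proof (intro allI impI)
      fix e :: real assume e: "e > 0"
      define l u where "l = max 0 (t - e)" and "u = min T (t + e)"
      have "0 \<le> t" "t \<le> T" using t by auto
      then have lu: "l < u" "0 \<le> l" "u \<le> T" "t - e \<le> l" "u \<le> t + e"
        unfolding l_def u_def using e \<open>T > 0\<close> by linarith+
      have "\<not> {l<..<u} \<subseteq> N"
      proof
        assume "{l<..<u} \<subseteq> N"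
        then have "emeasure lborel {l<..<u} = 0"
          by (rule emeasure_eq_0[OF null_setsD2[OF N(1)] null_setsD1[OF N(1)]])
        moreover have "emeasure lborel {l<..<u} = ennreal (u - l)"
          using lu(1) by (intro emeasure_lborel_Ioo) simp
        ultimately show False using lu(1) by (simp add: ennreal_eq_0_iff)
      qed
      then obtain s where s: "s \<in> {l<..<u}" "s \<notin> N" by blast
      then have "s \<in> {0<..T} - N" using lu by simp
      then have "s \<in> D" using N(2) by blast
      moreover have "dist s t < e" using s(1) lu by (simp add: dist_real_def abs_less_iff)
      ultimately show "\<exists>s\<in>D. dist s t < e" by blast
    qed
  qed
qed

theorem theorem3p1:
  fixes T :: real
    and a :: "real \<Rightarrow> 'a::euclidean_space \<Rightarrow> real"
    and z0 :: "'a smeasure"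
    and z1 z2 :: "real \<Rightarrow> 'a smeasure"
    and zt :: "real \<Rightarrow> 'a \<Rightarrow> real"
  assumes T_pos: "T > 0"
    and a_borel: "(\<lambda>p. a (fst p) (snd p)) \<in> borel_measurable (borel :: (real \<times> 'a) measure)"
    and a_nonneg: "\<And>t x. t \<in> {0..T} \<Longrightarrow> a t x \<ge> 0"
    and z0_meas: "fin_smeasure z0"
    and z1_meas: "\<And>t. t \<in> {0..T} \<Longrightarrow> fin_smeasure (z1 t)"
    and z2_meas: "\<And>t. t \<in> {0..T} \<Longrightarrow> fin_smeasure (z2 t)"
    and z1_cont: "weakly_continuous_on {0..T} z1"
    and z2_cont: "weakly_continuous_on {0..T} z2"
    and z1_sol: "dist_solution T a z0 z1"
    and z2_sol: "dist_solution T a z0 z2"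
    and zt_loc: "L1_loc_strip T zt"
    and zt_density: "AE t in lborel. t \<in> {0..T} \<longrightarrow>
          integrable lborel (zt t) \<and>
          (\<forall>A\<in>sets borel. sval (z1 t) A - sval (z2 t) A = (LINT x:A|lborel. zt t x))"
    and B: "(finite_strip_integral 0 T (\<lambda>t x. (zt t x)\<^sup>2) \<and>
             finite_strip_integral 0 T (\<lambda>t x. (a t x * zt t x)\<^sup>2))
          \<or> (DIM('a) = 1 \<and>
             (\<forall>t0>0. finite_strip_integral t0 T (\<lambda>t x. (zt t x)\<^sup>2) \<and>
                     finite_strip_integral 0 T (\<lambda>t x. \<bar>a t x * zt t x\<bar>) \<and>
                     finite_strip_integral t0 T (\<lambda>t x. (a t x * zt t x)\<^sup>2)))"
  shows "\<forall>t\<in>{0..T}. \<forall>A\<in>sets borel. sval (z1 t) A - sval (z2 t) A = 0"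
proof -
  have zt_meas[measurable]: "(\<lambda>p. zt (fst p) (snd p)) \<in> borel_measurable borel"
    using zt_loc by (simp add: L1_loc_strip_def)
  note a_borel[measurable]
  obtain N where N: "N \<in> null_sets lborel"
    and sub: "\<And>t. t \<in> space lborel - N \<Longrightarrow> t \<in> {0..T} \<longrightarrow> integrable lborel (zt t) \<and>
          (\<forall>A\<in>sets borel. sval (z1 t) A - sval (z2 t) A = (LINT x:A|lborel. zt t x))"
    using AE_E3[OF zt_density] by metis
  \<comment> \<open>Time \<open>0\<close> is discarded along with the exceptional null set, so that
    \<open>w\<close> vanishes at nonpositive times.\<close>
  define D where "D = {0<..T} - N"
  have DT: "D \<subseteq> {0<..T}" and DT': "D \<subseteq> {0..T}" by (auto simp: D_def)
  have D_sets[measurable]: "D \<in> sets borel" using N unfolding D_def by auto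
  have dens: "integrable lborel (zt t)"
      "\<And>A. A \<in> sets borel \<Longrightarrow> sval (z1 t) A - sval (z2 t) A = (LINT x:A|lborel. zt t x)" if "t \<in> D" for t
  proof -
    have *: "t \<in> space lborel - N" "t \<in> {0..T}" using that by (auto simp: D_def)
    note P = sub[OF *(1), THEN mp, OF *(2)]
    show "integrable lborel (zt t)" using P by (rule conjunct1)
    show "sval (z1 t) A - sval (z2 t) A = (LINT x:A|lborel. zt t x)" if "A \<in> sets borel" for A
      using conjunct2[OF P] that by (rule bspec)
  qed
  have D_AE: "AE s in lborel. s \<in> {0..T} \<longrightarrow> s \<in> D"
  proof -
    have "AE s in lborel. s \<notin> N" using N by (rule AE_not_in)
    then show ?thesis using AE_lborel_singleton[of "0::real"] by eventually_elim (auto simp: D_def)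
  qed
  have D_closure: "closure D = {0..T}"
    by (rule closure_full_measure[OF T_pos DT' N]) (simp add: D_def)

  \<comment> \<open>Cutting off to \<open>D\<close> turns properties valid at almost every time into
    properties of every slice, as the locale demands.\<close>
  define f where "f p = indicator D (fst p) * zt (fst p) (snd p)" for p
  define w where "w p = indicator D (fst p) * (a (fst p) (snd p) * zt (fst p) (snd p))" for p
  have f_meas[measurable]: "f \<in> borel_measurable borel" unfolding f_def by measurable
  have w_meas[measurable]: "w \<in> borel_measurable borel" unfolding w_def by measurable

  have test: "sint (z1 t) u - sint (z2 t) u = (LBINT x. u x * zt t x)"
    if t: "t \<in> D" and u: "continuous_on UNIV u" "\<And>x. \<bar>u x\<bar> \<le> C" for t u C
  proof -
    have tT: "t \<in> {0..T}" using t DT' by auto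
    have um: "u \<in> borel_measurable borel" by (rule borel_measurable_continuous_onI[OF u(1)])
    have "integrable lborel (\<lambda>x. u x * zt t x)"
      using integrable_mult_bounded[OF dens(1)[OF t] um u(2)] by (simp add: mult.commute)
    then show ?thesis
      by (intro sint_diff_density[OF z1_meas[OF tT] z2_meas[OF tT] dens[OF t]]
          integrable_bounded_fin_smeasure[OF z1_meas[OF tT] um u(2)] integrable_bounded_fin_smeasure[OF z2_meas[OF tT] um u(2)])
  qed
  obtain M1 where M1: "M1 \<ge> 0" "\<And>t u B. t \<in> {0..T} \<Longrightarrow> continuous_on UNIV u \<Longrightarrow> (\<And>x. \<bar>u x\<bar> \<le> B) \<Longrightarrow> \<bar>sint (z1 t) u\<bar> \<le> M1 * B"
    using weakly_continuous_uniform_bound[OF z1_meas z1_cont] by metis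
  obtain M2 where M2: "M2 \<ge> 0" "\<And>t u B. t \<in> {0..T} \<Longrightarrow> continuous_on UNIV u \<Longrightarrow> (\<And>x. \<bar>u x\<bar> \<le> B) \<Longrightarrow> \<bar>sint (z2 t) u\<bar> \<le> M2 * B"
    using weakly_continuous_uniform_bound[OF z2_meas z2_cont] by metis
  \<comment> \<open>The L1 norm of the density is at most the sum of the two uniform bounds, since
    each bounds its measure on every continuous test function.\<close>
  have zt_norm: "(LBINT x. \<bar>zt t x\<bar>) \<le> M1 + M2" if t: "t \<in> D" for t
  proof (rule L1_norm_le_of_continuous_tests[OF dens(1)[OF t]])
    fix u :: "'a \<Rightarrow> real" and C assume u: "continuous_on UNIV u" "\<And>x. \<bar>u x\<bar> \<le> C"
    have tT: "t \<in> {0..T}" using t DT' by auto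
    show "\<bar>\<integral>x. u x * zt t x \<partial>lborel\<bar> \<le> (M1 + M2) * C"
      using M1(2)[OF tT u] M2(2)[OF tT u] test[OF t u] by (simp add: distrib_right)
  qed
  have f_int: "integrable lborel (\<lambda>y. f (s, y))" for s
    using dens(1)[of s] by (cases "s \<in> D") (auto simp: f_def)
  have f_norm: "(LBINT y. \<bar>f (s, y)\<bar>) \<le> M1 + M2" for s
    using zt_norm[of s] M1(1) M2(1) by (cases "s \<in> D") (auto simp: f_def)
  have fw: "w p * f p \<ge> 0" for p
  proof -
    have "fst p \<in> D \<Longrightarrow> 0 \<le> a (fst p) (snd p) * (zt (fst p) (snd p) * zt (fst p) (snd p))"
      using DT' by (intro mult_nonneg_nonneg[OF a_nonneg]) auto
    then show ?thesis by (auto simp: w_def f_def indicator_def mult_ac)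
  qed
  have w_out: "w (s, y) = 0" if "s \<notin> D" for s y using that by (simp add: w_def)

  have w2: "integrable lborel (\<lambda>p. indicator {t0<..} (fst p) * (w p)\<^sup>2)"
    if "finite_strip_integral t0 T (\<lambda>t x. (a t x * zt t x)\<^sup>2)" for t0
    by (rule finite_strip_integral_integrable[OF that]) (use DT in \<open>auto simp: w_def indicator_def\<close>)
  have f2: "integrable lborel (\<lambda>p. indicator {t0<..} (fst p) * (f p)\<^sup>2)"
    if "finite_strip_integral t0 T (\<lambda>t x. (zt t x)\<^sup>2)" for t0
    by (rule finite_strip_integral_integrable[OF that]) (use DT in \<open>auto simp: f_def indicator_def\<close>)

  have energy: "heat_energy T (M1 + M2) D f w w1"
    if w1: "integrable lborel w1" "\<And>p. w1 p \<ge> 0"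
      and w_le: "\<And>\<eta> s y. \<eta> \<ge> 1 \<Longrightarrow> \<bar>w (s, y)\<bar> \<le> indicator {0..T} s / \<eta> + \<eta> * w1 (s, y)"
      and ww: "\<And>c. c > 0 \<Longrightarrow> (\<integral>\<^sup>+p. \<integral>\<^sup>+q. ennreal (gauss c (snd q - snd p) * \<bar>w p\<bar> * \<bar>w q\<bar>) \<partial>lborel \<partial>lborel) < \<infinity>"
    for w1 :: "real \<times> 'a \<Rightarrow> real"
  proof unfold_locales
    have wint: "integrable lborel (\<lambda>p. \<psi> (snd p - x0) * w p)" if "gauss_bounded \<psi>" for \<psi> x0
      using w_le[of 1] by (intro integrable_gauss_bounded_mult[OF that w_meas w1(1), where T=T]) simp
    have wf: "(LBINT y. \<phi> y * f (t, y)) = (LBINT p. indicator {..t} (fst p) * (laplacian \<phi> (snd p) * w p))"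
      if t: "t \<in> D" and \<phi>: "schwartz \<phi>" "\<phi> \<in> borel_measurable borel" "\<And>x. \<bar>\<phi> x\<bar> \<le> C"
        "integrable lborel (\<lambda>p. laplacian \<phi> (snd p) * w p)" for t \<phi> C
    proof -
      have ft: "f (t, y) = zt t y" for y using t by (simp add: f_def)
      have ws: "w (s, y) = indicator D s * (a s y * zt s y)" for s y by (simp add: w_def)
      show ?thesis unfolding ft
        by (rule weak_formulation_density[OF z1_meas z2_meas z1_sol z2_sol DT D_AE dens \<phi>(1-3) ws \<phi>(4) t])
    qed
    have bdd: "\<exists>C. \<forall>x. \<bar>K (x - x0)\<bar> \<le> C" if K: "gauss_bounded K" for K and x0 :: 'a
    proof -
      obtain C c where C: "C \<ge> 0" "c > 0" "\<And>x. \<bar>K x\<bar> \<le> C * gauss c x" using K by (auto simp: gauss_bounded_def)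
      have "\<bar>K x\<bar> \<le> C" for x
        using C(3)[of x] mult_left_mono[OF gauss_le_1[of c x] C(1)] C(2) by simp
      then show ?thesis by blast
    qed
    show "(LBINT y. heat r (y - x0) * f (t, y)) = (LBINT p. indicator {..t} (fst p) * (heat_dr r (snd p - x0) * w p))"
      if t: "t \<in> D" and r: "r > 0" for t r x0
    proof -
      obtain C where C: "\<And>x. \<bar>heat r (x - x0)\<bar> \<le> C" using bdd[OF gauss_bounded_heat[OF r]] by blast
      have m: "(\<lambda>x. heat r (x - x0)) \<in> borel_measurable borel" by measurable
      have i: "integrable lborel (\<lambda>p. laplacian (\<lambda>x. heat r (x - x0)) (snd p) * w p)"
        unfolding laplacian_heat[OF r] by (rule wint[OF gauss_bounded_heat_dr[OF r]])
      show ?thesis using wf[OF t schwartz_heat[OF r] m C i] unfolding laplacian_heat[OF r] .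
    qed
    show "(LBINT y. heat_dr r (y - x0) * f (t, y)) = (LBINT p. indicator {..t} (fst p) * (heat_drr r (snd p - x0) * w p))"
      if t: "t \<in> D" and r: "r > 0" for t r x0
    proof -
      obtain C where C: "\<And>x. \<bar>heat_dr r (x - x0)\<bar> \<le> C" using bdd[OF gauss_bounded_heat_dr[OF r]] by blast
      have m: "(\<lambda>x. heat_dr r (x - x0)) \<in> borel_measurable borel" by measurable
      have i: "integrable lborel (\<lambda>p. laplacian (\<lambda>x. heat_dr r (x - x0)) (snd p) * w p)"
        unfolding laplacian_heat_dr by (rule wint[OF gauss_bounded_heat_drr[OF r]])
      show ?thesis using wf[OF t schwartz_heat_dr[OF r] m C i] unfolding laplacian_heat_dr .
    qed
    show "0 \<le> M1 + M2" using M1(1) M2(1) by simp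
  qed (rule T_pos DT f_meas w_meas w_out f_int f_norm w1 w_le fw ww; assumption)+

  have vanish: "AE y in lborel. f (t, y) = 0" if t: "t \<in> D" for t
    using B
  proof
    assume B1: "finite_strip_integral 0 T (\<lambda>t x. (zt t x)\<^sup>2) \<and> finite_strip_integral 0 T (\<lambda>t x. (a t x * zt t x)\<^sup>2)"
    have pos: "indicator {0<..} (fst p) * (g p)\<^sup>2 = (g p)\<^sup>2" if "\<And>s y. s \<notin> D \<Longrightarrow> g (s, y) = 0" for g :: "real \<times> 'a \<Rightarrow> real" and p
      using that[of "fst p" "snd p"] DT by (cases "fst p \<in> D") auto
    have f_out: "f (s, y) = 0" if "s \<notin> D" for s y using that by (simp add: f_def)
    have pw: "indicator {0<..} (fst p) * (w p)\<^sup>2 = (w p)\<^sup>2" for p by (rule pos) (rule w_out)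
    have pf: "indicator {0<..} (fst p) * (f p)\<^sup>2 = (f p)\<^sup>2" for p by (rule pos) (rule f_out)
    have w2': "integrable lborel (\<lambda>p. (w p)\<^sup>2)" using w2[OF conjunct2[OF B1]] unfolding pw .
    have f2': "integrable lborel (\<lambda>p. (f p)\<^sup>2)" using f2[OF conjunct1[OF B1]] unfolding pf .
    interpret heat_energy T "M1 + M2" D f w "\<lambda>p. (w p)\<^sup>2"
    proof (rule energy[OF w2'])
      fix \<eta> s y assume \<eta>: "(\<eta>::real) \<ge> 1"
      \<comment> \<open>Where \<open>\<bar>w\<bar>\<close> is at most \<open>1 / \<eta>\<close> the
        first term suffices; where it is larger, \<open>\<eta> * \<bar>w\<bar> > 1\<close> and the
        quadratic term takes over.\<close>
      show "\<bar>w (s, y)\<bar> \<le> indicator {0..T} s / \<eta> + \<eta> * (w (s, y))\<^sup>2"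
      proof (cases "s \<in> D")
        case True
        then have s: "s \<in> {0..T}" using DT' by auto
        show ?thesis
        proof (cases "\<eta> * \<bar>w (s, y)\<bar> \<le> 1")
          case True
          then have "\<bar>w (s, y)\<bar> \<le> 1 / \<eta>" using \<eta> by (simp add: field_simps)
          moreover have "0 \<le> \<eta> * (w (s, y))\<^sup>2" using \<eta> by simp
          ultimately show ?thesis using s by simp
        next
          case False
          then have "1 * \<bar>w (s, y)\<bar> \<le> (\<eta> * \<bar>w (s, y)\<bar>) * \<bar>w (s, y)\<bar>" by (intro mult_right_mono) auto
          then have "\<bar>w (s, y)\<bar> \<le> \<eta> * (w (s, y))\<^sup>2" by (simp add: power2_eq_square mult.assoc)
          moreover have "0 \<le> indicator {0..T} s / \<eta>" using \<eta> by simp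
          ultimately show ?thesis by linarith
        qed
      next
        case False
        then show ?thesis using w_out \<eta> by simp
      qed
    next
      fix c :: real assume "c > 0"
      then show "(\<integral>\<^sup>+p. \<integral>\<^sup>+q. ennreal (gauss c (snd q - snd p) * \<bar>w p\<bar> * \<bar>w q\<bar>) \<partial>lborel \<partial>lborel) < \<infinity>"
        using DT' by (intro nn_integral_gauss_pair_L2[OF w_meas w2', where T=T] w_out) auto
    qed simp
    show ?thesis by (rule vanishing_L2[OF t w2' f2'])
  next
    assume B2: "DIM('a) = 1 \<and>
             (\<forall>t0>0. finite_strip_integral t0 T (\<lambda>t x. (zt t x)\<^sup>2) \<and>
                     finite_strip_integral 0 T (\<lambda>t x. \<bar>a t x * zt t x\<bar>) \<and>
                     finite_strip_integral t0 T (\<lambda>t x. (a t x * zt t x)\<^sup>2))"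
    \<comment> \<open>The bound on \<open>\<bar>a z\<bar>\<close> over the whole strip stands under
      the quantifier over \<open>t0\<close>; taking \<open>t0 = 1\<close> extracts it.\<close>
    then have "finite_strip_integral 0 T (\<lambda>t x. \<bar>a t x * zt t x\<bar>)" using zero_less_one by blast
    then have w1': "integrable lborel w"
      by (rule finite_strip_integral_integrable) (use DT in \<open>auto simp: w_def indicator_def\<close>)
    interpret heat_energy T "M1 + M2" D f w "\<lambda>p. \<bar>w p\<bar>"
    proof (rule energy)
      fix \<eta> s y assume \<eta>: "(\<eta>::real) \<ge> 1"
      have "1 * \<bar>w (s, y)\<bar> \<le> \<eta> * \<bar>w (s, y)\<bar>" using \<eta> by (intro mult_right_mono) auto
      moreover have "0 \<le> indicator {0..T} s / \<eta>" using \<eta> by simp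
      ultimately show "\<bar>w (s, y)\<bar> \<le> indicator {0..T} s / \<eta> + \<eta> * \<bar>w (s, y)\<bar>" by linarith
    next
      fix c :: real assume "c > 0"
      then show "(\<integral>\<^sup>+p. \<integral>\<^sup>+q. ennreal (gauss c (snd q - snd p) * \<bar>w p\<bar> * \<bar>w q\<bar>) \<partial>lborel \<partial>lborel) < \<infinity>"
        by (rule nn_integral_gauss_pair_L1[OF w1'])
    qed (use w1' in auto)
    have D_small: "\<exists>s\<in>D. s < e" if e: "e > 0" for e
    proof -
      have "0 \<in> closure D" using D_closure T_pos by simp
      then obtain s where "s \<in> D" "dist s 0 < e" using e by (auto simp: closure_approachable)
      then show ?thesis by (intro bexI[of _ s]) (auto simp: dist_real_def)
    qed
    show ?thesis by (rule vanishing_dim1[OF _ t D_small]) (use B2 w2 f2 in auto)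
  qed
  \<comment> \<open>The pairing is continuous in \<open>t\<close> and vanishes on \<open>D\<close>,
    which is dense in \<open>[0,T]\<close>; this recovers the times at which no density is
    known.\<close>
  have zero: "sint (z1 t) u - sint (z2 t) u = 0"
    if t: "t \<in> {0..T}" and u: "continuous_on UNIV u" "bounded (range u)" for t u
  proof (rule continuous_constant_on_closure[of D "\<lambda>t. sint (z1 t) u - sint (z2 t) u"])
    show "continuous_on (closure D) (\<lambda>t. sint (z1 t) u - sint (z2 t) u)"
      unfolding D_closure using z1_cont z2_cont u
      by (intro continuous_on_diff) (auto simp: weakly_continuous_on_def)
    show "t \<in> closure D" using t D_closure by simp
    fix s assume s: "s \<in> D"
    obtain C where "\<And>x. \<bar>u x\<bar> \<le> C" using u(2) by (auto simp: bounded_iff)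
    then have "sint (z1 s) u - sint (z2 s) u = (LBINT x. u x * zt s x)" by (rule test[OF s u(1)])
    also have "\<dots> = 0"
      using vanish[OF s] s by (intro integral_eq_zero_AE) (auto simp: f_def elim: eventually_mono)
    finally show "sint (z1 s) u - sint (z2 s) u = 0" .
  qed
  show ?thesis
  proof (intro ballI)
    fix t A assume t: "t \<in> {0..T}" and A: "A \<in> sets (borel :: 'a measure)"
    show "sval (z1 t) A - sval (z2 t) A = 0"
      by (rule sval_eq_of_sint_eq[OF z1_meas[OF t] z2_meas[OF t] _ A]) (use zero[OF t] in force)
  qed
qed

end
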